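(* For every integer $k\ge1$ the following identities hold: $$\sum_{r=0}^{k}(-1)^r\,\mathrm{str}_{1,\ldots,k}\;\mathcal{S}^q_r\,\mathcal{A}^q_{\{r+1,\ldots,k\}}\,L^{\pm}_1(z)L^{\pm}_2(zq^2)\cdots L^{\pm}_k(zq^{2k-2})=0,$$ $$\sum_{r=0}^{k}(-1)^r\,\mathrm{str}_{1,\ldots,k}\;\mathcal{A}^q_r\,\mathcal{S}^q_{\{r+1,\ldots,k\}}\,L^{\pm}_1(z)L^{\pm}_2(zq^2)\cdots L^{\pm}_k(zq^{2k-2})=0,$$ where $\mathcal{S}^q_r$, $\mathcal{A}^q_r$ act on the first $r$ copies of $\mathrm{End}\,\mathbb{C}^{M|N}$, and $\mathcal{A}^q_{\{r+1,\ldots,k\}}$, $\mathcal{S}^q_{\{r+1,\ldots,k\}}$ denote the $q$-antisymmetrizer and $q$-symmetrizer over the copies of $\mathrm{End}\,\mathbb{C}^{M|N}$ labeled by $r+1,\ldots,k$.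
   Context: Let $M,N\ge 0$ be integers with $M\ne N$. The base field is $\mathbb{C}(q)$ ($q$ is not a root of unity). For $1\le i\le M+N$ put $\bar i=0$ if $i\le M$ and $\bar i=1$ if $i>M$, and $q_i=q^{1-2\bar i}$. $\mathbb{C}^{M|N}$ is the superspace with basis $e_i$ of parity $\bar i$, and $E_{ij}\in\mathrm{End}\,\mathbb{C}^{M|N}$ are the matrix units (of parity $\bar i+\bar j$). Tensor products of superalgebras are graded: $(a\otimes b)(a'\otimes b')=(-1)^{|b||a'|}aa'\otimes bb'$. Put $R(z,w)=\sum_i (zq_i-wq_i^{-1})E_{ii}\otimes E_{ii}+(z-w)\sum_{i\ne j}E_{ii}\otimes E_{jj}+z\sum_{i<j}(q_j-q_j^{-1})E_{ij}\otimes E_{ji}+w\sum_{i>j}(q_j-q_j^{-1})E_{ij}\otimes E_{ji}$, $\overline R(x)=R(x,1)/(xq-q^{-1})$ and $R(x)=f(x)\overline R(x)$, where $f(x)=1+\sum_{k\ge1}f_kx^{-k}$ is the formal series uniquely determined by $f(xq^{2N-2M})=f(x)\frac{(1-xq^{-2})(1-xq^{2N-2M+2})}{(1-x)(1-xq^{2N-2M})}$; $R(x)$ is expanded in powers of $x^{-1}$. $\mathrm{U}_q(\widehat{\mathfrak{gl}}_{M|N})$ is the superalgebra over $\mathbb{C}(q)$ generated by $l_{ij}^{\pm(r)}$ ($1\le i,j\le M+N$, $r\ge 0$, parity $\bar i+\bar j$) and an invertible central even element $q^c$. Put $l_{ij}^{\pm}(z)=\sum_{r\ge0}l_{ij}^{\pm(r)}z^{\mp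 r}$, $L^{\pm}(z)=\sum_{i,j}l^{\pm}_{ij}(z)\otimes E_{ij}$, and let $L_a^\pm(z)$ denote $L^\pm(z)$ acting in the $a$-th copy of $\mathrm{End}\,\mathbb{C}^{M|N}$ in $\mathrm{U}_q(\widehat{\mathfrak{gl}}_{M|N})\otimes(\mathrm{End}\,\mathbb{C}^{M|N})^{\otimes k}$. The defining relations are: $l_{ji}^{+(0)}=l_{ij}^{-(0)}=0$ for $i<j$; $l_{ii}^{-(0)}l_{ii}^{+(0)}=l_{ii}^{+(0)}l_{ii}^{-(0)}=1$; $R(z/w)L_1^{\pm}(z)L_2^{\pm}(w)=L_2^{\pm}(w)L_1^{\pm}(z)R(z/w)$; $R(zq^{c}/w)L_1^{+}(z)L_2^{-}(w)=L_2^{-}(w)L_1^{+}(z)R(zq^{-c}/w)$. The supertrace is $\mathrm{str}(\sum a_{ij}E_{ij})=\sum_i(-1)^{\bar i}a_{ii}$, and $\mathrm{str}_{1,\ldots,k}$ is the supertrace over all $k$ copies of $\mathrm{End}\,\mathbb{C}^{M|N}$. Let $P=\sum_{i,j}(-1)^{\bar j}E_{ij}\otimes E_{ji}$ be the graded permutation, $R=R(1,0)$ (from the two-variable $R(z,w)$), and $\check R=PR$. The Hecke algebra $\mathcal{H}_m$ (generators $T_1,\dots,T_{m-1}$, relations $(T_i-q)(T_i+q^{-1})=0$, $T_iT_{i+1}T_i=T_{i+1}T_iT_{i+1}$, $T_iT_j=T_jT_i$ for $|i-j|>1$) acts on $(\mathbb{C}^{M|N})^{\otimes m}$ by $T_a\mapsto\check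 R_{a}=P_{a,a+1}R_{a,a+1}$. For $\sigma\in\mathfrak{S}_m$ with reduced decomposition $\sigma=\sigma_{i_1}\cdots\sigma_{i_l}$ in adjacent transpositions, $T_\sigma=T_{i_1}\cdots T_{i_l}$ and $l(\sigma)=l$. With $[n]_q=\frac{q^n-q^{-n}}{q-q^{-1}}$ and $[m]_q!=[1]_q\cdots[m]_q$, $$\mathcal{S}^q_m=\frac{q^{-m(m-1)/2}}{[m]_q!}\sum_{\sigma\in\mathfrak{S}_m}q^{l(\sigma)}T_\sigma,\qquad \mathcal{A}^q_m=\frac{q^{m(m-1)/2}}{[m]_q!}\sum_{\sigma\in\mathfrak{S}_m}(-q)^{-l(\sigma)}T_\sigma,$$ regarded as operators on the tensor space; the (anti)symmetrizer over an empty set of copies is $1$. *)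

theory Defs
  imports
    "HOL-Computational_Algebra.Computational_Algebra"
    "HOL-Library.Poly_Mapping"
    "HOL-Combinatorics.Permutations"
    "HOL-Algebra.QuotRing"
begin

section \<open>The base field\<close>

type_synonym cq = "complex poly fract"

definition qq :: cq where
  "qq = Fract [:0, 1:] 1"

definition qint :: "nat \<Rightarrow> cq" where
  "qint n = (qq ^ n - inverse qq ^ n) / (qq - inverse qq)"

definition qfact :: "nat \<Rightarrow> cq" where
  "qfact m = (\<Prod>i=1..m. qint i)"


section \<open>Parities and graded tensor products\<close>

definition par :: "nat \<Rightarrow> nat \<Rightarrow> nat" where
  "par M i = (if i \<le> M then 0 else 1)"

text \<open>
  An element of \<open>A \<otimes> (End V)\<^sup>\<otimes>\<^sup>k\<close>, where \<open>V\<close> has basis \<open>e\<^sub>1, \<dots>, e\<^sub>M\<^sub>+\<^sub>N\<close>, is written uniquely as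
  the sum of \<open>X I J \<otimes> E\<^bsub>I\<^sub>1J\<^sub>1\<^esub> \<otimes> \<dots> \<otimes> E\<^bsub>I\<^sub>kJ\<^sub>k\<^esub>\<close> over multi-indices \<open>I, J\<close> of length \<open>k\<close>, and is
  represented by the function \<open>X\<close>. Only the values on \<open>idx M N k\<close> are meaningful.
\<close>
type_synonym 'a tens = "nat list \<Rightarrow> nat list \<Rightarrow> 'a"

definition idx :: "nat \<Rightarrow> nat \<Rightarrow> nat \<Rightarrow> nat list set" where
  "idx M N k = {I. length I = k \<and> set I \<subseteq> {1..M + N}}"

definition tone :: "'a::{zero, one} tens" where
  "tone I J = (if I = J then 1 else 0)"

definition tmap :: "('a \<Rightarrow> 'b) \<Rightarrow> 'a tens \<Rightarrow> 'b tens" where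
  "tmap h X I J = h (X I J)"

text \<open>
  The product of the graded tensor product. The argument \<open>s\<close> is the grading involution of the
  coefficient superalgebra, \<open>s b = (-1)^|b| b\<close> for homogeneous \<open>b\<close>. Moving the coefficient \<open>Y J K\<close>
  to the left past the units \<open>E\<^bsub>I\<^sub>aJ\<^sub>a\<^esub>\<close> applies \<open>s\<close> once for every odd one among them; moving
  \<open>E\<^bsub>J\<^sub>bK\<^sub>b\<^esub>\<close> past \<open>E\<^bsub>I\<^sub>aJ\<^sub>a\<^esub>\<close> for \<open>b < a\<close> gives the explicit sign.
\<close>
definition tmul :: "nat \<Rightarrow> nat \<Rightarrow> nat \<Rightarrow> ('a \<Rightarrow> 'a) \<Rightarrow> 'a::ring_1 tens \<Rightarrow> 'a tens \<Rightarrow> 'a tens" where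
  "tmul M N k s X Y I K =
     (\<Sum>J\<in>idx M N k.
        (-1) ^ (\<Sum>a<k. \<Sum>b<a. (par M (I ! a) + par M (J ! a)) * (par M (J ! b) + par M (K ! b))) *
        X I J * (s ^^ (\<Sum>a<k. par M (I ! a) + par M (J ! a))) (Y J K))"

text \<open>
  The element of the \<open>k\<close>-fold tensor product that is \<open>X\<close> in the copies listed in \<open>as\<close> (an
  increasing list of labels in \<open>1, \<dots>, k\<close>) and \<open>1\<close> in the other copies. No sign arises, since the
  order of the tensor factors does not change.
\<close>
definition place :: "nat \<Rightarrow> nat list \<Rightarrow> 'a::zero tens \<Rightarrow> 'a tens" where
  "place k as X I J =
     (if \<forall>b\<in>{1..k} - set as. I ! (b - 1) = J ! (b - 1)
      then X (map (\<lambda>a. I ! (a - 1)) as) (map (\<lambda>a. J ! (a - 1)) as) else 0)"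

definition str :: "nat \<Rightarrow> nat \<Rightarrow> nat \<Rightarrow> 'a::ring_1 tens \<Rightarrow> 'a" where
  "str M N k X = (\<Sum>I\<in>idx M N k. (-1) ^ (\<Sum>a<k. par M (I ! a)) * X I I)"

text \<open>\<open>E2 i j k l\<close> is \<open>E\<^sub>i\<^sub>j \<otimes> E\<^sub>k\<^sub>l\<close>.\<close>
definition E2 :: "nat \<Rightarrow> nat \<Rightarrow> nat \<Rightarrow> nat \<Rightarrow> 'a::{zero, one} tens" where
  "E2 i j k l I J = (if I = [i, k] \<and> J = [j, l] then 1 else 0)"


section \<open>The R-matrices\<close>

definition qi :: "nat \<Rightarrow> 'a::field \<Rightarrow> nat \<Rightarrow> 'a" where
  "qi M q i = q powi (1 - 2 * int (par M i))"

text \<open>\<open>R(z,w)\<close> over an arbitrary field containing \<open>q, z, w\<close>.\<close>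
definition Rzw :: "nat \<Rightarrow> nat \<Rightarrow> 'a::field \<Rightarrow> 'a \<Rightarrow> 'a \<Rightarrow> 'a tens" where
  "Rzw M N q z w I J =
     (\<Sum>i\<in>{1..M+N}. (z * qi M q i - w * inverse (qi M q i)) * E2 i i i i I J)
   + (z - w) * (\<Sum>i\<in>{1..M+N}. \<Sum>j\<in>{1..M+N} - {i}. E2 i i j j I J)
   + z * (\<Sum>i\<in>{1..M+N}. \<Sum>j\<in>{i<..M+N}. (qi M q j - inverse (qi M q j)) * E2 i j j i I J)
   + w * (\<Sum>i\<in>{1..M+N}. \<Sum>j\<in>{1..<i}. (qi M q j - inverse (qi M q j)) * E2 i j j i I J)"

definition Pgr :: "nat \<Rightarrow> nat \<Rightarrow> cq tens" where
  "Pgr M N I J = (\<Sum>i\<in>{1..M+N}. \<Sum>j\<in>{1..M+N}. (-1) ^ par M j * E2 i j j i I J)"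

text \<open>
  Series in \<open>x\<^sup>-\<^sup>1\<close> are power series or Laurent series whose formal variable is \<open>x\<^sup>-\<^sup>1\<close>, so that
  \<open>x\<close> itself is \<open>fls_X_inv\<close>, and the substitution \<open>x \<mapsto> x c\<close> replaces \<open>fps_X\<close> by \<open>c\<^sup>-\<^sup>1 fps_X\<close>.
\<close>
definition is_f :: "nat \<Rightarrow> nat \<Rightarrow> cq fps \<Rightarrow> bool" where
  "is_f M N f \<longleftrightarrow>
     fps_nth f 0 = 1 \<and>
     (let x = fls_X_inv; d = 2 * int N - 2 * int M in
        fps_to_fls (f oo (fps_const (inverse (qq powi d)) * fps_X)) =
        fps_to_fls f *
          (((1 - x * fls_const (qq powi (- 2))) * (1 - x * fls_const (qq powi (d + 2)))) /
           ((1 - x) * (1 - x * fls_const (qq powi d)))))"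

definition fser :: "nat \<Rightarrow> nat \<Rightarrow> cq fps" where
  "fser M N = (THE f. is_f M N f)"

definition Rbar :: "nat \<Rightarrow> nat \<Rightarrow> cq fls tens" where
  "Rbar M N I J =
     Rzw M N (fls_const qq) fls_X_inv 1 I J / (fls_X_inv * fls_const qq - inverse (fls_const qq))"

definition Rx :: "nat \<Rightarrow> nat \<Rightarrow> cq fls tens" where
  "Rx M N I J = fps_to_fls (fser M N) * Rbar M N I J"

text \<open>The coefficient of \<open>x\<^sup>-\<^sup>n\<close> in \<open>R(x)\<close>.\<close>
definition Rcoeff :: "nat \<Rightarrow> nat \<Rightarrow> nat \<Rightarrow> cq tens" where
  "Rcoeff M N n I J = fls_nth (Rx M N I J) (int n)"


section \<open>Hecke algebra action, symmetrizers and antisymmetrizers\<close>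

definition Rcheck :: "nat \<Rightarrow> nat \<Rightarrow> nat \<Rightarrow> nat \<Rightarrow> cq tens" where
  "Rcheck M N k a =
     tmul M N k id (place k [a, a + 1] (Pgr M N)) (place k [a, a + 1] (Rzw M N qq 1 0))"

definition perm_of :: "nat list \<Rightarrow> nat \<Rightarrow> nat" where
  "perm_of is = foldr (\<lambda>i f. transpose i (Suc i) \<circ> f) is id"

definition decomposition :: "nat \<Rightarrow> (nat \<Rightarrow> nat) \<Rightarrow> nat list \<Rightarrow> bool" where
  "decomposition m \<sigma> is \<longleftrightarrow> set is \<subseteq> {1..<m} \<and> perm_of is = \<sigma>"

definition perm_len :: "nat \<Rightarrow> (nat \<Rightarrow> nat) \<Rightarrow> nat" where
  "perm_len m \<sigma> = (LEAST l. \<exists>is. decomposition m \<sigma> is \<and> length is = l)"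

definition reduced :: "nat \<Rightarrow> (nat \<Rightarrow> nat) \<Rightarrow> nat list \<Rightarrow> bool" where
  "reduced m \<sigma> is \<longleftrightarrow> decomposition m \<sigma> is \<and> length is = perm_len m \<sigma>"

text \<open>
  The image of \<open>T\<^sub>\<sigma>\<close>, \<open>\<sigma> \<in> S\<^sub>m\<close>, acting in the copies \<open>off + 1, \<dots>, off + m\<close> of the \<open>k\<close>-fold tensor
  product; it does not depend on the choice of the reduced decomposition.
\<close>
definition Tperm :: "nat \<Rightarrow> nat \<Rightarrow> nat \<Rightarrow> nat \<Rightarrow> nat \<Rightarrow> (nat \<Rightarrow> nat) \<Rightarrow> cq tens" where
  "Tperm M N k off m \<sigma> =
     foldr (\<lambda>i X. tmul M N k id (Rcheck M N k (off + i)) X) (SOME is. reduced m \<sigma> is) tone"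

definition qsym :: "nat \<Rightarrow> nat \<Rightarrow> nat \<Rightarrow> nat \<Rightarrow> nat \<Rightarrow> cq tens" where
  "qsym M N k off m I J =
     qq powi (- int (m * (m - 1) div 2)) / qfact m *
     (\<Sum>\<sigma> | \<sigma> permutes {1..m}. qq ^ perm_len m \<sigma> * Tperm M N k off m \<sigma> I J)"

definition qantisym :: "nat \<Rightarrow> nat \<Rightarrow> nat \<Rightarrow> nat \<Rightarrow> nat \<Rightarrow> cq tens" where
  "qantisym M N k off m I J =
     qq powi int (m * (m - 1) div 2) / qfact m *
     (\<Sum>\<sigma> | \<sigma> permutes {1..m}. (- qq) powi (- int (perm_len m \<sigma>)) * Tperm M N k off m \<sigma> I J)"


section \<open>The free superalgebra on the generators\<close>

datatype pm = Plus | Minus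

text \<open>\<open>Lgen s i j r\<close> stands for \<open>l\<^sub>i\<^sub>j\<^bsup>s(r)\<^esup>\<close>; \<open>QC\<close> and \<open>QCinv\<close> stand for \<open>q\<^sup>c\<close> and its inverse.\<close>
datatype gen = Lgen pm nat nat nat | QC | QCinv

datatype fword = Word (letters: "gen list")

instantiation fword :: monoid_add
begin

definition zero_fword :: fword where "0 = Word []"
definition plus_fword :: "fword \<Rightarrow> fword \<Rightarrow> fword" where
  "u + v = Word (letters u @ letters v)"

instance by standard (auto simp: zero_fword_def plus_fword_def)

end

text \<open>Noncommutative polynomials: finitely supported functions on words with convolution product.\<close>
type_synonym falg = "fword \<Rightarrow>\<^sub>0 cq"

definition scal :: "cq \<Rightarrow> falg" where
  "scal c = Poly_Mapping.single 0 c"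

definition gen :: "gen \<Rightarrow> falg" where
  "gen g = Poly_Mapping.single (Word [g]) 1"

fun gen_par :: "nat \<Rightarrow> gen \<Rightarrow> nat" where
  "gen_par M (Lgen s i j r) = par M i + par M j"
| "gen_par M QC = 0"
| "gen_par M QCinv = 0"

definition gens :: "nat \<Rightarrow> nat \<Rightarrow> gen set" where
  "gens M N = {Lgen s i j r | s i j r. i \<in> {1..M+N} \<and> j \<in> {1..M+N}} \<union> {QC, QCinv}"

text \<open>The grading involution, multiplying each word by \<open>-1\<close> to the power of its parity.\<close>
definition grinv :: "nat \<Rightarrow> falg \<Rightarrow> falg" where
  "grinv M = Poly_Mapping.mapp (\<lambda>w c. (-1) ^ (\<Sum>g\<leftarrow>letters w. gen_par M g) * c)"

definition grinv_fps :: "nat \<Rightarrow> falg fps \<Rightarrow> falg fps" where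
  "grinv_fps M f = Abs_fps (\<lambda>n. grinv M (fps_nth f n))"

definition free_alg :: "nat \<Rightarrow> nat \<Rightarrow> falg ring" where
  "free_alg M N =
     \<lparr>carrier = {p. \<forall>w\<in>Poly_Mapping.keys p. set (letters w) \<subseteq> gens M N},
      monoid.mult = (*), one = 1, ring.zero = 0, add = (+)\<rparr>"


section \<open>The quantum affine superalgebra\<close>

text \<open>\<open>L\<^sup>s(z)\<close> is a series in \<open>z\<close> to the powers \<open>zdir s * r\<close>, \<open>r \<ge> 0\<close>.\<close>
fun zdir :: "pm \<Rightarrow> int" where
  "zdir Plus = -1"
| "zdir Minus = 1"

text \<open>The coefficient of \<open>z\<^sup>e\<close> in \<open>L\<^sup>s(z)\<close>, as an element of the free algebra tensored with \<open>End V\<close>.\<close>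
definition Lcoeff :: "pm \<Rightarrow> int \<Rightarrow> falg tens" where
  "Lcoeff s e I J =
     (if zdir s * e \<ge> 0 then gen (Lgen s (I ! 0) (J ! 0) (nat (zdir s * e))) else 0)"

text \<open>
  The matrix entry at \<open>I, J\<close> of the coefficient of \<open>z\<^sup>m w\<^sup>n\<close> in
  \<open>R(z g\<^sup>-\<^sup>1/w) L\<^sub>1\<^sup>s(z) L\<^sub>2\<^sup>t(w) - L\<^sub>2\<^sup>t(w) L\<^sub>1\<^sup>s(z) R(z h\<^sup>-\<^sup>1/w)\<close>. The coefficient of \<open>x\<^sup>-\<^sup>d\<close> in \<open>R(x)\<close> contributes
  with \<open>z\<^sup>-\<^sup>d w\<^sup>d\<close> and \<open>g\<^sup>d\<close> (resp. \<open>h\<^sup>d\<close>). For \<open>(s,t) = (+,+), (-,-), (+,-)\<close> all terms with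
  \<open>d > |m| + |n|\<close> vanish.
\<close>
definition rll :: "nat \<Rightarrow> nat \<Rightarrow> pm \<Rightarrow> pm \<Rightarrow> falg \<Rightarrow> falg \<Rightarrow> int \<Rightarrow> int \<Rightarrow> falg tens" where
  "rll M N s t g h m n I J =
     (\<Sum>d\<le>nat (\<bar>m\<bar> + \<bar>n\<bar>).
        let mul = tmul M N 2 (grinv M);
            Rd = tmap scal (Rcoeff M N d);
            L1 = place 2 [1] (Lcoeff s (m + int d));
            L2 = place 2 [2] (Lcoeff t (n - int d))
        in g ^ d * mul (mul Rd L1) L2 I J - h ^ d * mul (mul L2 L1) Rd I J)"

definition uq_relators :: "nat \<Rightarrow> nat \<Rightarrow> falg set" where
  "uq_relators M N =
     {gen (Lgen Plus j i 0) | i j. i \<in> {1..M+N} \<and> j \<in> {1..M+N} \<and> i < j}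
   \<union> {gen (Lgen Minus i j 0) | i j. i \<in> {1..M+N} \<and> j \<in> {1..M+N} \<and> i < j}
   \<union> {gen (Lgen Minus i i 0) * gen (Lgen Plus i i 0) - 1 | i. i \<in> {1..M+N}}
   \<union> {gen (Lgen Plus i i 0) * gen (Lgen Minus i i 0) - 1 | i. i \<in> {1..M+N}}
   \<union> {gen QC * gen QCinv - 1, gen QCinv * gen QC - 1}
   \<union> {gen QC * gen g - gen g * gen QC | g. g \<in> gens M N}
   \<union> {rll M N s s 1 1 m n I J | s m n I J. I \<in> idx M N 2 \<and> J \<in> idx M N 2}
   \<union> {rll M N Plus Minus (gen QCinv) (gen QC) m n I J | m n I J. I \<in> idx M N 2 \<and> J \<in> idx M N 2}"

definition uq_ideal :: "nat \<Rightarrow> nat \<Rightarrow> falg set" where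
  "uq_ideal M N = Idl\<^bsub>free_alg M N\<^esub> (uq_relators M N)"

definition Uq :: "nat \<Rightarrow> nat \<Rightarrow> falg set ring" where
  "Uq M N = free_alg M N Quot uq_ideal M N"

text \<open>The canonical projection of the free algebra onto \<open>Uq M N\<close>.\<close>
definition uq_proj :: "nat \<Rightarrow> nat \<Rightarrow> falg \<Rightarrow> falg set" where
  "uq_proj M N p = uq_ideal M N +>\<^bsub>free_alg M N\<^esub> p"


section \<open>Products of generating series\<close>

text \<open>
  \<open>L\<^sup>s(z c)\<close>, as a power series in \<open>z\<close> to the power \<open>zdir s\<close>, that is, in \<open>z\<^sup>-\<^sup>1\<close> for \<open>Plus\<close> and in
  \<open>z\<close> for \<open>Minus\<close>. Its entries lie in the free algebra and represent those over \<open>Uq M N\<close>.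
\<close>
definition Lser :: "pm \<Rightarrow> cq \<Rightarrow> falg fps tens" where
  "Lser s c I J =
     Abs_fps (\<lambda>r. scal (c powi (zdir s * int r)) * gen (Lgen s (I ! 0) (J ! 0) r))"

text \<open>\<open>L\<^sub>1(z) L\<^sub>2(z q\<^sup>2) \<cdots> L\<^sub>k(z q\<^bsup>2k-2\<^esup>)\<close>\<close>
definition Lprod :: "nat \<Rightarrow> nat \<Rightarrow> nat \<Rightarrow> pm \<Rightarrow> falg fps tens" where
  "Lprod M N k s =
     foldr (\<lambda>a X. tmul M N k (grinv_fps M) (place k [a] (Lser s (qq ^ (2 * a - 2)))) X)
       [1..<k + 1] tone"

definition str_with_L :: "nat \<Rightarrow> nat \<Rightarrow> nat \<Rightarrow> pm \<Rightarrow> cq tens \<Rightarrow> falg fps" where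
  "str_with_L M N k s X =
     str M N k (tmul M N k (grinv_fps M) (tmap (\<lambda>c. fps_const (scal c)) X) (Lprod M N k s))"


section \<open>Well-definedness\<close>

lemma qq_nonzero [simp]: "qq \<noteq> 0"
  by (simp add: qq_def Zero_fract_def eq_fract)

lemma qq_power_neq_1:
  assumes "n > 0" shows "qq ^ n \<noteq> 1"
proof -
  have "qq ^ n = Fract ([:0, 1:] ^ n) 1"
    by (induction n) (simp_all add: qq_def One_fract_def)
  moreover have "([:0, 1:] :: complex poly) ^ n \<noteq> 1"
  proof
    assume "([:0, 1:] :: complex poly) ^ n = 1"
    hence "poly ([:0, 1:] ^ n) (0::complex) = poly 1 0" by simp
    thus False using assms by (simp add: poly_power power_0_left)
  qed
  ultimately show ?thesis by (simp add: One_fract_def eq_fract)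
qed

lemma qq_powi_neq_1:
  assumes "e \<noteq> 0" shows "qq powi e \<noteq> 1"
proof
  assume *: "qq powi e = 1"
  hence "qq powi (- e) = 1" by (simp add: power_int_minus)
  with * have "qq powi \<bar>e\<bar> = 1" by (cases "e \<ge> 0") auto
  hence "qq ^ nat \<bar>e\<bar> = 1" by (simp add: power_int_def)
  thus False using qq_power_neq_1[of "nat \<bar>e\<bar>"] assms by simp
qed

fun frec :: "cq \<Rightarrow> cq fps \<Rightarrow> nat \<Rightarrow> cq" where
  "frec c G 0 = 1"
| "frec c G (Suc n) = (\<Sum>i\<in>{..n}. frec c G i * fps_nth G (Suc n - i)) / (c ^ Suc n - 1)"

lemma f_equation_ex1:
  assumes c: "\<And>n. n > 0 \<Longrightarrow> c ^ n \<noteq> (1::cq)" and G: "fps_nth G 0 = 1"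
  shows "\<exists>!f. fps_nth f 0 = 1 \<and> f oo (fps_const c * fps_X) = f * G"
proof -
  have eq: "(f oo (fps_const c * fps_X) = f * G) \<longleftrightarrow>
      (\<forall>n. (c ^ Suc n - 1) * fps_nth f (Suc n) = (\<Sum>i\<le>n. fps_nth f i * fps_nth G (Suc n - i)))"
    for f :: "cq fps"
  proof -
    have "(f oo (fps_const c * fps_X) = f * G) \<longleftrightarrow>
        (\<forall>n. c ^ n * fps_nth f n = (\<Sum>i\<le>n. fps_nth f i * fps_nth G (n - i)))"
      by (simp add: fps_eq_iff fps_compose_linear fps_mult_nth atLeast0AtMost)
    also have "\<dots> \<longleftrightarrow> (\<forall>n. c ^ Suc n * fps_nth f (Suc n) =
        (\<Sum>i\<le>Suc n. fps_nth f i * fps_nth G (Suc n - i)))"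
      (is "(\<forall>n. ?P n) \<longleftrightarrow> (\<forall>n. ?P (Suc n))")
    proof -
      have "?P 0" using G by simp
      show ?thesis
      proof (intro iffI allI)
        fix n assume "\<forall>n. ?P (Suc n)"
        with \<open>?P 0\<close> show "?P n" by (cases n) blast+
      qed blast
    qed
    also have "\<dots> \<longleftrightarrow> (\<forall>n. (c ^ Suc n - 1) * fps_nth f (Suc n) =
        (\<Sum>i\<le>n. fps_nth f i * fps_nth G (Suc n - i)))"
      using G by (simp add: algebra_simps)
    finally show ?thesis .
  qed
  define f0 where "f0 = Abs_fps (frec c G)"
  have "fps_nth f0 0 = 1 \<and> f0 oo (fps_const c * fps_X) = f0 * G"
    unfolding eq using c by (simp add: f0_def del: power_Suc)
  moreover have "f = f0" if f: "fps_nth f 0 = 1 \<and> f oo (fps_const c * fps_X) = f * G" for f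
  proof -
    have r: "(c ^ Suc n - 1) * fps_nth f (Suc n) = (\<Sum>i\<le>n. fps_nth f i * fps_nth G (Suc n - i))" for n
      using f unfolding eq by blast
    have "fps_nth f n = frec c G n" for n
    proof (induction n rule: less_induct)
      case (less n)
      show ?case
      proof (cases n)
        case 0 thus ?thesis using f by simp
      next
        case (Suc m)
        have "(\<Sum>i\<le>m. fps_nth f i * fps_nth G (Suc m - i)) = (\<Sum>i\<le>m. frec c G i * fps_nth G (Suc m - i))"
          by (intro sum.cong refl) (simp add: less Suc)
        with r[of m] c[of "Suc m"] show ?thesis
          by (simp add: Suc field_simps del: power_Suc)
      qed
    qed
    thus ?thesis by (simp add: f0_def fps_eq_iff)
  qed
  ultimately show ?thesis by blast
qed

lemma frac_cancel:
  fixes g :: "'a::field"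
  assumes "g * (a * b) = c * d" "a \<noteq> 0" "b \<noteq> 0" "x \<noteq> 0"
  shows "((c / x) * (d / x)) / ((a / x) * (b / x)) = g"
  using assms by (simp add: divide_simps)

text \<open>The defining property of \<open>fser\<close> determines a unique series.\<close>
lemma is_f_ex1:
  assumes "M \<noteq> N" shows "\<exists>!f. is_f M N f"
proof -
  define d where "d = 2 * int N - 2 * int M"
  define a b e where "a = qq powi (- 2)" and "b = qq powi (d + 2)" and "e = qq powi d"
  have nz [simp]: "a \<noteq> 0" "b \<noteq> 0" "e \<noteq> 0" by (simp_all add: a_def b_def e_def)
  have abe: "a * b = e" by (simp add: a_def b_def e_def flip: power_int_add)
  define D where "D = (fps_X - 1) * (fps_X - fps_const e)"
  define G where "G = (fps_X - fps_const a) * (fps_X - fps_const b) * inverse D"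
  have D0: "fps_nth D 0 = e" by (simp add: D_def)
  have G0: "fps_nth G 0 = 1" by (simp add: G_def D0 abe)
  have DI: "D * inverse D = 1" using D0 by (simp add: inverse_mult_eq_1')
  have DG: "G * D = (fps_X - fps_const a) * (fps_X - fps_const b)"
    using DI by (simp add: G_def mult.assoc mult.commute)
  let ?x = "fls_X_inv :: cq fls"
  have xX: "?x = inverse fls_X" by (simp add: fls_inverse_X)
  have Xnz: "(fls_X :: cq fls) \<noteq> 0" by simp
  have one: "1 - ?x * fls_const u = fps_to_fls (fps_X - fps_const u) / fls_X" for u
  proof -
    have "fps_to_fls (fps_X - fps_const u) = fls_X - fls_const u" by simp
    moreover have "1 - ?x * fls_const u = (fls_X - fls_const u) / fls_X"
      by (simp only: xX divide_inverse mult.commute[of _ "inverse fls_X"] right_diff_distrib left_inverse[OF Xnz])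
    ultimately show ?thesis by (simp only:)
  qed
  have one1: "1 - ?x = fps_to_fls (fps_X - 1) / fls_X"
    using one[of 1] by simp
  have nzD: "fps_X - 1 \<noteq> (0 :: cq fps)" "fps_X - fps_const e \<noteq> 0"
    using D0 by (auto simp: D_def)
  have nzD': "fps_to_fls (fps_X - 1 :: cq fps) \<noteq> 0" "fps_to_fls (fps_X - fps_const e) \<noteq> 0"
    using nzD by (simp_all only: fps_to_fls_eq_0_iff not_False_eq_True)
  have "fps_to_fls G * (fps_to_fls (fps_X - 1) * fps_to_fls (fps_X - fps_const e)) =
      fps_to_fls (fps_X - fps_const a) * fps_to_fls (fps_X - fps_const b)"
    using arg_cong[OF DG, of fps_to_fls] by (simp only: D_def fls_times_fps_to_fls)
  hence frac: "((1 - ?x * fls_const a) * (1 - ?x * fls_const b)) /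
      ((1 - ?x) * (1 - ?x * fls_const e)) = fps_to_fls G"
    unfolding one one1 using nzD' Xnz by (intro frac_cancel)
  have "is_f M N f \<longleftrightarrow> fps_nth f 0 = 1 \<and> f oo (fps_const (inverse e) * fps_X) = f * G" for f
    unfolding is_f_def Let_def d_def[symmetric] a_def[symmetric] b_def[symmetric] e_def[symmetric] frac
    by (simp only: fls_times_fps_to_fls[symmetric] fps_to_fls_eq_iff)
  moreover have "inverse e ^ n \<noteq> 1" if "n > 0" for n
  proof -
    have "inverse e ^ n = qq powi (- d * int n)"
      by (simp add: e_def power_int_minus power_int_mult power_inverse)
    thus ?thesis using qq_powi_neq_1[of "- d * int n"] that assms by (simp add: d_def)
  qed
  ultimately show ?thesis using f_equation_ex1[of "inverse e" G] G0 by simp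
qed

lemma free_alg_ring: "ring (free_alg M N)"
proof (intro ringI abelian_groupI monoidI)
  fix x y assume "x \<in> carrier (free_alg M N)" "y \<in> carrier (free_alg M N)"
  thus "x \<oplus>\<^bsub>free_alg M N\<^esub> y \<in> carrier (free_alg M N)"
    using Poly_Mapping.keys_add[of x y] by (auto simp: free_alg_def)
next
  fix x y assume "x \<in> carrier (free_alg M N)" "y \<in> carrier (free_alg M N)"
  thus "x \<otimes>\<^bsub>free_alg M N\<^esub> y \<in> carrier (free_alg M N)"
    using Poly_Mapping.keys_mult[of x y] by (fastforce simp: free_alg_def plus_fword_def)
next
  fix x assume "x \<in> carrier (free_alg M N)"
  thus "\<exists>y\<in>carrier (free_alg M N). y \<oplus>\<^bsub>free_alg M N\<^esub> x = \<zero>\<^bsub>free_alg M N\<^esub>"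
    by (intro bexI[of _ "- x"]) (auto simp: free_alg_def)
qed (auto simp: free_alg_def zero_fword_def algebra_simps)

lemma free_alg_closed:
  shows "0 \<in> carrier (free_alg M N)" "1 \<in> carrier (free_alg M N)"
    and "x \<in> carrier (free_alg M N) \<Longrightarrow> - x \<in> carrier (free_alg M N)"
    and "x \<in> carrier (free_alg M N) \<Longrightarrow> y \<in> carrier (free_alg M N) \<Longrightarrow> x + y \<in> carrier (free_alg M N)"
    and "x \<in> carrier (free_alg M N) \<Longrightarrow> y \<in> carrier (free_alg M N) \<Longrightarrow> x - y \<in> carrier (free_alg M N)"
    and "x \<in> carrier (free_alg M N) \<Longrightarrow> y \<in> carrier (free_alg M N) \<Longrightarrow> x * y \<in> carrier (free_alg M N)"
    and "scal c \<in> carrier (free_alg M N)"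
    and "g \<in> gens M N \<Longrightarrow> gen g \<in> carrier (free_alg M N)"
    and "x \<in> carrier (free_alg M N) \<Longrightarrow> grinv M x \<in> carrier (free_alg M N)"
proof -
  interpret ring "free_alg M N" by (rule free_alg_ring)
  show "0 \<in> carrier (free_alg M N)" "1 \<in> carrier (free_alg M N)"
    using zero_closed one_closed by (auto simp: free_alg_def)
  show um: "- x \<in> carrier (free_alg M N)" if "x \<in> carrier (free_alg M N)" for x
    using that by (simp add: free_alg_def)
  show pl: "x + y \<in> carrier (free_alg M N)"
    if "x \<in> carrier (free_alg M N)" "y \<in> carrier (free_alg M N)" for x y
    using a_closed[OF that] by (simp add: free_alg_def)
  show "x - y \<in> carrier (free_alg M N)"
    if "x \<in> carrier (free_alg M N)" "y \<in> carrier (free_alg M N)"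
    using pl[OF that(1) um[OF that(2)]] by simp
  show "x * y \<in> carrier (free_alg M N)"
    if "x \<in> carrier (free_alg M N)" "y \<in> carrier (free_alg M N)"
    using m_closed[OF that] by (simp add: free_alg_def)
  show "scal c \<in> carrier (free_alg M N)"
    by (auto simp: free_alg_def scal_def zero_fword_def split: if_splits)
  show "gen g \<in> carrier (free_alg M N)" if "g \<in> gens M N"
    using that by (auto simp: free_alg_def gen_def)
  show "grinv M x \<in> carrier (free_alg M N)" if "x \<in> carrier (free_alg M N)"
    using that Poly_Mapping.keys_mapp_subset[of _ x] unfolding free_alg_def grinv_def by fastforce
qed

lemma free_alg_sum_closed:
  "(\<And>i. i \<in> A \<Longrightarrow> f i \<in> carrier (free_alg M N)) \<Longrightarrow> sum f A \<in> carrier (free_alg M N)"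
  by (induction A rule: infinite_finite_induct) (auto intro: free_alg_closed)

lemma free_alg_power_closed:
  "x \<in> carrier (free_alg M N) \<Longrightarrow> x ^ n \<in> carrier (free_alg M N)"
  by (induction n) (auto intro: free_alg_closed)

lemma free_alg_grinv_closed:
  "x \<in> carrier (free_alg M N) \<Longrightarrow> (grinv M ^^ n) x \<in> carrier (free_alg M N)"
  by (induction n) (auto intro: free_alg_closed)

lemma free_alg_tmul_closed:
  assumes "\<And>I J. I \<in> idx M N k \<Longrightarrow> J \<in> idx M N k \<Longrightarrow> X I J \<in> carrier (free_alg M N)"
    and "\<And>I J. I \<in> idx M N k \<Longrightarrow> J \<in> idx M N k \<Longrightarrow> Y I J \<in> carrier (free_alg M N)"
    and "I \<in> idx M N k" "K \<in> idx M N k"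
  shows "tmul M N k (grinv M) X Y I K \<in> carrier (free_alg M N)"
  unfolding tmul_def using assms
  by (intro free_alg_sum_closed free_alg_closed(6) free_alg_grinv_closed free_alg_power_closed)
     (auto intro: free_alg_closed)

text \<open>Hence \<open>uq_ideal\<close> is the two-sided ideal generated by the relators, and \<open>Uq\<close> is a ring.\<close>
lemma uq_relators_carrier: "uq_relators M N \<subseteq> carrier (free_alg M N)"
proof -
  note cl = free_alg_closed free_alg_power_closed
  have L: "place 2 [a] (Lcoeff s e) I J \<in> carrier (free_alg M N)"
    if "I \<in> idx M N 2" "J \<in> idx M N 2" "a \<in> {1, 2}" for a s e I J
  proof -
    have "I ! (a - 1) \<in> set I" "J ! (a - 1) \<in> set J"
      using that by (auto simp: idx_def intro!: nth_mem)
    hence "I ! (a - 1) \<in> {1..M+N}" "J ! (a - 1) \<in> {1..M+N}"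
      using that by (auto simp: idx_def)
    hence "Lgen s (I ! (a - 1)) (J ! (a - 1)) r \<in> gens M N" for r
      by (auto simp: gens_def)
    thus ?thesis by (auto simp: place_def Lcoeff_def intro: cl)
  qed
  have R: "rll M N s t g h m n I J \<in> carrier (free_alg M N)"
    if "g \<in> carrier (free_alg M N)" "h \<in> carrier (free_alg M N)" "I \<in> idx M N 2" "J \<in> idx M N 2"
    for s t g h m n I J
    unfolding rll_def Let_def using that
    by (intro free_alg_sum_closed free_alg_closed(5,6) free_alg_power_closed free_alg_tmul_closed L)
       (auto simp: tmap_def intro: cl)
  have Q: "gen QC \<in> carrier (free_alg M N)" "gen QCinv \<in> carrier (free_alg M N)"
    by (auto intro: cl simp: gens_def)
  have G: "gen (Lgen s i j r) \<in> carrier (free_alg M N)"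
    if "i \<in> {1..M+N}" "j \<in> {1..M+N}" for s i j r
    using that by (auto intro!: cl simp: gens_def)
  show ?thesis
    unfolding uq_relators_def
    by (auto intro!: cl(5,6) R Q G cl(1,2) cl(8)) (auto simp: gens_def)
qed

lemma uq_ideal: "ideal (uq_ideal M N) (free_alg M N)"
  unfolding uq_ideal_def
  by (rule ring.genideal_ideal[OF free_alg_ring uq_relators_carrier])

lemma Uq_ring: "ring (Uq M N)"
  unfolding Uq_def by (rule ideal.quotient_is_ring[OF uq_ideal])

end

theory Submission
  imports Defs
begin

text \<open>
  Write \<open>X = L\<^sub>1(z) L\<^sub>2(zq\<^sup>2) \<cdots> L\<^sub>k(zq\<^bsup>2k-2\<^esup>)\<close> and \<open>T\<^sub>i\<close> for the action of the Hecke generators. The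
  spectral parameters of neighbouring factors differ by \<open>q\<^sup>2\<close>, which is where the R-matrix degenerates:
  \<open>P R(1,q\<^sup>2) = (1 - q\<^sup>2)(T - q)\<close> (\<open>P_op_R_op_q2\<close>). Multiplying the RLL relation at this point by
  \<open>P\<close> on the left and by \<open>T + q\<^sup>-\<^sup>1\<close> on the right kills one of its two sides, because
  \<open>(T - q)(T + q\<^sup>-\<^sup>1) = 0\<close>. What remains is the Manin relation \<open>(T\<^sub>i - q) X (T\<^sub>i + q\<^sup>-\<^sup>1) = 0\<close> modulo the
  ideal of relations (\<open>local_manin\<close>, \<open>global_manin\<close>).

  The rest of the argument only uses this relation and the cyclicity of the supertrace. Consider the
  functional \<open>W \<mapsto> str (W X)\<close> and let \<open>S\<close>, \<open>A\<close> be a symmetrizer and an antisymmetrizer on consecutive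
  copies. The Manin relation allows one to insert or to remove one of two equal factors:
  \<open>S W S\<close> and \<open>S W\<close> have the same value, and so have \<open>A W A\<close> and \<open>W A\<close>
  (\<open>symmetrizer_slide\<close>, \<open>antisymmetrizer_slide\<close>). Now let \<open>B\<^sub>r = S\<^sub>r A\<close> be the product in the \<open>r\<close>-th
  summand, and let \<open>a\<^sub>r\<close> be the product of the symmetrizer on \<open>1, \<dots>, r\<close> and the antisymmetrizer on
  \<open>r, \<dots>, k\<close>, which overlap in the copy \<open>r\<close>. The formula
  \<open>[m+1] S\<^sub>m\<^sub>+\<^sub>1 = S\<^sub>m (q\<^sup>-\<^sup>m + [m] T\<^sub>m) S\<^sub>m\<close> and its antisymmetric analogue (both are \<open>qproj_step\<close>) express
  the values of \<open>a\<^sub>r\<close> and of \<open>a\<^sub>r\<^sub>+\<^sub>1\<close> as two different combinations of those of \<open>B\<^sub>r\<close> and of one further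
  element \<open>S\<^sub>r A T\<^sub>r A S\<^sub>r\<close> (\<open>overlap_cong\<close>). Eliminating the latter writes \<open>B\<^sub>r\<close> as \<open>d\<^sub>r + d\<^sub>r\<^sub>+\<^sub>1\<close>, where
  \<open>d\<^sub>r\<close> is a multiple of \<open>a\<^sub>r\<close> and \<open>d\<^sub>0 = d\<^sub>k\<^sub>+\<^sub>1 = 0\<close>, so the alternating sum telescopes (\<open>macmahon\<close>).
  The Hecke relations are invariant under replacing \<open>q\<close> by \<open>-q\<^sup>-\<^sup>1\<close>, which exchanges symmetrizers and
  antisymmetrizers; this gives the second identity together with the first.

  Three bridges connect this argument with the definitions. The (anti)symmetrizers are sums over
  permutations of products along arbitrarily chosen reduced words; Matsumoto's theorem for the
  symmetric group turns them into sums over explicit words, which factor along the chain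
  \<open>S\<^sub>1 \<subset> S\<^sub>2 \<subset> \<cdots>\<close> (\<open>sum_reduced_words\<close>, \<open>qsum_words\<close>). The graded product of even tensors becomes the
  composition of operators after multiplying matrix entries by suitable signs, since the sign of the
  graded product is a coboundary (\<open>twist_cocycle\<close>, \<open>tens_op_tmul\<close>). Finally, the RLL relation holds with
  the R-matrix times a power series in \<open>w/z\<close>; as this series has an invertible constant term, it can
  be divided out, and only then can \<open>w\<close> be specialized to \<open>z q\<^sup>2\<close> (\<open>poly_rll_ideal\<close>, \<open>fused_ideal\<close>).
\<close>

section \<open>Words and normal forms in the symmetric group\<close>

text \<open>
  The congruence on words in the adjacent transpositions generated by the braid and the
  commutation relations, without the relation that a square is trivial. Equivalent words have
  the same product in the symmetric group and in every Hecke algebra.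
\<close>
inductive braid_eq :: "nat list \<Rightarrow> nat list \<Rightarrow> bool" where
  same: "braid_eq u u"
| swap: "braid_eq u v \<Longrightarrow> braid_eq v u"
| trans: "braid_eq u v \<Longrightarrow> braid_eq v w \<Longrightarrow> braid_eq u w"
| congr: "braid_eq u v \<Longrightarrow> braid_eq (a @ u @ b) (a @ v @ b)"
| far: "Suc i < j \<Longrightarrow> braid_eq [i, j] [j, i]"
| braid: "braid_eq [i, Suc i, i] [Suc i, i, Suc i]"

lemma braid_eq_set: "braid_eq u v \<Longrightarrow> set u = set v"
  by (induction rule: braid_eq.induct) auto

lemma braid_eq_length: "braid_eq u v \<Longrightarrow> length u = length v"
  by (induction rule: braid_eq.induct) auto

lemma braid_eq_append_right: "braid_eq u v \<Longrightarrow> braid_eq (u @ b) (v @ b)"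
  using braid_eq.congr[of u v "[]" b] by simp

lemma braid_eq_append_left: "braid_eq u v \<Longrightarrow> braid_eq (a @ u) (a @ v)"
  using braid_eq.congr[of u v a "[]"] by simp

lemma braid_eq_prod_list:
  fixes U :: "nat \<Rightarrow> 'a::monoid_mult"
  assumes "braid_eq u v" "set u \<subseteq> I"
    and "\<And>i j. i \<in> I \<Longrightarrow> j \<in> I \<Longrightarrow> Suc i < j \<Longrightarrow> U i * U j = U j * U i"
    and "\<And>i. i \<in> I \<Longrightarrow> Suc i \<in> I \<Longrightarrow> U i * U (Suc i) * U i = U (Suc i) * U i * U (Suc i)"
  shows "prod_list (map U u) = prod_list (map U v)"
  using assms(1,2)
proof (induction rule: braid_eq.induct)
  case (swap u v) thus ?case using braid_eq_set by metis
next
  case (trans u v w) thus ?case using braid_eq_set by metis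
qed (use assms(3,4) in \<open>auto simp: mult.assoc\<close>)

lemma perm_of_append: "perm_of (u @ v) = perm_of u \<circ> perm_of v"
  by (induction u) (simp_all add: perm_of_def comp_assoc)

lemma perm_of_Nil [simp]: "perm_of [] = id"
  and perm_of_single: "perm_of [i] = transpose i (Suc i)"
  and perm_of_Cons: "perm_of (i # u) = transpose i (Suc i) \<circ> perm_of u"
  by (simp_all add: perm_of_def)

lemma braid_eq_perm_of: "braid_eq u v \<Longrightarrow> perm_of u = perm_of v"
proof (induction rule: braid_eq.induct)
  case (congr u v a b) thus ?case by (simp add: perm_of_append)
next
  case (far i j) thus ?case
    by (auto simp: perm_of_Cons fun_eq_iff transpose_def)
next
  case (braid i) thus ?case
    by (auto simp: perm_of_Cons fun_eq_iff transpose_def)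
qed auto

lemma perm_of_permutes: "set u \<subseteq> {1..<m} \<Longrightarrow> perm_of u permutes {1..m}"
proof (induction u)
  case (Cons i u)
  hence "transpose i (Suc i) permutes {1..m}" by (intro permutes_swap_id) auto
  moreover have "perm_of u permutes {1..m}" using Cons by simp
  ultimately show ?case unfolding perm_of_Cons by (rule permutes_compose[rotated])
qed (simp add: permutes_id)

lemma braid_eq_far_word:
  assumes "\<forall>x\<in>set w. Suc x < i \<or> Suc i < x"
  shows "braid_eq (w @ [i]) (i # w)"
  using assms
proof (induction w)
  case (Cons x w)
  hence "braid_eq [x, i] [i, x]" by (auto intro: braid_eq.far braid_eq.swap)
  from braid_eq_append_right[OF this, of w] braid_eq_append_left[OF Cons.IH, of "[x]"] Cons.prems
  show ?case by (auto intro: braid_eq.trans)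
qed (auto intro: braid_eq.same)

text \<open>
  The word \<open>m (m-1) \<dots> j\<close>. As \<open>j\<close> runs through \<open>1, \<dots>, m+1\<close>, these words represent the right
  cosets of \<open>S\<^sub>m\<close> in \<open>S\<^sub>m\<^sub>+\<^sub>1\<close>: the permutation of \<open>down j m\<close> sends \<open>j\<close> to \<open>m+1\<close>, and it is the
  identity for \<open>j = m+1\<close>.
\<close>
definition down :: "nat \<Rightarrow> nat \<Rightarrow> nat list" where
  "down j m = rev [j..<Suc m]"

text \<open>
  The letter \<open>i\<close> passes through the letters below \<open>i - 1\<close>, then \<open>i (i-1) i = (i-1) i (i-1)\<close>
  turns it into \<open>i - 1\<close>, and this letter passes through those above \<open>i\<close>.
\<close>
lemma down_braid:
  assumes "j < i" "i \<le> m"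
  shows "braid_eq (down j m @ [i]) ((i - 1) # down j m)"
proof -
  obtain p where p: "i = Suc p" using assms by (cases i) auto
  have "[j..<Suc m] = [j..<p] @ [p, Suc p] @ [Suc (Suc p)..<Suc m]"
  proof -
    have "[j..<Suc m] = [j..<Suc (Suc p)] @ [Suc (Suc p)..<Suc m]"
      using assms p by (metis le_Suc_eq less_imp_le_nat upt_add_eq_append le_add_diff_inverse not_less_eq_eq less_or_eq_imp_le)
    thus ?thesis using assms p by simp
  qed
  define A B where "A = rev [Suc (Suc p)..<Suc m]" and "B = rev [j..<p]"
  \<comment> \<open>The letters \<open>i\<close> and \<open>i - 1\<close> of the word, between those above \<open>i\<close> and those below \<open>i - 1\<close>.\<close>
  have d: "down j m = A @ [Suc p, p] @ B"
    using \<open>[j..<Suc m] = _\<close> by (simp add: down_def A_def B_def)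
  have 1: "braid_eq (B @ [Suc p]) (Suc p # B)"
    by (rule braid_eq_far_word) (auto simp: B_def)
  have 2: "braid_eq (A @ [p]) (p # A)"
    by (rule braid_eq_far_word) (auto simp: A_def)
  have "braid_eq (A @ [Suc p, p] @ B @ [Suc p]) (A @ [Suc p, p] @ Suc p # B)"
    using braid_eq_append_left[OF 1, of "A @ [Suc p, p]"] by simp
  also have "braid_eq \<dots> (A @ [p, Suc p, p] @ B)"
    using braid_eq.congr[OF braid_eq.swap[OF braid_eq.braid[of p]], of A B] by simp
  also (braid_eq.trans) have "braid_eq \<dots> ((p # A) @ [Suc p, p] @ B)"
    using braid_eq_append_right[OF 2, of "[Suc p, p] @ B"] by simp
  finally (braid_eq.trans) show ?thesis by (simp add: d p)
qed

lemma down_far: "Suc i < j \<Longrightarrow> braid_eq (down j m @ [i]) (i # down j m)"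
  by (rule braid_eq_far_word) (auto simp: down_def)

lemma down_Suc: "j \<le> Suc m \<Longrightarrow> down j (Suc m) = Suc m # down j m"
  by (simp add: down_def)

lemma down_snoc: "j \<le> m \<Longrightarrow> down j m = down (Suc j) m @ [j]"
  by (simp add: down_def upt_conv_Cons del: upt_Suc)

lemma down_empty [simp]: "down (Suc m) m = []"
  by (simp add: down_def)

lemma perm_of_down: "j \<le> Suc m \<Longrightarrow> perm_of (down j m) j = Suc m"
proof (induction m)
  case 0 thus ?case by (cases j) (auto simp: down_def perm_of_Cons)
next
  case (Suc m) thus ?case
    by (cases "j = Suc (Suc m)") (auto simp: down_Suc perm_of_Cons)
qed

text \<open>
  Every element of \<open>S\<^sub>m\<^sub>+\<^sub>1\<close> is uniquely an element of \<open>S\<^sub>m\<close> times a coset representative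
  \<open>down j m\<close>. Iterating this gives one distinguished word for each permutation.
\<close>
fun normal_words :: "nat \<Rightarrow> nat list set" where
  "normal_words 0 = {[]}"
| "normal_words (Suc m) = (\<lambda>(w, j). w @ down j m) ` (normal_words m \<times> {1..Suc m})"

lemma normal_words_set: "w \<in> normal_words m \<Longrightarrow> set w \<subseteq> {1..<m}"
  by (induction m arbitrary: w) (fastforce simp: down_def)+

text \<open>
  The preimage of \<open>m+1\<close> recovers \<open>j\<close>, because \<open>w\<close> fixes \<open>m+1\<close>; then the coset representative
  cancels.
\<close>
lemma normal_words_unique:
  assumes "perm_of (w @ down j m) = perm_of (w' @ down j' m)" "w \<in> normal_words m" "w' \<in> normal_words m"
    "j \<in> {1..Suc m}" "j' \<in> {1..Suc m}"
  shows "j = j' \<and> perm_of w = perm_of w'"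
proof -
  have p: "perm_of w permutes {1..m}" "perm_of w' permutes {1..m}"
    using assms normal_words_set perm_of_permutes by blast+
  have d: "perm_of (down j m) permutes {1..Suc m}" "perm_of (down j' m) permutes {1..Suc m}"
    using assms by (intro perm_of_permutes; auto simp: down_def)+
  have v: "perm_of (w @ down j m) j = Suc m" "perm_of (w' @ down j' m) j' = Suc m"
    unfolding perm_of_append comp_def
    using assms permutes_not_in[OF p(1)] permutes_not_in[OF p(2)]
    by (simp_all add: perm_of_down)
  have "perm_of (w @ down j m) permutes {1..Suc m}"
    unfolding perm_of_append
    by (intro permutes_compose d permutes_subset[OF p(1)]) auto
  hence "inj (perm_of (w @ down j m))" by (rule permutes_inj)
  with v assms(1) have j: "j = j'" by (metis injD)
  have "surj (perm_of (down j m))" using d permutes_surj by blast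
  hence "perm_of w = perm_of w'"
    using assms(1) j unfolding perm_of_append by (metis fun.map_comp surj_fun_eq comp_assoc surj_iff comp_id)
  with j show ?thesis by simp
qed

lemma normal_words_inj: "inj_on perm_of (normal_words m)"
proof (induction m)
  case (Suc m)
  show ?case
  proof (rule inj_onI)
    fix x y assume "x \<in> normal_words (Suc m)" "y \<in> normal_words (Suc m)" and e: "perm_of x = perm_of y"
    then obtain w j w' j' where "x = w @ down j m" "y = w' @ down j' m"
      "w \<in> normal_words m" "w' \<in> normal_words m" "j \<in> {1..Suc m}" "j' \<in> {1..Suc m}" by auto
    with normal_words_unique[of w j m w' j'] e Suc show "x = y" by (auto simp: inj_on_def)
  qed
qed auto

lemma normal_words_split_inj: "inj_on (\<lambda>(w, j). w @ down j m) (normal_words m \<times> {1..Suc m})"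
proof (rule inj_onI, clarify)
  fix w j w' j' assume "w @ down j m = w' @ down j' m" "w \<in> normal_words m" "w' \<in> normal_words m"
    "j \<in> {1..Suc m}" "j' \<in> {1..Suc m}"
  with normal_words_unique[of w j m w' j'] normal_words_inj[of m] show "w = w' \<and> j = j'"
    by (auto simp: inj_on_def)
qed

lemma normal_words_surj: "\<sigma> permutes {1..m} \<Longrightarrow> \<exists>w\<in>normal_words m. perm_of w = \<sigma>"
proof (induction m arbitrary: \<sigma>)
  case (Suc m)
  define j where "j = inv_into UNIV \<sigma> (Suc m)"
  have j: "j \<in> {1..Suc m}" "\<sigma> j = Suc m"
    unfolding j_def using Suc.prems permutes_in_image[OF permutes_inv[OF Suc.prems], of "Suc m"]
      permutes_inverses(1)[OF Suc.prems] by auto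
  define d where "d = perm_of (down j m)"
  have d: "d permutes {1..Suc m}"
    unfolding d_def using j by (intro perm_of_permutes) (auto simp: down_def)
  have "(\<sigma> \<circ> inv_into UNIV d) permutes {1..m}"
  proof (rule permutes_superset)
    show "(\<sigma> \<circ> inv_into UNIV d) permutes {1..Suc m}"
      by (intro permutes_compose permutes_inv d Suc.prems)
    fix x assume "x \<in> {1..Suc m} - {1..m}"
    hence "x = Suc m" by auto
    moreover have "inv_into UNIV d (Suc m) = j"
      using perm_of_down[of j m] j permutes_inverses(2)[OF d] unfolding d_def by (metis atLeastAtMost_iff)
    ultimately show "(\<sigma> \<circ> inv_into UNIV d) x = x" using j by simp
  qed
  from Suc.IH[OF this] obtain w where w: "w \<in> normal_words m" "perm_of w = \<sigma> \<circ> inv_into UNIV d" by blast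
  have "perm_of (w @ down j m) = \<sigma> \<circ> (inv_into UNIV d \<circ> d)"
    by (simp add: perm_of_append w d_def[symmetric] comp_assoc)
  also have "\<dots> = \<sigma>" using permutes_inv_o(2)[OF d] by simp
  finally show ?case using w j by force
qed auto

text \<open>
  Multiplying a normal word \<open>v (down j m)\<close> by a generator on the right either extends or
  shortens the coset representative (\<open>i = j - 1\<close> or \<open>i = j\<close>), or moves a generator of \<open>S\<^sub>m\<close>
  through it to \<open>v\<close>, where the induction hypothesis applies. In the shortening case \<open>w\<close> itself
  is the longer word, so no cancellation of squares is used.
\<close>
lemma normal_words_step:
  assumes "w \<in> normal_words m" "1 \<le> i" "i < m"
  shows "\<exists>w'\<in>normal_words m. braid_eq (w @ [i]) w' \<or> braid_eq (w' @ [i]) w"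
  using assms
proof (induction m arbitrary: w i)
  case (Suc m)
  then obtain v j where w: "w = v @ down j m" and v: "v \<in> normal_words m" and j: "j \<in> {1..Suc m}" by auto
  have inner: ?case if "1 \<le> p" "p < m" and br: "braid_eq (down j m @ [i]) (p # down j m)" for p
  proof -
    from Suc.IH[OF v that(1,2)] obtain v' where v': "v' \<in> normal_words m"
      "braid_eq (v @ [p]) v' \<or> braid_eq (v' @ [p]) v" by blast
    have *: "braid_eq ((u @ down j m) @ [i]) ((u @ [p]) @ down j m)" for u
      using braid_eq_append_left[OF br, of u] by simp
    have "v' @ down j m \<in> normal_words (Suc m)" using v' j by auto
    moreover have "braid_eq (w @ [i]) (v' @ down j m) \<or> braid_eq ((v' @ down j m) @ [i]) w"
      using v'(2) * braid_eq_append_right w by (meson braid_eq.trans)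
    ultimately show ?thesis by blast
  qed
  consider "Suc i < j" | "j = Suc i" | "j = i" | "j < i" by linarith
  thus ?case
  proof cases
    case 1 thus ?thesis using inner[of i] down_far[of i j m] Suc.prems j by auto
  next
    case 2
    hence "w @ [i] = v @ down i m" using w down_snoc[of i m] Suc.prems by simp
    moreover have "v @ down i m \<in> normal_words (Suc m)" using v Suc.prems by auto
    ultimately show ?thesis using braid_eq.same by metis
  next
    case 3
    hence "(v @ down (Suc i) m) @ [i] = w" using w down_snoc[of i m] Suc.prems by simp
    moreover have "v @ down (Suc i) m \<in> normal_words (Suc m)" using v Suc.prems by auto
    ultimately show ?thesis using braid_eq.same by metis
  next
    case 4 thus ?thesis using inner[of "i - 1"] down_braid[of j i m] Suc.prems j by auto
  qed
qed auto

text \<open>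
  This is Matsumoto's theorem for the symmetric group: a word that is as short as the normal
  word of its permutation can be brought into normal form by braid and commutation relations
  alone. Reading the word from left to right, each letter lengthens or shortens the normal form
  by one, so a word of the length of its normal form never meets a shortening step.
\<close>
lemma normal_words_normal_form:
  assumes "set u \<subseteq> {1..<m}"
  shows "\<exists>w\<in>normal_words m. perm_of w = perm_of u \<and> length w \<le> length u \<and>
    (length w = length u \<longrightarrow> braid_eq u w)"
  using assms
proof (induction u rule: rev_induct)
  case Nil
  have "[] \<in> normal_words m"
  proof (induction m)
    case (Suc m) thus ?case by (force intro: rev_image_eqI[of "([], Suc m)"])
  qed simp
  thus ?case by (auto intro: braid_eq.same)
next
  case (snoc i u)
  then obtain w where w: "w \<in> normal_words m" "perm_of w = perm_of u" "length w \<le> length u"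
    "length w = length u \<Longrightarrow> braid_eq u w" by auto
  from normal_words_step[OF w(1), of i] snoc.prems obtain w' where w': "w' \<in> normal_words m"
    "braid_eq (w @ [i]) w' \<or> braid_eq (w' @ [i]) w" by auto
  from w'(2) show ?case
  proof
    assume b: "braid_eq (w @ [i]) w'"
    have "perm_of w' = perm_of (u @ [i])"
      using braid_eq_perm_of[OF b] w(2) by (simp add: perm_of_append)
    moreover have "length w' = Suc (length w)" using braid_eq_length[OF b] by simp
    moreover have "braid_eq (u @ [i]) w'" if "length w = length u"
      using braid_eq_append_right[OF w(4)[OF that], of "[i]"] b by (rule braid_eq.trans)
    ultimately show ?thesis using w'(1) w(3) by (intro bexI[of _ w']) auto
  next
    assume b: "braid_eq (w' @ [i]) w"
    have "perm_of u = perm_of w' \<circ> transpose i (Suc i)"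
      using braid_eq_perm_of[OF b] w(2) by (simp add: perm_of_append perm_of_single)
    hence "perm_of (u @ [i]) = perm_of w' \<circ> (transpose i (Suc i) \<circ> transpose i (Suc i))"
      by (simp only: perm_of_append perm_of_single comp_assoc)
    hence "perm_of w' = perm_of (u @ [i])" by (simp only: transpose_comp_involutory comp_id)
    moreover have "Suc (length w') = length w" using braid_eq_length[OF b] by simp
    ultimately show ?thesis using w'(1) w(3) by (intro bexI[of _ w']) auto
  qed
qed

lemma perm_len_normal_words:
  assumes "w \<in> normal_words m" shows "perm_len m (perm_of w) = length w"
  unfolding perm_len_def
proof (rule Least_equality)
  show "\<exists>is. decomposition m (perm_of w) is \<and> length is = length w"
    using normal_words_set[OF assms] by (auto simp: decomposition_def)
next
  fix l assume "\<exists>is. decomposition m (perm_of w) is \<and> length is = l"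
  then obtain u where u: "set u \<subseteq> {1..<m}" "perm_of u = perm_of w" "length u = l"
    by (auto simp: decomposition_def)
  with normal_words_normal_form[OF u(1)] normal_words_inj[of m] assms show "length w \<le> l"
    by (metis inj_onD)
qed

lemma reduced_braid_eq:
  assumes "w \<in> normal_words m" "reduced m (perm_of w) u" shows "braid_eq u w" "set u \<subseteq> {1..<m}"
proof -
  show u: "set u \<subseteq> {1..<m}" using assms by (auto simp: reduced_def decomposition_def)
  have "perm_of u = perm_of w" "length u = length w"
    using assms perm_len_normal_words[OF assms(1)] by (auto simp: reduced_def decomposition_def)
  with normal_words_normal_form[OF u] normal_words_inj[of m] assms(1) show "braid_eq u w"
    by (metis inj_onD)
qed

lemma reduced_normal_words:
  assumes "w \<in> normal_words m" shows "reduced m (perm_of w) w"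
  using normal_words_set[OF assms] perm_len_normal_words[OF assms] by (auto simp: reduced_def decomposition_def)

text \<open>
  A sum over permutations that refers to arbitrarily chosen reduced words does not depend on the
  choice if the summand is invariant under the braid congruence.
\<close>
lemma sum_reduced_words:
  assumes "\<And>w u. w \<in> normal_words m \<Longrightarrow> braid_eq u w \<Longrightarrow> set u \<subseteq> {1..<m} \<Longrightarrow> F (length w) u = F (length w) w"
  shows "(\<Sum>\<sigma> | \<sigma> permutes {1..m}. F (perm_len m \<sigma>) (SOME is. reduced m \<sigma> is)) =
    (\<Sum>w\<in>normal_words m. F (length w) w)"
proof -
  have "perm_of ` normal_words m = {\<sigma>. \<sigma> permutes {1..m}}"
    using normal_words_surj[of _ m] normal_words_set perm_of_permutes by force
  hence "(\<Sum>\<sigma> | \<sigma> permutes {1..m}. F (perm_len m \<sigma>) (SOME is. reduced m \<sigma> is)) =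
    (\<Sum>w\<in>normal_words m. F (perm_len m (perm_of w)) (SOME is. reduced m (perm_of w) is))"
    using sum.reindex[OF normal_words_inj, of _ m] by (metis (no_types, lifting) comp_apply sum.cong)
  also have "\<dots> = (\<Sum>w\<in>normal_words m. F (length w) w)"
  proof (rule sum.cong[OF HOL.refl])
    fix w assume w: "w \<in> normal_words m"
    have "reduced m (perm_of w) (SOME is. reduced m (perm_of w) is)"
      using reduced_normal_words[OF w] by (rule someI)
    from reduced_braid_eq[OF w this] assms[OF w] perm_len_normal_words[OF w]
    show "F (perm_len m (perm_of w)) (SOME is. reduced m (perm_of w) is) = F (length w) w" by simp
  qed
  finally show ?thesis .
qed

section \<open>q-symmetrizers in algebras satisfying the Hecke relations\<close>

text \<open>An algebra over the field \<open>'k\<close>, with the scalar multiplication as an explicit operation \<open>sc\<close>.\<close>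
locale scaled_ring =
  fixes sc :: "'k::field \<Rightarrow> 'a::ring_1 \<Rightarrow> 'a"
  assumes sc_add_right: "sc x (a + b) = sc x a + sc x b"
    and sc_add_left: "sc (x + y) a = sc x a + sc y a"
    and sc_sc [simp]: "sc x (sc y a) = sc (x * y) a"
    and sc_one [simp]: "sc 1 a = a"
    and sc_mult_left [simp]: "sc x a * b = sc x (a * b)"
    and sc_mult_right [simp]: "a * sc x b = sc x (a * b)"
begin

lemma sc_zero_right [simp]: "sc x 0 = 0"
  using sc_add_right[of x 0 0] by simp

lemma sc_zero_left [simp]: "sc 0 a = 0"
  using sc_add_left[of 0 0 a] by simp

lemma sc_minus_right: "sc x (- a) = - sc x a"
  using sc_add_right[of x a "- a"] by (simp add: eq_neg_iff_add_eq_0 add.commute)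

lemma sc_minus_left: "sc (- x) a = - sc x a"
  using sc_add_left[of x "- x" a] by (simp add: eq_neg_iff_add_eq_0 add.commute)

lemma sc_diff_right: "sc x (a - b) = sc x a - sc x b"
  using sc_add_right[of x a "- b"] by (simp add: sc_minus_right)

lemma sc_diff_left: "sc (x - y) a = sc x a - sc y a"
  using sc_add_left[of x "- y" a] by (simp add: sc_minus_left)

lemma sc_sum: "sc x (sum f A) = (\<Sum>i\<in>A. sc x (f i))"
  by (induction A rule: infinite_finite_induct) (simp_all add: sc_add_right)

lemma sc_cancel: "c \<noteq> 0 \<Longrightarrow> sc c x = sc c y \<Longrightarrow> x = y"
  by (metis left_inverse sc_one sc_sc)

lemmas sc_linear = sc_add_right sc_diff_right sc_minus_right

text \<open>
  With \<open>t\<close> standing for \<open>q\<close> or for \<open>-q\<^sup>-\<^sup>1\<close>, \<open>qrow t U m\<close> is the sum of \<open>t\<^bsup>l\<^esup> U\<^sub>m U\<^sub>m\<^sub>-\<^sub>1 \<cdots> U\<^sub>j\<close> over the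
  coset representatives of length \<open>l\<close> of \<open>S\<^sub>m\<close> in \<open>S\<^sub>m\<^sub>+\<^sub>1\<close>, written as a nested product, and
  \<open>qcol t U m\<close> is its mirror image. The products \<open>qsum\<close> and \<open>qsum'\<close> of these sums are two
  factorizations of the symmetrizer on \<open>m\<close> strands without its normalizing factor. Absorption of
  generators can be proved by induction on the right for the first one and on the left for the
  second one, and the two absorption properties then force them to agree.
\<close>
fun qrow :: "'k \<Rightarrow> (nat \<Rightarrow> 'a) \<Rightarrow> nat \<Rightarrow> 'a" where
  "qrow t U 0 = 1"
| "qrow t U (Suc m) = 1 + sc t (U (Suc m) * qrow t U m)"

fun qcol :: "'k \<Rightarrow> (nat \<Rightarrow> 'a) \<Rightarrow> nat \<Rightarrow> 'a" where
  "qcol t U 0 = 1"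
| "qcol t U (Suc m) = 1 + sc t (qcol t U m * U (Suc m))"

fun qsum :: "'k \<Rightarrow> (nat \<Rightarrow> 'a) \<Rightarrow> nat \<Rightarrow> 'a" where
  "qsum t U 0 = 1"
| "qsum t U (Suc m) = qsum t U m * qrow t U m"

fun qsum' :: "'k \<Rightarrow> (nat \<Rightarrow> 'a) \<Rightarrow> nat \<Rightarrow> 'a" where
  "qsum' t U 0 = 1"
| "qsum' t U (Suc m) = qcol t U m * qsum' t U m"

lemma qrow_words: "(\<Sum>j=1..Suc m. sc (t ^ length (down j m)) (prod_list (map U (down j m)))) = qrow t U m"
proof (induction m)
  case (Suc m)
  have "(\<Sum>j=1..Suc (Suc m). sc (t ^ length (down j (Suc m))) (prod_list (map U (down j (Suc m))))) =
    (\<Sum>j=1..Suc m. sc (t ^ length (down j (Suc m))) (prod_list (map U (down j (Suc m))))) + 1"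
    by simp
  also have "(\<Sum>j=1..Suc m. sc (t ^ length (down j (Suc m))) (prod_list (map U (down j (Suc m))))) =
    (\<Sum>j=1..Suc m. sc t (U (Suc m) * sc (t ^ length (down j m)) (prod_list (map U (down j m)))))"
    by (rule sum.cong) (auto simp: down_Suc)
  also have "\<dots> = sc t (U (Suc m) * qrow t U m)"
    by (simp only: sum_distrib_left[symmetric] sc_sum[symmetric] Suc.IH)
  finally show ?case by (simp add: add.commute)
qed (simp add: down_def)

lemma qsum_words: "(\<Sum>w\<in>normal_words m. sc (t ^ length w) (prod_list (map U w))) = qsum t U m"
proof (induction m)
  case (Suc m)
  have "(\<Sum>w\<in>normal_words (Suc m). sc (t ^ length w) (prod_list (map U w))) =
    (\<Sum>(w, j)\<in>normal_words m \<times> {1..Suc m}.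
      sc (t ^ length (w @ down j m)) (prod_list (map U (w @ down j m))))"
    unfolding normal_words.simps by (subst sum.reindex[OF normal_words_split_inj]) (simp add: case_prod_unfold)
  also have "\<dots> = (\<Sum>(w, j)\<in>normal_words m \<times> {1..Suc m}. sc (t ^ length w) (prod_list (map U w)) *
      sc (t ^ length (down j m)) (prod_list (map U (down j m))))"
    by (rule sum.cong) (auto simp: power_add mult.commute)
  also have "\<dots> = qsum t U m * qrow t U m"
    unfolding qrow_words[symmetric] Suc.IH[symmetric]
    by (simp only: sum_product sum.cartesian_product)
  finally show ?case by simp
qed simp

end

text \<open>
  This is \<open>t\<^bsup>n-1\<^esup> [n]\<^sub>t\<close>, the eigenvalue with which \<open>qrow t U (n-1)\<close> acts on a vector that every
  \<open>U\<^sub>i\<close> multiplies by \<open>t\<close>.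
\<close>
definition qnum :: "'k::field \<Rightarrow> nat \<Rightarrow> 'k" where
  "qnum t n = (\<Sum>j<n. t ^ (2 * j))"

definition qnum_fact :: "'k::field \<Rightarrow> nat \<Rightarrow> 'k" where
  "qnum_fact t m = (\<Prod>j=1..m. qnum t j)"

lemma qnum_0 [simp]: "qnum t 0 = 0" and qnum_1 [simp]: "qnum t (Suc 0) = 1"
  by (simp_all add: qnum_def)

lemma qnum_Suc: "qnum t (Suc n) = 1 + t * (t * qnum t n)"
proof -
  have "qnum t (Suc n) = 1 + (\<Sum>j<n. t ^ (2 * Suc j))"
    unfolding qnum_def by (subst sum.lessThan_Suc_shift) simp
  thus ?thesis by (simp add: qnum_def sum_distrib_left algebra_simps)
qed

lemma qnum_fact_0 [simp]: "qnum_fact t 0 = 1"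
  and qnum_fact_Suc: "qnum_fact t (Suc m) = qnum_fact t m * qnum t (Suc m)"
  by (simp_all add: qnum_fact_def)

text \<open>
  The generators of the Hecke algebra on \<open>n\<close> strands have the eigenvalues \<open>t\<close> and \<open>-t\<^sup>-\<^sup>1\<close>, so the
  relations are the same for \<open>t = q\<close> and for \<open>t = -q\<^sup>-\<^sup>1\<close>. Working with a general \<open>t\<close> treats
  symmetrizers and antisymmetrizers at once.
\<close>
locale hecke = scaled_ring sc for sc :: "'k::field \<Rightarrow> 'a::ring_1 \<Rightarrow> 'a" +
  fixes t :: 'k and U :: "nat \<Rightarrow> 'a" and n :: nat
  assumes t_nonzero [simp]: "t \<noteq> 0"
    and qnum_nonzero: "j > 0 \<Longrightarrow> qnum t j \<noteq> 0"
    and square: "1 \<le> i \<Longrightarrow> i < n \<Longrightarrow> U i * U i = 1 + sc (t - inverse t) (U i)"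
    and far_comm: "1 \<le> i \<Longrightarrow> Suc i < j \<Longrightarrow> j < n \<Longrightarrow> U i * U j = U j * U i"
    and braid_rel: "1 \<le> i \<Longrightarrow> Suc i < n \<Longrightarrow> U i * U (Suc i) * U i = U (Suc i) * U i * U (Suc i)"
begin

lemma qrow_comm: "Suc m < i \<Longrightarrow> i < n \<Longrightarrow> qrow t U m * U i = U i * qrow t U m"
proof (induction m)
  case (Suc m)
  have "U (Suc m) * U i = U i * U (Suc m)" using Suc.prems by (intro far_comm) auto
  hence "U (Suc m) * qrow t U m * U i = U i * (U (Suc m) * qrow t U m)"
    using Suc.IH Suc.prems by (metis Suc_lessD mult.assoc)
  thus ?case by (simp add: distrib_left distrib_right)
qed simp

lemma qcol_comm: "Suc m < i \<Longrightarrow> i < n \<Longrightarrow> qcol t U m * U i = U i * qcol t U m"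
proof (induction m)
  case (Suc m)
  have "U (Suc m) * U i = U i * U (Suc m)" using Suc.prems by (intro far_comm) auto
  hence "qcol t U m * U (Suc m) * U i = U i * (qcol t U m * U (Suc m))"
    using Suc.IH Suc.prems by (metis Suc_lessD mult.assoc)
  thus ?case by (simp add: distrib_left distrib_right)
qed simp

lemma qsum_comm: "m < i \<Longrightarrow> i < n \<Longrightarrow> qsum t U m * U i = U i * qsum t U m"
proof (induction m)
  case (Suc m) thus ?case using qrow_comm[of m i] by (metis Suc_lessD mult.assoc qsum.simps(2))
qed simp

lemma qsum'_comm: "m < i \<Longrightarrow> i < n \<Longrightarrow> qsum' t U m * U i = U i * qsum' t U m"
proof (induction m)
  case (Suc m) thus ?case using qcol_comm[of m i] by (metis Suc_lessD mult.assoc qsum'.simps(2))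
qed simp

definition absorbs_right :: "nat \<Rightarrow> 'a \<Rightarrow> bool" where
  "absorbs_right m P \<longleftrightarrow> (\<forall>i. 1 \<le> i \<and> i < m \<longrightarrow> P * U i = sc t P)"

definition absorbs_left :: "nat \<Rightarrow> 'a \<Rightarrow> bool" where
  "absorbs_left m P \<longleftrightarrow> (\<forall>i. 1 \<le> i \<and> i < m \<longrightarrow> U i * P = sc t P)"

lemma absorbs_right_qrow: "absorbs_right (Suc m) P \<Longrightarrow> P * qrow t U m = sc (qnum t (Suc m)) P"
proof (induction m)
  case (Suc m)
  hence "absorbs_right (Suc m) P" by (auto simp: absorbs_right_def)
  hence IH: "P * qrow t U m = sc (qnum t (Suc m)) P" by (rule Suc.IH)
  have "P * U (Suc m) = sc t P" using Suc.prems by (auto simp: absorbs_right_def)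
  hence "P * (U (Suc m) * qrow t U m) = sc t (P * qrow t U m)" by (simp add: mult.assoc[symmetric])
  thus ?case by (subst qnum_Suc) (simp add: distrib_left sc_add_left IH)
qed simp

lemma absorbs_left_qrow: "absorbs_left (Suc m) P \<Longrightarrow> qrow t U m * P = sc (qnum t (Suc m)) P"
proof (induction m)
  case (Suc m)
  hence "absorbs_left (Suc m) P" by (auto simp: absorbs_left_def)
  hence IH: "qrow t U m * P = sc (qnum t (Suc m)) P" by (rule Suc.IH)
  have "U (Suc m) * P = sc t P" using Suc.prems by (auto simp: absorbs_left_def)
  hence "qrow t U (Suc m) * P = P + sc (t * (qnum t (Suc m) * t)) P"
    by (simp add: distrib_right mult.assoc IH)
  thus ?case by (subst qnum_Suc) (simp add: sc_add_left mult_ac)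
qed simp

lemma absorbs_left_qcol: "absorbs_left (Suc m) P \<Longrightarrow> qcol t U m * P = sc (qnum t (Suc m)) P"
proof (induction m)
  case (Suc m)
  hence "absorbs_left (Suc m) P" by (auto simp: absorbs_left_def)
  hence IH: "qcol t U m * P = sc (qnum t (Suc m)) P" by (rule Suc.IH)
  have "U (Suc m) * P = sc t P" using Suc.prems by (auto simp: absorbs_left_def)
  hence "qcol t U (Suc m) * P = P + sc (t * (t * qnum t (Suc m))) P"
    by (simp add: distrib_right mult.assoc IH)
  thus ?case by (subst qnum_Suc) (simp add: sc_add_left)
qed simp

lemma absorbs_right_qcol: "absorbs_right (Suc m) P \<Longrightarrow> P * qcol t U m = sc (qnum t (Suc m)) P"
proof (induction m)
  case (Suc m)
  hence "absorbs_right (Suc m) P" by (auto simp: absorbs_right_def)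
  hence IH: "P * qcol t U m = sc (qnum t (Suc m)) P" by (rule Suc.IH)
  have "P * U (Suc m) = sc t P" using Suc.prems by (auto simp: absorbs_right_def)
  hence "P * (qcol t U m * U (Suc m)) = sc (qnum t (Suc m) * t) P"
    using IH by (simp add: mult.assoc[symmetric])
  thus ?case by (subst qnum_Suc) (simp add: distrib_left sc_add_left mult_ac)
qed simp

lemma absorbs_right_qsum: "absorbs_right m P \<Longrightarrow> P * qsum t U m = sc (qnum_fact t m) P"
proof (induction m)
  case (Suc m)
  hence "P * qsum t U m = sc (qnum_fact t m) P" by (auto simp: absorbs_right_def)
  hence "P * qsum t U (Suc m) = sc (qnum_fact t m) (P * qrow t U m)"
    by (simp add: mult.assoc[symmetric])
  thus ?case using absorbs_right_qrow[OF Suc.prems] by (simp add: qnum_fact_Suc)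
qed simp

lemma absorbs_left_qsum: "absorbs_left m P \<Longrightarrow> qsum t U m * P = sc (qnum_fact t m) P"
proof (induction m)
  case (Suc m)
  hence "qsum t U m * P = sc (qnum_fact t m) P" by (auto simp: absorbs_left_def)
  thus ?case using absorbs_left_qrow[OF Suc.prems] by (simp add: mult.assoc qnum_fact_Suc mult.commute)
qed simp

lemma absorbs_right_qsum': "absorbs_right m P \<Longrightarrow> P * qsum' t U m = sc (qnum_fact t m) P"
proof (induction m)
  case (Suc m)
  hence IH: "P * qsum' t U m = sc (qnum_fact t m) P" by (auto simp: absorbs_right_def)
  have "P * qsum' t U (Suc m) = sc (qnum t (Suc m)) (P * qsum' t U m)"
    using absorbs_right_qcol[OF Suc.prems] by (simp add: mult.assoc[symmetric])
  thus ?case by (simp add: IH qnum_fact_Suc mult.commute)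
qed simp

lemma absorbs_left_qsum': "absorbs_left m P \<Longrightarrow> qsum' t U m * P = sc (qnum_fact t m) P"
proof (induction m)
  case (Suc m)
  hence IH: "qsum' t U m * P = sc (qnum_fact t m) P" by (auto simp: absorbs_left_def)
  thus ?case using absorbs_left_qcol[OF Suc.prems] by (simp add: qnum_fact_Suc mult.assoc)
qed simp

lemma qnum_fact_nonzero: "qnum_fact t m \<noteq> 0"
  by (simp add: qnum_fact_def qnum_nonzero)

text \<open>
  Both are \<open>(U\<^sub>i - t)(U\<^sub>i + t\<^sup>-\<^sup>1) = 0\<close> in the form in which two neighbouring terms of a coset sum
  occur.
\<close>
lemma quadratic:
  assumes "1 \<le> i" "i < n"
  shows "U i - sc t 1 + sc t (U i * (U i - sc t 1)) = 0"
    "U i - sc t 1 + sc t ((U i - sc t 1) * U i) = 0"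
proof -
  have "sc t (U i * (U i - sc t 1)) = sc t 1 + sc (t * (t - inverse t)) (U i) - sc (t * t) (U i)"
    by (simp add: right_diff_distrib square[OF assms] sc_linear)
  also have "t * (t - inverse t) = t * t - 1" by (simp add: right_diff_distrib)
  finally have e: "sc t (U i * (U i - sc t 1)) = sc t 1 - U i" by (simp add: sc_diff_left)
  thus "U i - sc t 1 + sc t (U i * (U i - sc t 1)) = 0" by simp
  have "(U i - sc t 1) * U i = U i * (U i - sc t 1)" by (simp add: algebra_simps)
  thus "U i - sc t 1 + sc t ((U i - sc t 1) * U i) = 0" using e by simp
qed

text \<open>
  With \<open>E\<close> the symmetrizer on \<open>m - 1\<close> strands, it is to be shown that \<open>E y (U\<^sub>i - t) = 0\<close> for the
  sum \<open>y\<close> over coset representatives. For the last generator, the first two terms of \<open>y\<close> cancel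
  by the quadratic relation, and in the others the braid relation carries \<open>U\<^sub>i - t\<close> to the left
  as \<open>U\<^sub>i\<^sub>-\<^sub>1 - t\<close>, where \<open>E\<close> kills it. For the other generators the induction hypothesis applies
  to the shorter coset sum, once a smaller symmetrizer is split off from \<open>E\<close>.
\<close>
lemma qsum_absorbs_right: "m \<le> n \<Longrightarrow> absorbs_right m (qsum t U m)"
proof (induction m rule: less_induct)
  case (less m)
  show ?case
  proof (cases "m \<le> 1")
    case True thus ?thesis by (auto simp: absorbs_right_def)
  next
    case False
    then obtain p where p: "m = Suc (Suc p)" by (metis One_nat_def not_less_eq_eq not0_implies_Suc le0)
    define E where "E = qsum t U (Suc p)"
    have E: "absorbs_right (Suc p) E" unfolding E_def using less.IH[of "Suc p"] less.prems p by (simp del: qsum.simps qsum'.simps)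
    hence EU: "E * (U i - sc t 1) = 0" if "1 \<le> i" "i < Suc p" for i
      using that by (auto simp: absorbs_right_def right_diff_distrib)
    have "E * (qrow t U (Suc p) * (U i - sc t 1)) = 0" if i: "1 \<le> i" "i < m" for i
    proof (cases "i = Suc p")
      case True
      \<comment> \<open>The contributions of the coset representatives \<open>1\<close> and \<open>U\<^sub>i\<close> cancel.\<close>
      have top: "U i - sc t 1 + sc t (U i * (U i - sc t 1)) = 0" using quadratic i p less.prems by simp
      show ?thesis
      proof (cases p)
        case 0
        thus ?thesis using top True by (simp add: E_def distrib_right)
      next
        case (Suc r)
        define Y where "Y = qrow t U r"
        have YU: "Y * U i = U i * Y"
          unfolding Y_def using qrow_comm[of r i] True Suc p less.prems by simp
        have br: "U p * U i * U p = U i * U p * U i"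
          using braid_rel[of p] True Suc p less.prems by simp
        have "U i * U p * (U i - sc t 1) = (U p - sc t 1) * (U i * U p)"
          using br by (simp add: right_diff_distrib left_diff_distrib mult.assoc)
        moreover have "Y * (U i - sc t 1) = (U i - sc t 1) * Y"
          using YU by (simp add: right_diff_distrib left_diff_distrib)
        ultimately have "E * (U i * (U p * (Y * (U i - sc t 1)))) = E * (U p - sc t 1) * (U i * U p * Y)"
          by (metis mult.assoc)
        \<comment> \<open>The remaining representatives begin with \<open>U\<^sub>i U\<^sub>p\<close>, and \<open>U\<^sub>i - t\<close> reaches \<open>E\<close> as \<open>U\<^sub>p - t\<close>.\<close>
        hence van: "E * (U i * (U p * (Y * (U i - sc t 1)))) = 0"
          using EU[of p] Suc by simp
        have "qrow t U (Suc p) = 1 + sc t (U i) + sc (t * t) (U i * (U p * Y))"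
          unfolding Y_def using True Suc by (simp add: distrib_left sc_add_right add.assoc)
        hence "qrow t U (Suc p) * (U i - sc t 1) =
          (U i - sc t 1 + sc t (U i * (U i - sc t 1))) + sc (t * t) (U i * (U p * (Y * (U i - sc t 1))))"
          by (simp only: distrib_right mult_1 sc_mult_left mult.assoc)
        thus ?thesis using top van by simp
      qed
    next
      case False
      hence ip: "i < Suc p" using i p by simp
      \<comment> \<open>A multiple of \<open>E\<close> equals \<open>E F\<close>, and \<open>F\<close> commutes with \<open>U\<^sub>p\<^sub>+\<^sub>1\<close>; next to the shorter coset
        sum it forms \<open>E\<close>.\<close>
      define F where "F = qsum t U p"
      have EF: "E * F = sc (qnum_fact t p) E"
        unfolding F_def using E by (intro absorbs_right_qsum) (auto simp: absorbs_right_def)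
      have FY: "F * qrow t U p * (U i - sc t 1) = 0"
        using EU[OF i(1) ip] by (simp add: E_def F_def)
      have FU: "F * U (Suc p) = U (Suc p) * F"
        unfolding F_def using qsum_comm[of p "Suc p"] p less.prems by simp
      have "sc (qnum_fact t p) (E * (U (Suc p) * (qrow t U p * (U i - sc t 1)))) =
         E * F * (U (Suc p) * (qrow t U p * (U i - sc t 1)))" by (simp add: EF)
      also have "\<dots> = E * (U (Suc p) * (F * qrow t U p * (U i - sc t 1)))"
        using FU by (metis mult.assoc)
      also have "\<dots> = sc (qnum_fact t p) 0" by (simp only: FY) simp
      finally have "E * (U (Suc p) * (qrow t U p * (U i - sc t 1))) = 0"
        using sc_cancel[OF qnum_fact_nonzero] by blast
      moreover have "qrow t U (Suc p) * (U i - sc t 1) =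
          (U i - sc t 1) + sc t (U (Suc p) * (qrow t U p * (U i - sc t 1)))"
        by (simp only: qrow.simps distrib_right mult_1 sc_mult_left mult.assoc)
      ultimately show ?thesis using EU[OF i(1) ip] by (simp add: distrib_left)
    qed
    hence "E * qrow t U (Suc p) * (U i - sc t 1) = 0" if "1 \<le> i" "i < m" for i
      using that by (simp add: mult.assoc)
    thus ?thesis unfolding p absorbs_right_def E_def
      by (auto simp: right_diff_distrib simp del: qrow.simps)
  qed
qed

text \<open>The mirror image of the preceding argument.\<close>
lemma qsum'_absorbs_left: "m \<le> n \<Longrightarrow> absorbs_left m (qsum' t U m)"
proof (induction m rule: less_induct)
  case (less m)
  show ?case
  proof (cases "m \<le> 1")
    case True thus ?thesis by (auto simp: absorbs_left_def)
  next
    case False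
    then obtain p where p: "m = Suc (Suc p)" by (metis One_nat_def not_less_eq_eq not0_implies_Suc le0)
    define E where "E = qsum' t U (Suc p)"
    have E: "absorbs_left (Suc p) E" unfolding E_def using less.IH[of "Suc p"] less.prems p by (simp del: qsum.simps qsum'.simps)
    hence EU: "(U i - sc t 1) * E = 0" if "1 \<le> i" "i < Suc p" for i
      using that by (auto simp: absorbs_left_def left_diff_distrib)
    have "(U i - sc t 1) * qcol t U (Suc p) * E = 0" if i: "1 \<le> i" "i < m" for i
    proof (cases "i = Suc p")
      case True
      have top: "U i - sc t 1 + sc t ((U i - sc t 1) * U i) = 0" using quadratic i p less.prems by simp
      show ?thesis
      proof (cases p)
        case 0
        thus ?thesis using top True by (simp add: E_def distrib_left)
      next
        case (Suc r)
        define Y where "Y = qcol t U r"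
        have YU: "Y * U i = U i * Y"
          unfolding Y_def using qcol_comm[of r i] True Suc p less.prems by simp
        have br: "U p * U i * U p = U i * U p * U i"
          using braid_rel[of p] True Suc p less.prems by simp
        have "(U i - sc t 1) * (U p * U i) = U p * U i * (U p - sc t 1)"
          using br by (simp add: right_diff_distrib left_diff_distrib mult.assoc)
        moreover have "(U i - sc t 1) * Y = Y * (U i - sc t 1)"
          using YU by (simp add: right_diff_distrib left_diff_distrib)
        ultimately have "(U i - sc t 1) * (Y * (U p * U i)) * E = Y * (U p * U i) * ((U p - sc t 1) * E)"
          by (metis mult.assoc)
        hence van: "(U i - sc t 1) * (Y * (U p * U i)) * E = 0"
          using EU[of p] Suc by simp
        have "qcol t U (Suc p) = 1 + sc t (U i) + sc (t * t) (Y * (U p * U i))"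
          unfolding Y_def using True Suc by (simp add: distrib_right sc_add_right add.assoc mult.assoc)
        hence "(U i - sc t 1) * qcol t U (Suc p) =
          (U i - sc t 1 + sc t ((U i - sc t 1) * U i)) + sc (t * t) ((U i - sc t 1) * (Y * (U p * U i)))"
          by (simp only: distrib_left mult_1_right sc_mult_right)
        thus ?thesis using top van by simp
      qed
    next
      case False
      hence ip: "i < Suc p" using i p by simp
      define F where "F = qsum' t U p"
      have EF: "F * E = sc (qnum_fact t p) E"
        unfolding F_def using E by (intro absorbs_left_qsum') (auto simp: absorbs_left_def)
      have FY: "(U i - sc t 1) * qcol t U p * F = 0"
        using EU[OF i(1) ip] by (simp add: E_def F_def mult.assoc)
      have FU: "F * U (Suc p) = U (Suc p) * F"
        unfolding F_def using qsum'_comm[of p "Suc p"] p less.prems by simp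
      have "sc (qnum_fact t p) ((U i - sc t 1) * qcol t U p * U (Suc p) * E) =
         (U i - sc t 1) * qcol t U p * U (Suc p) * (F * E)" by (simp add: EF)
      also have "\<dots> = ((U i - sc t 1) * qcol t U p * F) * (U (Suc p) * E)"
        using FU by (metis mult.assoc)
      also have "\<dots> = sc (qnum_fact t p) 0" by (simp only: FY) simp
      finally have "(U i - sc t 1) * qcol t U p * U (Suc p) * E = 0"
        using sc_cancel[OF qnum_fact_nonzero] by blast
      moreover have "(U i - sc t 1) * qcol t U (Suc p) =
          (U i - sc t 1) + sc t ((U i - sc t 1) * qcol t U p * U (Suc p))"
        by (simp only: qcol.simps distrib_left mult_1_right sc_mult_right mult.assoc)
      ultimately show ?thesis using EU[OF i(1) ip] by (simp add: distrib_right)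
    qed
    hence "(U i - sc t 1) * (qcol t U (Suc p) * E) = 0" if "1 \<le> i" "i < m" for i
      using that by (simp add: mult.assoc)
    thus ?thesis unfolding p absorbs_left_def E_def
      by (auto simp: left_diff_distrib simp del: qcol.simps)
  qed
qed

text \<open>
  The product of the two factorizations is \<open>[m]!\<close> times either of them, since one absorbs from
  the right and the other from the left.
\<close>
lemma qsum_eq_qsum': "m \<le> n \<Longrightarrow> qsum t U m = qsum' t U m"
proof -
  assume m: "m \<le> n"
  have "sc (qnum_fact t m) (qsum t U m) = sc (qnum_fact t m) (qsum' t U m)"
    using absorbs_right_qsum'[OF qsum_absorbs_right[OF m]]
      absorbs_left_qsum[OF qsum'_absorbs_left[OF m]] by simp
  thus ?thesis using sc_cancel[OF qnum_fact_nonzero] by blast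
qed

lemma qsum_absorbs_left: "m \<le> n \<Longrightarrow> absorbs_left m (qsum t U m)"
  using qsum'_absorbs_left qsum_eq_qsum' by simp

end

section \<open>The alternating sum of overlapping projections\<close>

context scaled_ring begin

lemma qrow_cong: "(\<And>i. 1 \<le> i \<Longrightarrow> i \<le> m \<Longrightarrow> U i = V i) \<Longrightarrow> qrow t U m = qrow t V m"
  by (induction m) simp_all

lemma qsum_cong: "(\<And>i. 1 \<le> i \<Longrightarrow> i < m \<Longrightarrow> U i = V i) \<Longrightarrow> qsum t U m = qsum t V m"
proof (induction m)
  case (Suc m) thus ?case using qrow_cong[of m U V] by simp
qed simp

lemma qrow_commute: "(\<And>i. 1 \<le> i \<Longrightarrow> i \<le> m \<Longrightarrow> x * U i = U i * x) \<Longrightarrow> x * qrow t U m = qrow t U m * x"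
proof (induction m)
  case (Suc m)
  have "x * (U (Suc m) * qrow t U m) = U (Suc m) * qrow t U m * x"
    using Suc.prems[of "Suc m"] Suc.IH Suc.prems by (metis Suc_eq_plus1_left le_SucI le_add1 le_refl mult.assoc)
  thus ?case by (simp add: distrib_left distrib_right)
qed simp

lemma qsum_commute: "(\<And>i. 1 \<le> i \<Longrightarrow> i < m \<Longrightarrow> x * U i = U i * x) \<Longrightarrow> x * qsum t U m = qsum t U m * x"
proof (induction m)
  case (Suc m)
  have "x * qrow t U m = qrow t U m * x" using Suc.prems by (intro qrow_commute) auto
  moreover have "x * qsum t U m = qsum t U m * x" using Suc by auto
  ultimately show ?case by (metis mult.assoc qsum.simps(2))
qed simp

text \<open>The symmetrizer normalized to be idempotent.\<close>
definition qproj :: "'k \<Rightarrow> (nat \<Rightarrow> 'a) \<Rightarrow> nat \<Rightarrow> 'a" where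
  "qproj t U m = sc (inverse (qnum_fact t m)) (qsum t U m)"

lemma qproj_0 [simp]: "qproj t U 0 = 1" and qproj_1 [simp]: "qproj t U (Suc 0) = 1"
  by (simp_all add: qproj_def qnum_fact_Suc)

lemma qproj_commute: "(\<And>i. 1 \<le> i \<Longrightarrow> i < m \<Longrightarrow> x * U i = U i * x) \<Longrightarrow> x * qproj t U m = qproj t U m * x"
  using qsum_commute[of m x U t] by (simp add: qproj_def)

end

lemma qnum_add: "qnum t (n + r) = qnum t n + t ^ (2 * n) * qnum t r"
  by (induction r) (simp_all add: qnum_def distrib_left power_add[symmetric] algebra_simps)

text \<open>
  The \<open>q\<close>-number \<open>[n+1]\<close> is invariant under \<open>t \<mapsto> -t\<^sup>-\<^sup>1\<close> up to sign, hence \<open>qnum\<close> changes by a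
  power of \<open>t\<close>.
\<close>
lemma qnum_inverse:
  assumes "t \<noteq> 0" shows "t ^ (2 * n) * qnum (- inverse t) (Suc n) = qnum t (Suc n)"
proof -
  have "qnum t (Suc n) = (\<Sum>j<Suc n. t ^ (2 * (n - j)))"
    unfolding qnum_def by (subst sum.nat_diff_reindex[symmetric]) simp
  also have "\<dots> = (\<Sum>j<Suc n. t ^ (2 * n) * (- inverse t) ^ (2 * j))"
  proof (rule sum.cong[OF refl])
    fix j assume "j \<in> {..<Suc n}"
    hence "2 * n = 2 * (n - j) + 2 * j" by simp
    hence "t ^ (2 * n) = t ^ (2 * (n - j)) * t ^ (2 * j)" by (metis power_add)
    thus "t ^ (2 * (n - j)) = t ^ (2 * n) * (- inverse t) ^ (2 * j)"
      using assms by (simp add: field_simps)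
  qed
  finally show ?thesis by (simp only: qnum_def sum_distrib_left)
qed

context hecke begin

lemma hecke_restrict: "m \<le> n \<Longrightarrow> hecke sc t U m"
proof unfold_locales
  fix i j assume "m \<le> n" "1 \<le> i" "Suc i < j" "j < m"
  thus "U i * U j = U j * U i" by (intro far_comm) auto
next
  fix i assume "m \<le> n" "1 \<le> i" "Suc i < m"
  thus "U i * U (Suc i) * U i = U (Suc i) * U i * U (Suc i)" by (intro braid_rel) auto
qed (use qnum_nonzero square in auto)

lemma hecke_shift: "r + m \<le> n \<Longrightarrow> hecke sc t (\<lambda>i. U (r + i)) m"
proof unfold_locales
  fix i assume "r + m \<le> n" "1 \<le> i" "Suc i < m"
  thus "U (r + i) * U (r + Suc i) * U (r + i) = U (r + Suc i) * U (r + i) * U (r + Suc i)"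
    using braid_rel[of "r + i"] by simp
next
  fix i j assume "r + m \<le> n" "1 \<le> i" "Suc i < j" "j < m"
  thus "U (r + i) * U (r + j) = U (r + j) * U (r + i)" by (intro far_comm) auto
qed (use qnum_nonzero square in auto)

lemma hecke_reverse: "hecke sc t (\<lambda>i. U (n - i)) n"
proof unfold_locales
  fix i j assume "1 \<le> i" "Suc i < j" "j < n"
  thus "U (n - i) * U (n - j) = U (n - j) * U (n - i)"
    using far_comm[of "n - j" "n - i"] by simp
next
  fix i assume "1 \<le> i" "Suc i < n"
  thus "U (n - i) * U (n - Suc i) * U (n - i) = U (n - Suc i) * U (n - i) * U (n - Suc i)"
    using braid_rel[of "n - Suc i"] by (simp add: Suc_diff_Suc)
qed (use qnum_nonzero square in auto)

text \<open>
  An element that absorbs all generators on both sides is determined up to its normalization, so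
  it does not see the order in which the strands are numbered.
\<close>
lemma qsum_reverse: "qsum t U n = qsum t (\<lambda>i. U (n - i)) n"
proof -
  interpret R: hecke sc t "\<lambda>i. U (n - i)" n by (rule hecke_reverse)
  define P where "P = qsum t (\<lambda>i. U (n - i)) n"
  have "R.absorbs_left n (qsum t U n)" unfolding R.absorbs_left_def
  proof safe
    fix i assume "1 \<le> i" "i < n"
    hence "1 \<le> n - i" "n - i < n" by auto
    thus "U (n - i) * qsum t U n = sc t (qsum t U n)"
      using qsum_absorbs_left[of n] unfolding absorbs_left_def by blast
  qed
  hence 1: "P * qsum t U n = sc (qnum_fact t n) (qsum t U n)"
    unfolding P_def by (rule R.absorbs_left_qsum)
  have "absorbs_right n P" unfolding absorbs_right_def
  proof safe
    fix i assume "1 \<le> i" "i < n"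
    hence "1 \<le> n - i" "n - i < n" "n - (n - i) = i" by auto
    thus "P * U i = sc t P"
      using R.qsum_absorbs_right[of n] unfolding P_def R.absorbs_right_def by (metis le_refl)
  qed
  hence "P * qsum t U n = sc (qnum_fact t n) P" by (rule absorbs_right_qsum)
  with 1 have "sc (qnum_fact t n) (qsum t U n) = sc (qnum_fact t n) P" by simp
  thus ?thesis unfolding P_def using sc_cancel[OF qnum_fact_nonzero] by blast
qed

lemma qproj_reverse: "qproj t U n = qproj t (\<lambda>i. U (n - i)) n"
  by (simp add: qproj_def qsum_reverse)

lemma qproj_absorbs:
  assumes "m \<le> n" "1 \<le> i" "i < m"
  shows "qproj t U m * U i = sc t (qproj t U m)" "U i * qproj t U m = sc t (qproj t U m)"
  using qsum_absorbs_right[OF assms(1)] qsum_absorbs_left[OF assms(1)] assms(2,3)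
  by (auto simp: qproj_def absorbs_right_def absorbs_left_def mult.commute)

lemma qproj_idem: "m \<le> n \<Longrightarrow> qproj t U m * qproj t U m = qproj t U m"
  using absorbs_right_qsum[OF qsum_absorbs_right] qnum_fact_nonzero[of m] by (simp add: qproj_def)

text \<open>
  The double coset decomposition of \<open>S\<^sub>m\<^sub>+\<^sub>1\<close> with respect to \<open>S\<^sub>m\<close> has two classes, represented by
  \<open>1\<close> and by the last transposition.
\<close>
lemma qproj_step:
  assumes "1 \<le> m" "m < n"
  shows "sc (qnum t (Suc m)) (qproj t U (Suc m)) =
    qproj t U m * (1 + sc (t * qnum t m) (U m)) * qproj t U m"
proof -
  obtain p where p: "m = Suc p" using assms by (cases m) auto
  define E where "E = qsum t U m"
  define c where "c = qnum_fact t m"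
  have c: "c \<noteq> 0" by (simp add: c_def qnum_fact_nonzero)
  have "absorbs_right m (qsum t U (Suc m))"
    using qsum_absorbs_right[of "Suc m"] assms by (auto simp: absorbs_right_def)
  hence "sc c (qsum t U (Suc m)) = E * qrow t U m * E"
    using absorbs_right_qsum[of m "qsum t U (Suc m)"] by (simp add: E_def c_def)
  also have "\<dots> = E * (E + sc t (U m * (qrow t U p * E)))"
    by (simp add: p distrib_left distrib_right mult.assoc)
  also have "qrow t U p * E = sc (qnum t m) E"
    using absorbs_left_qrow[of p E] qsum_absorbs_left[of m] assms by (simp add: p E_def)
  also have "E * (E + sc t (U m * sc (qnum t m) E)) = E * (1 + sc (t * qnum t m) (U m)) * E"
    by (simp add: distrib_left distrib_right mult.assoc)
  finally have e: "sc c (qsum t U (Suc m)) = E * (1 + sc (t * qnum t m) (U m)) * E" .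
  have "qproj t U m * (1 + sc (t * qnum t m) (U m)) * qproj t U m =
    sc (inverse c * inverse c) (E * (1 + sc (t * qnum t m) (U m)) * E)"
    by (simp add: qproj_def E_def c_def)
  also have "\<dots> = sc (inverse c * inverse c * c) (qsum t U (Suc m))" by (simp only: e[symmetric] sc_sc)
  also have "inverse c * inverse c * c = inverse c" using c by simp
  also have "sc (inverse c) (qsum t U (Suc m)) = sc (qnum t (Suc m)) (qproj t U (Suc m))"
    using qnum_nonzero[of "Suc m"] c by (simp add: qproj_def qnum_fact_Suc c_def[symmetric] field_simps)
  finally show ?thesis by simp
qed

end

text \<open>
  The abstract setting of the telescoping argument. In the application \<open>H\<close> is an algebra of
  operators containing the Hecke generators, and \<open>K\<close> consists of the operators \<open>W\<close> with
  \<open>str (W X) = 0\<close> modulo the relations. Then \<open>trace\<close> is the Manin relation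
  \<open>(T\<^sub>i - q) X (T\<^sub>i + q\<^sup>-\<^sup>1) = 0\<close> with the last factor moved to the front by cyclicity.
\<close>
locale manin_trace = scaled_ring sc for sc :: "'k::field \<Rightarrow> 'a::ring_1 \<Rightarrow> 'a" +
  fixes K H :: "'a set" and q :: 'k and T :: "nat \<Rightarrow> 'a" and k :: nat
  assumes K0: "0 \<in> K" and K_add: "a \<in> K \<Longrightarrow> b \<in> K \<Longrightarrow> a + b \<in> K" and K_sc: "a \<in> K \<Longrightarrow> sc x a \<in> K"
    and H1: "1 \<in> H" and H_add: "a \<in> H \<Longrightarrow> b \<in> H \<Longrightarrow> a + b \<in> H"
    and H_mult: "a \<in> H \<Longrightarrow> b \<in> H \<Longrightarrow> a * b \<in> H" and H_sc: "a \<in> H \<Longrightarrow> sc x a \<in> H"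
    and H_T: "1 \<le> i \<Longrightarrow> i < k \<Longrightarrow> T i \<in> H"
    and trace: "W \<in> H \<Longrightarrow> 1 \<le> i \<Longrightarrow> i < k \<Longrightarrow>
      (T i + sc (inverse q) 1) * W * (T i - sc q 1) \<in> K"
    and hecke_q: "hecke sc q T k" and hecke_q': "hecke sc (- inverse q) T k"
begin

lemma K_minus: "a \<in> K \<Longrightarrow> - a \<in> K"
  using K_sc[of a "-1"] by (simp add: sc_minus_left)

lemma K_diff: "a \<in> K \<Longrightarrow> b \<in> K \<Longrightarrow> a - b \<in> K"
  using K_add[of a "- b"] K_minus[of b] by simp

lemma K_sum: "(\<And>i. i \<in> A \<Longrightarrow> f i \<in> K) \<Longrightarrow> sum f A \<in> K"
  by (induction A rule: infinite_finite_induct) (auto intro: K0 K_add)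

definition cong :: "'a \<Rightarrow> 'a \<Rightarrow> bool" (infix "\<approx>" 50) where "a \<approx> b \<longleftrightarrow> a - b \<in> K"

lemma cong_refl [simp]: "a \<approx> a" by (simp add: cong_def K0)
lemma cong_sym: "a \<approx> b \<Longrightarrow> b \<approx> a" using K_minus[of "a - b"] by (simp add: cong_def)
lemma cong_trans [trans]: "a \<approx> b \<Longrightarrow> b \<approx> c \<Longrightarrow> a \<approx> c"
  using K_add[of "a - b" "b - c"] by (simp add: cong_def)
lemma cong_add: "a \<approx> b \<Longrightarrow> c \<approx> d \<Longrightarrow> a + c \<approx> b + d"
  using K_add[of "a - b" "c - d"] by (simp add: cong_def algebra_simps)
lemma cong_diff: "a \<approx> b \<Longrightarrow> c \<approx> d \<Longrightarrow> a - c \<approx> b - d"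
  using K_diff[of "a - b" "c - d"] by (simp add: cong_def algebra_simps)
lemma cong_sc: "a \<approx> b \<Longrightarrow> sc x a \<approx> sc x b"
  using K_sc[of "a - b"] by (simp add: cong_def sc_diff_right)

lemma qrow_H: "(\<And>i. 1 \<le> i \<Longrightarrow> i \<le> m \<Longrightarrow> U i \<in> H) \<Longrightarrow> qrow t U m \<in> H"
  by (induction m) (auto intro!: H1 H_add H_mult H_sc)

lemma qsum_H: "(\<And>i. 1 \<le> i \<Longrightarrow> i < m \<Longrightarrow> U i \<in> H) \<Longrightarrow> qsum t U m \<in> H"
proof (induction m)
  case (Suc m) thus ?case using qrow_H[of m U t] by (auto intro!: H_mult)
qed (simp add: H1)

lemma qproj_H: "(\<And>i. 1 \<le> i \<Longrightarrow> i < m \<Longrightarrow> U i \<in> H) \<Longrightarrow> qproj t U m \<in> H"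
  unfolding qproj_def by (intro H_sc qsum_H)

text \<open>
  The absorption property is only available modulo \<open>K\<close>, and only with \<open>S\<close> as the leftmost factor
  and for every \<open>W\<close> at once. This is why the letters of the coset sum are moved one by one into
  \<open>W\<close>.
\<close>
lemma qrow_slide_right:
  assumes "\<And>i. 1 \<le> i \<Longrightarrow> i \<le> m \<Longrightarrow> U i \<in> H" "W \<in> H"
    and "\<And>W i. W \<in> H \<Longrightarrow> 1 \<le> i \<Longrightarrow> i \<le> m \<Longrightarrow> S * W * U i \<approx> sc t (S * W)"
  shows "S * W * qrow t U m \<approx> sc (qnum t (Suc m)) (S * W)"
  using assms
proof (induction m arbitrary: W)
  case (Suc m)
  have "S * (W * U (Suc m)) * qrow t U m \<approx> sc (qnum t (Suc m)) (S * (W * U (Suc m)))"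
    using Suc.prems by (intro Suc.IH) (auto intro: H_mult)
  also have "\<dots> \<approx> sc (qnum t (Suc m)) (sc t (S * W))"
    using Suc.prems(3)[of W "Suc m"] Suc.prems(2) by (intro cong_sc) (simp add: mult.assoc)
  finally have "S * W + sc t (S * (W * U (Suc m)) * qrow t U m) \<approx>
      S * W + sc t (sc (qnum t (Suc m)) (sc t (S * W)))"
    by (intro cong_add cong_sc) auto
  moreover have "S * W + sc t (sc (qnum t (Suc m)) (sc t (S * W))) = sc (qnum t (Suc (Suc m))) (S * W)"
    by (subst qnum_Suc[of _ "Suc m"]) (simp add: sc_add_left mult_ac)
  ultimately show ?case by (simp add: distrib_left mult.assoc)
qed simp

lemma qsum_slide_right:
  assumes "\<And>i. 1 \<le> i \<Longrightarrow> i < m \<Longrightarrow> U i \<in> H" "W \<in> H"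
    and "\<And>W i. W \<in> H \<Longrightarrow> 1 \<le> i \<Longrightarrow> i < m \<Longrightarrow> S * W * U i \<approx> sc t (S * W)"
  shows "S * W * qsum t U m \<approx> sc (qnum_fact t m) (S * W)"
  using assms
proof (induction m)
  case (Suc m)
  have "S * (W * qsum t U m) * qrow t U m \<approx> sc (qnum t (Suc m)) (S * (W * qsum t U m))"
    using Suc.prems by (intro qrow_slide_right) (auto intro!: H_mult qsum_H)
  also have "\<dots> \<approx> sc (qnum t (Suc m)) (sc (qnum_fact t m) (S * W))"
    using Suc by (intro cong_sc) (simp add: mult.assoc)
  finally show ?case by (simp add: mult.assoc qnum_fact_Suc mult.commute)
qed simp

lemma qrow_slide_left:
  assumes "\<And>i. 1 \<le> i \<Longrightarrow> i \<le> m \<Longrightarrow> U i \<in> H" "W \<in> H"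
    and "\<And>W i. W \<in> H \<Longrightarrow> 1 \<le> i \<Longrightarrow> i \<le> m \<Longrightarrow> U i * W * A \<approx> sc t (W * A)"
  shows "qrow t U m * W * A \<approx> sc (qnum t (Suc m)) (W * A)"
  using assms
proof (induction m arbitrary: W)
  case (Suc m)
  have "U (Suc m) * (qrow t U m * W) * A \<approx> sc t ((qrow t U m * W) * A)"
    using Suc.prems by (intro Suc.prems(3)) (auto intro!: H_mult qrow_H)
  also have "\<dots> \<approx> sc t (sc (qnum t (Suc m)) (W * A))"
    using Suc by (intro cong_sc) auto
  finally have "W * A + sc t (U (Suc m) * (qrow t U m * W) * A) \<approx>
      W * A + sc t (sc t (sc (qnum t (Suc m)) (W * A)))"
    by (intro cong_add cong_sc) auto
  moreover have "W * A + sc t (sc t (sc (qnum t (Suc m)) (W * A))) = sc (qnum t (Suc (Suc m))) (W * A)"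
    by (subst qnum_Suc[of _ "Suc m"]) (simp add: sc_add_left mult_ac)
  ultimately show ?case by (simp add: distrib_right mult.assoc)
qed simp

lemma qsum_slide_left:
  assumes "\<And>i. 1 \<le> i \<Longrightarrow> i < m \<Longrightarrow> U i \<in> H" "W \<in> H"
    and "\<And>W i. W \<in> H \<Longrightarrow> 1 \<le> i \<Longrightarrow> i < m \<Longrightarrow> U i * W * A \<approx> sc t (W * A)"
  shows "qsum t U m * W * A \<approx> sc (qnum_fact t m) (W * A)"
  using assms
proof (induction m arbitrary: W)
  case (Suc m)
  have "qsum t U m * (qrow t U m * W) * A \<approx> sc (qnum_fact t m) ((qrow t U m * W) * A)"
    using Suc.prems by (intro Suc.IH) (auto intro!: H_mult qrow_H)
  also have "\<dots> \<approx> sc (qnum_fact t m) (sc (qnum t (Suc m)) (W * A))"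
    using Suc.prems by (intro cong_sc qrow_slide_left) auto
  finally show ?case by (simp add: mult.assoc qnum_fact_Suc)
qed simp

lemma q_nonzero: "q \<noteq> 0" using hecke.t_nonzero[OF hecke_q] .

lemma q_plus_inverse_nonzero: "q + inverse q \<noteq> 0"
proof -
  have "qnum q (Suc (Suc 0)) \<noteq> 0" using hecke.qnum_nonzero[OF hecke_q] by blast
  hence "1 + q * q \<noteq> 0" by (subst (asm) qnum_Suc) simp
  thus ?thesis using q_nonzero by (simp add: field_simps)
qed

text \<open>Generators of a set of consecutive strands, numbered in one of the two directions.\<close>
definition block :: "(nat \<Rightarrow> 'a) \<Rightarrow> nat \<Rightarrow> bool" where
  "block U m \<longleftrightarrow> (\<forall>i. 1 \<le> i \<and> i < m \<longrightarrow> (\<exists>j. 1 \<le> j \<and> j < k \<and> U i = T j)) \<and>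
     hecke sc q U m \<and> hecke sc (- inverse q) U m"

lemma block_H: "block U m \<Longrightarrow> 1 \<le> i \<Longrightarrow> i < m \<Longrightarrow> U i \<in> H"
  using H_T by (force simp: block_def)

text \<open>
  For a generator \<open>T\<close> of the block, \<open>(T + q\<^sup>-\<^sup>1) S = (q + q\<^sup>-\<^sup>1) S\<close>. The Manin relation applied to
  \<open>S W\<close> therefore says that \<open>S W (T - q)\<close> is in \<open>K\<close>, that is, modulo \<open>K\<close> every \<open>T\<close> on the far
  right can be replaced by \<open>q\<close>.
\<close>
lemma symmetrizer_slide:
  assumes "block U m" "W \<in> H" shows "qproj q U m * W * qproj q U m \<approx> qproj q U m * W"
proof -
  define S where "S = qproj q U m"
  have "S * W * U i \<approx> sc q (S * W)" if W: "W \<in> H" and i: "1 \<le> i" "i < m" for W i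
  proof -
    obtain j where j: "1 \<le> j" "j < k" "U i = T j" using assms(1) i by (auto simp: block_def)
    have H: "S * W \<in> H" unfolding S_def using block_H[OF assms(1)] W by (intro H_mult qproj_H)
    have "U i * S = sc q S" unfolding S_def
      using assms(1) i hecke.qproj_absorbs(2)[of sc q U m m i] by (simp add: block_def)
    hence "(U i + sc (inverse q) 1) * (S * W) * (U i - sc q 1) =
        sc (q + inverse q) (S * W * (U i - sc q 1))"
      by (simp add: distrib_right mult.assoc[symmetric] sc_add_left)
    hence "sc (q + inverse q) (S * W * (U i - sc q 1)) \<in> K"
      using trace[OF H j(1,2)] j(3) by simp
    from K_sc[OF this, of "inverse (q + inverse q)"] q_plus_inverse_nonzero
    show ?thesis by (simp add: cong_def right_diff_distrib)
  qed
  from qsum_slide_right[OF block_H[OF assms(1)] assms(2) this, of m]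
  have "S * W * qsum q U m \<approx> sc (qnum_fact q m) (S * W)" by simp
  from cong_sc[OF this, of "inverse (qnum_fact q m)"]
  moreover have "qnum_fact q m \<noteq> 0"
    using assms(1) hecke.qnum_fact_nonzero unfolding block_def by blast
  moreover have "S = sc (inverse (qnum_fact q m)) (qsum q U m)" by (simp add: S_def qproj_def)
  ultimately show ?thesis unfolding S_def[symmetric] by simp
qed

text \<open>
  Here \<open>A (T - q) = -(q + q\<^sup>-\<^sup>1) A\<close>, and the Manin relation applied to \<open>W A\<close> replaces every \<open>T\<close> on
  the far left by \<open>-q\<^sup>-\<^sup>1\<close>.
\<close>
lemma antisymmetrizer_slide:
  assumes "block U m" "W \<in> H"
  shows "qproj (- inverse q) U m * W * qproj (- inverse q) U m \<approx> W * qproj (- inverse q) U m"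
proof -
  define A where "A = qproj (- inverse q) U m"
  have "U i * W * A \<approx> sc (- inverse q) (W * A)" if W: "W \<in> H" and i: "1 \<le> i" "i < m" for W i
  proof -
    obtain j where j: "1 \<le> j" "j < k" "U i = T j" using assms(1) i by (auto simp: block_def)
    have H: "W * A \<in> H" unfolding A_def using block_H[OF assms(1)] W by (intro H_mult qproj_H)
    have "A * U i = sc (- inverse q) A" unfolding A_def
      using assms(1) i hecke.qproj_absorbs(1)[of sc "- inverse q" U m m i] by (simp add: block_def)
    hence "(U i + sc (inverse q) 1) * (W * A) * (U i - sc q 1) =
        sc (- (q + inverse q)) ((U i + sc (inverse q) 1) * W * A)"
      by (simp add: right_diff_distrib mult.assoc sc_diff_left sc_minus_left)
    hence "sc (- (q + inverse q)) ((U i + sc (inverse q) 1) * W * A) \<in> K"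
      using trace[OF H j(1,2)] j(3) by simp
    from K_sc[OF this, of "inverse (- (q + inverse q))"] q_plus_inverse_nonzero
    have "(U i + sc (inverse q) 1) * W * A \<in> K" by (metis left_inverse neg_equal_0_iff_equal sc_one sc_sc)
    thus ?thesis by (simp add: cong_def distrib_right sc_minus_left)
  qed
  from qsum_slide_left[OF block_H[OF assms(1)] assms(2) this, of m]
  have "qsum (- inverse q) U m * W * A \<approx> sc (qnum_fact (- inverse q) m) (W * A)" by simp
  from cong_sc[OF this, of "inverse (qnum_fact (- inverse q) m)"]
  moreover have "qnum_fact (- inverse q) m \<noteq> 0"
    using assms(1) hecke.qnum_fact_nonzero unfolding block_def by blast
  moreover have "A = sc (inverse (qnum_fact (- inverse q) m)) (qsum (- inverse q) U m)" by (simp add: A_def qproj_def)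
  ultimately show ?thesis unfolding A_def[symmetric] by simp
qed

text \<open>
  If \<open>X\<close> is the generator joining the strands of \<open>S\<close> to those of \<open>A\<close>, the left sides are
  multiples of the two products in which \<open>A\<close>, respectively \<open>S\<close>, is enlarged by one strand of the
  other. Sliding \<open>S\<close> in the first and \<open>A\<close> in the second brings their nontrivial terms \<open>S A X A\<close>
  and \<open>S X S A\<close> to the same form \<open>S A X A S\<close>.
\<close>
lemma overlap_cong:
  assumes "S * A = A * S" "S * S = S" "A * A = A" "S \<in> H" "A \<in> H" "X \<in> H"
    and S: "\<And>W. W \<in> H \<Longrightarrow> S * W * S \<approx> S * W" and A: "\<And>W. W \<in> H \<Longrightarrow> A * W * A \<approx> W * A"
  shows "S * (A * (1 + sc c X) * A) \<approx> S * A + sc c (S * A * X * A * S)"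
    and "(S * (1 + sc c X) * S) * A \<approx> S * A + sc c (S * A * X * A * S)"
proof -
  have "S * (A * X * A) * S \<approx> S * (A * X * A)" using assms by (intro S H_mult)
  note h = cong_sym[OF this]
  have "S * A + sc c (S * (A * X * A)) \<approx> S * A + sc c (S * (A * X * A) * S)"
    by (intro cong_add cong_sc cong_refl h)
  thus "S * (A * (1 + sc c X) * A) \<approx> S * A + sc c (S * A * X * A * S)"
    using assms(3) by (simp add: distrib_left distrib_right mult.assoc)
  have "A * (S * X * S) * A \<approx> (S * X * S) * A" using assms by (intro A H_mult)
  note h' = cong_sym[OF this]
  have "S * A + sc c (S * X * S * A) \<approx> S * A + sc c (A * (S * X * S) * A)"
    by (intro cong_add cong_sc cong_refl h')
  moreover have "A * (S * X * S) * A = S * A * X * A * S" using assms(1) by (metis mult.assoc)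
  ultimately show "(S * (1 + sc c X) * S) * A \<approx> S * A + sc c (S * A * X * A * S)"
    using assms(2) by (simp add: distrib_left distrib_right mult.assoc[symmetric])
qed

lemma block_first: "r \<le> k \<Longrightarrow> block T r"
  using hecke.hecke_restrict[OF hecke_q, of r] hecke.hecke_restrict[OF hecke_q', of r]
  unfolding block_def by force

lemma block_last: "r \<le> k \<Longrightarrow> block (\<lambda>i. T (k - i)) r"
  unfolding block_def
proof (intro conjI allI impI)
  fix i assume "r \<le> k" "1 \<le> i \<and> i < r"
  thus "\<exists>j. 1 \<le> j \<and> j < k \<and> T (k - i) = T j" by (intro exI[of _ "k - i"]) auto
next
  assume "r \<le> k"
  thus "hecke sc q (\<lambda>i. T (k - i)) r" "hecke sc (- inverse q) (\<lambda>i. T (k - i)) r"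
    using hecke.hecke_reverse[OF hecke_q] hecke.hecke_reverse[OF hecke_q'] hecke.hecke_restrict by blast+
qed

text \<open>
  The recursion \<open>qproj_step\<close> adds a strand at the end of the numbering. To enlarge the block
  \<open>r+1, \<dots>, k\<close> by the strand \<open>r\<close>, it has to be numbered from \<open>k\<close> downwards.
\<close>
lemma qproj_last:
  assumes "r \<le> k" "t = q \<or> t = - inverse q"
  shows "qproj t (\<lambda>i. T (r + i)) (k - r) = qproj t (\<lambda>i. T (k - i)) (k - r)"
proof -
  interpret hecke sc t "\<lambda>i. T (r + i)" "k - r"
    using assms hecke.hecke_shift[OF hecke_q, of r "k - r"] hecke.hecke_shift[OF hecke_q', of r "k - r"]
    by auto
  have "qproj t (\<lambda>i. T (r + i)) (k - r) = qproj t (\<lambda>i. T (r + (k - r - i))) (k - r)"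
    by (rule qproj_reverse)
  also have "\<dots> = qproj t (\<lambda>i. T (k - i)) (k - r)"
    unfolding qproj_def using assms(1) by (subst qsum_cong[where V = "\<lambda>i. T (k - i)"]) auto
  finally show ?thesis .
qed

lemma blocks_commute:
  assumes "r \<le> k"
  shows "qproj t T r * qproj t' (\<lambda>i. T (k - i)) (k - r) = qproj t' (\<lambda>i. T (k - i)) (k - r) * qproj t T r"
proof (rule qproj_commute)
  fix j assume j: "1 \<le> j" "j < k - r"
  have "T (k - j) * qproj t T r = qproj t T r * T (k - j)"
  proof (rule qproj_commute)
    fix i assume "1 \<le> i" "i < r"
    thus "T (k - j) * T i = T i * T (k - j)"
      using j hecke.far_comm[OF hecke_q, of i "k - j"] by simp
  qed
  thus "qproj t T r * T (k - j) = T (k - j) * qproj t T r" by simp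
qed

lemma sum_telescope:
  "(\<Sum>r\<le>n. (- 1) ^ r * (d r + d (Suc r))) = (d 0 + (- 1) ^ n * d (Suc n) :: 'a)"
  by (induction n) (simp_all add: algebra_simps)

text \<open>
  Modulo \<open>K\<close>, the product \<open>B\<^sub>r\<close> of the projection \<open>F\<^sub>r\<close> on the strands \<open>1, \<dots>, r\<close> and of \<open>G\<^sub>r\<close> on
  \<open>r+1, \<dots>, k\<close> satisfies \<open>z\<^sub>k B\<^sub>r = z\<^sub>r z\<^bsub>k-r+1\<^esub> a\<^sub>r + z\<^bsub>k-r\<^esub> z\<^sub>r\<^sub>+\<^sub>1 a\<^sub>r\<^sub>+\<^sub>1\<close>, where \<open>z\<^sub>n = qnum t n\<close> and \<open>a\<^sub>r\<close>
  is the product of \<open>F\<^sub>r\<close> and \<open>G\<^sub>r\<^sub>-\<^sub>1\<close>, which share the strand \<open>r\<close>. The two terms are \<open>d\<^sub>r\<close> and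
  \<open>d\<^sub>r\<^sub>+\<^sub>1\<close> for the same sequence \<open>d\<close>, and \<open>d\<^sub>0 = d\<^sub>k\<^sub>+\<^sub>1 = 0\<close> because \<open>z\<^sub>0 = 0\<close>.
\<close>
lemma macmahon:
  assumes t: "t = q \<or> t = - inverse q" and k: "k \<ge> 1"
  shows "(\<Sum>r\<le>k. (- 1) ^ r * (qproj t T r * qproj (- inverse t) (\<lambda>i. T (r + i)) (k - r))) \<in> K"
proof -
  define t' where "t' = - inverse t"
  have t': "t' = q \<or> t' = - inverse q" "t \<noteq> 0" using t q_nonzero by (auto simp: t'_def)
  have hk: "hecke sc t T k" "hecke sc t' (\<lambda>i. T (k - i)) k"
    using t t' hecke_q hecke_q' hecke.hecke_reverse by auto
  define F where "F r = qproj t T r" for r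
  define G where "G r = qproj t' (\<lambda>i. T (k - i)) (k - r)" for r
  \<comment> \<open>The slides fix the order of the factors: the symmetrizer stands on the left.\<close>
  define a where "a r = (if t = q then F r * G (r - 1) else G (r - 1) * F r)" for r
  define d where "d r = sc (qnum t r * qnum t (Suc k - r)) (a r)" for r
  have FH: "F r \<in> H" if "r \<le> k" for r
    unfolding F_def by (intro qproj_H block_H[OF block_first[OF that]])
  have GH: "G r \<in> H" if "r \<le> k" for r
    unfolding G_def by (intro qproj_H block_H[OF block_last]) auto
  have comm: "F r * G r = G r * F r" if "r \<le> k" for r
    unfolding F_def G_def by (rule blocks_commute[OF that])
  have key: "sc (qnum t k) (F r * G r) \<approx> d r + d (Suc r)" if r: "r \<le> k" for r
  proof -
    \<comment> \<open>At the ends one of the two overlapping projections is trivial and \<open>B\<^sub>r\<close> already is an \<open>a\<close>.\<close>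
    consider "r = 0" | "r = k" "r \<noteq> 0" | "1 \<le> r" "r < k" using r by linarith
    thus ?thesis
    proof cases
      case 1
      thus ?thesis by (simp add: d_def a_def F_def)
    next
      case 2
      hence "Suc k - r = Suc 0" "Suc k - Suc r = 0" "k - (r - 1) = Suc 0" by auto
      thus ?thesis using 2 by (simp add: d_def a_def G_def)
    next
      case 3
      define p where "p = k - r - 1"
      have p: "k - r = Suc p" "k - (r - 1) = Suc (Suc p)" "Suc k - r = Suc (Suc p)" "Suc k - Suc r = Suc p"
        "k = Suc p + r" using 3 by (auto simp: p_def)
      define C where "C = (if t = q then F r * G r * T r * G r * F r else G r * F r * T r * F r * G r)"
      define \<alpha> \<beta> where "\<alpha> = t * qnum t r" and "\<beta> = t' * qnum t' (Suc p)"
      have F1: "sc (qnum t (Suc r)) (F (Suc r)) = F r * (1 + sc \<alpha> (T r)) * F r"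
        unfolding F_def \<alpha>_def using hecke.qproj_step[OF hk(1), of r] 3 by simp
      have G1: "sc (qnum t' (Suc (Suc p))) (G (r - 1)) = G r * (1 + sc \<beta> (T r)) * G r"
      proof -
        have "k - Suc p = r" "Suc p < k" using p 3 by auto
        thus ?thesis unfolding G_def p(1-4) \<beta>_def using hecke.qproj_step[OF hk(2), of "Suc p"] by simp
      qed
      have FF: "F r * F r = F r" unfolding F_def using hecke.qproj_idem[OF hk(1) r] .
      have GG: "G r * G r = G r" unfolding G_def using hecke.qproj_idem[OF hk(2)] by simp
      have TH: "T r \<in> H" using 3 by (intro H_T)
      have 1: "sc (qnum t' (Suc (Suc p))) (a r) \<approx> F r * G r + sc \<beta> C \<and>
            sc (qnum t (Suc r)) (a (Suc r)) \<approx> F r * G r + sc \<alpha> C"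
      proof (cases "t = q")
        case True
        have sl: "F r * W * F r \<approx> F r * W" "G r * W * G r \<approx> W * G r" if "W \<in> H" for W
          unfolding F_def G_def t'_def True
          using symmetrizer_slide[OF block_first[OF r] that]
            antisymmetrizer_slide[OF block_last that, of "k - r"] by auto
        note o = overlap_cong[OF comm[OF r] FF GG FH[OF r] GH[OF r] TH sl]
        show ?thesis using o(1)[of \<beta>] o(2)[of \<alpha>] True
          by (simp add: a_def C_def F1[symmetric] G1[symmetric])
      next
        case False
        hence tt: "t = - inverse q" "t' = q" using t q_nonzero by (auto simp: t'_def)
        have sl: "F r * W * F r \<approx> W * F r" "G r * W * G r \<approx> G r * W" if "W \<in> H" for W
          unfolding F_def G_def tt
          using antisymmetrizer_slide[OF block_first[OF r] that]
            symmetrizer_slide[OF block_last that, of "k - r"] by auto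
        note o = overlap_cong[OF comm[OF r, symmetric] GG FF GH[OF r] FH[OF r] TH sl(2,1)]
        show ?thesis using o(2)[of \<beta>] o(1)[of \<alpha>] False
          by (simp add: a_def C_def F1[symmetric] G1[symmetric] comm[OF r])
      qed
      \<comment> \<open>Multiplying by \<open>u\<close> replaces the numbers formed with \<open>-t\<^sup>-\<^sup>1\<close> by those formed with \<open>t\<close>.\<close>
      define u where "u = t ^ (2 * p + 1)"
      have s1: "u * \<beta> = - qnum t (Suc p)"
        using qnum_inverse[OF t'(2), of p] t'(2) by (simp add: u_def \<beta>_def t'_def mult_ac)
      have s2: "u * \<alpha> * qnum t' (Suc (Suc p)) = qnum t r * qnum t (Suc (Suc p))"
        using qnum_inverse[OF t'(2), of "Suc p"] by (simp add: u_def \<alpha>_def t'_def mult_ac)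
      have s3: "u * \<alpha> - u * \<beta> = qnum t k"
        unfolding s1 p(5) qnum_add by (simp add: u_def \<alpha>_def mult_ac)
      \<comment> \<open>The combination that eliminates \<open>C\<close>.\<close>
      have "sc (u * \<alpha>) (sc (qnum t' (Suc (Suc p))) (a r)) - sc (u * \<beta>) (sc (qnum t (Suc r)) (a (Suc r))) \<approx>
         sc (u * \<alpha>) (F r * G r + sc \<beta> C) - sc (u * \<beta>) (F r * G r + sc \<alpha> C)"
        using 1 by (intro cong_diff cong_sc) auto
      also have "\<dots> = sc (u * \<alpha> - u * \<beta>) (F r * G r)"
        by (simp add: sc_add_right sc_diff_left mult_ac)
      also have "sc (u * \<alpha>) (sc (qnum t' (Suc (Suc p))) (a r)) - sc (u * \<beta>) (sc (qnum t (Suc r)) (a (Suc r))) =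
         d r + d (Suc r)"
        unfolding d_def p(1-4) s1 sc_sc s2 by (simp add: sc_minus_left mult.commute)
      finally show ?thesis unfolding s3 by (rule cong_sym)
    qed
  qed
  have sgn: "(- 1) ^ r * x = sc ((- 1) ^ r) x" for r x
    by (induction r) (simp_all add: sc_minus_left)
  have "(\<Sum>r\<le>k. (- 1) ^ r * (sc (qnum t k) (F r * G r) - (d r + d (Suc r)))) \<in> K"
    using key unfolding sgn cong_def by (intro K_sum K_sc) auto
  also have "(\<Sum>r\<le>k. (- 1) ^ r * (sc (qnum t k) (F r * G r) - (d r + d (Suc r)))) =
     (\<Sum>r\<le>k. (- 1) ^ r * sc (qnum t k) (F r * G r)) - (\<Sum>r\<le>k. (- 1) ^ r * (d r + d (Suc r)))"
    by (simp only: right_diff_distrib sum_subtractf)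
  also have "(\<Sum>r\<le>k. (- 1) ^ r * (d r + d (Suc r))) = 0"
    unfolding sum_telescope by (simp add: d_def)
  finally have "sc (qnum t k) (\<Sum>r\<le>k. (- 1) ^ r * (F r * G r)) \<in> K" by (simp add: sc_sum)
  from K_sc[OF this, of "inverse (qnum t k)"] have "(\<Sum>r\<le>k. (- 1) ^ r * (F r * G r)) \<in> K"
    using hecke.qnum_nonzero[OF hk(1), of k] k by simp
  also have "(\<Sum>r\<le>k. (- 1) ^ r * (F r * G r)) =
    (\<Sum>r\<le>k. (- 1) ^ r * (qproj t T r * qproj t' (\<lambda>i. T (r + i)) (k - r)))"
    unfolding F_def G_def using qproj_last t' by simp
  finally show ?thesis unfolding t'_def .
qed

end

section \<open>Operators attached to graded tensors\<close>

text \<open>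
  Operators on functions \<open>'i \<Rightarrow> 'a\<close> that are linear for the right multiplication by
  \<open>'a\<close>. Matrices over a noncommutative ring act on columns in this way. The index type is not
  restricted to the multi-indices of one length, so that a single ring contains the operators
  for all \<open>k\<close>.
\<close>
typedef (overloaded) ('i, 'a::ring_1) linop = "{f :: ('i \<Rightarrow> 'a) \<Rightarrow> 'i \<Rightarrow> 'a.
    (\<forall>u v. f (\<lambda>i. u i + v i) = (\<lambda>i. f u i + f v i)) \<and>
    (\<forall>v a. f (\<lambda>i. v i * a) = (\<lambda>i. f v i * a))}"
  morphisms app Linop
  by (rule exI[of _ "\<lambda>_ _. 0"]) simp

setup_lifting type_definition_linop

instantiation linop :: (type, ring_1) ring_1
begin

lift_definition zero_linop :: "('a, 'b) linop" is "\<lambda>_ _. 0" by simp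
lift_definition one_linop :: "('a, 'b) linop" is "\<lambda>v. v" by simp
lift_definition plus_linop :: "('a, 'b) linop \<Rightarrow> ('a, 'b) linop \<Rightarrow> ('a, 'b) linop" is "\<lambda>f g v i. f v i + g v i"
  by (simp add: fun_eq_iff algebra_simps)
lift_definition minus_linop :: "('a, 'b) linop \<Rightarrow> ('a, 'b) linop \<Rightarrow> ('a, 'b) linop" is "\<lambda>f g v i. f v i - g v i"
  by (simp add: fun_eq_iff algebra_simps)
lift_definition uminus_linop :: "('a, 'b) linop \<Rightarrow> ('a, 'b) linop" is "\<lambda>f v i. - f v i"
  by (simp add: fun_eq_iff)
lift_definition times_linop :: "('a, 'b) linop \<Rightarrow> ('a, 'b) linop \<Rightarrow> ('a, 'b) linop" is "\<lambda>f g v. f (g v)"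
  by simp

instance
proof
  show "(0 :: ('a, 'b) linop) \<noteq> 1"
    by transfer (metis zero_neq_one)
qed (transfer; simp add: fun_eq_iff algebra_simps; fail)+

end

lemma linop_eqI: "(\<And>v i. app F v i = app G v i) \<Longrightarrow> F = G"
  by transfer (simp add: fun_eq_iff)

lemma app_zero [simp]: "app 0 v i = 0"
  and app_one [simp]: "app 1 v = v"
  and app_plus [simp]: "app (F + G) v i = app F v i + app G v i"
  and app_minus [simp]: "app (F - G) v i = app F v i - app G v i"
  and app_uminus [simp]: "app (- F) v i = - app F v i"
  and app_times [simp]: "app (F * G) v = app F (app G v)"
  by (transfer; simp)+

lemma app_add: "app F (\<lambda>i. u i + v i) i = app F u i + app F v i"
  by transfer (simp add: fun_eq_iff)

lemma app_mult_right: "app F (\<lambda>i. v i * a) i = app F v i * a"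
  by transfer (simp add: fun_eq_iff)

lemma app_0 [simp]: "app F (\<lambda>i. 0) i = 0"
  using app_mult_right[of F "\<lambda>_. 0" 0 i] by simp

lemma app_sum: "app F (\<lambda>i. \<Sum>x\<in>A. g x i) i = (\<Sum>x\<in>A. app F (g x) i)"
  by (induction A rule: infinite_finite_induct) (simp_all add: app_add)

definition unitvec :: "'i \<Rightarrow> 'i \<Rightarrow> 'a::ring_1" where
  "unitvec j i = (if i = j then 1 else 0)"

definition entry :: "('i, 'a::ring_1) linop \<Rightarrow> 'i \<Rightarrow> 'i \<Rightarrow> 'a" where
  "entry F i j = app F (unitvec j) i"

lemma app_expand:
  assumes "finite B" "\<And>i. i \<notin> B \<Longrightarrow> v i = 0"
  shows "app F v i = (\<Sum>j\<in>B. entry F i j * v j)"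
proof -
  have "v = (\<lambda>i. \<Sum>j\<in>B. unitvec j i * v j)"
  proof
    fix i
    have "(\<Sum>j\<in>B. unitvec j i * v j) = (\<Sum>j\<in>B. if i = j then v j else 0)"
      by (rule sum.cong) (auto simp: unitvec_def)
    also have "\<dots> = v i" using assms by (simp add: sum.delta')
    finally show "v i = (\<Sum>j\<in>B. unitvec j i * v j)" by simp
  qed
  hence "app F v i = app F (\<lambda>i. \<Sum>j\<in>B. unitvec j i * v j) i" by simp
  thus ?thesis by (simp add: app_sum app_mult_right entry_def)
qed

lemma minus_one_power_cong: "even (m + n) \<Longrightarrow> (- 1) ^ m = ((- 1) ^ n :: 'a::ring_1)"
  by (simp add: minus_one_power_iff)

text \<open>
  A name for the multiplication by a sign, so that rewriting can collect all signs in front of a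
  product and leave them there.
\<close>
definition sgn_mult :: "nat \<Rightarrow> 'a::ring_1 \<Rightarrow> 'a" where
  "sgn_mult n x = (- 1) ^ n * x"

lemma sgn_mult_cong: "even (m + n) \<Longrightarrow> sgn_mult m x = sgn_mult n x"
  by (simp add: sgn_mult_def minus_one_power_iff)

lemma sgn_mult_simps:
  fixes x y :: "'a::ring_1"
  shows "(- 1) ^ n * x = sgn_mult n x"
    "sgn_mult m (sgn_mult n x) = sgn_mult (m + n) x"
    "sgn_mult n x * y = sgn_mult n (x * y)"
    "x * sgn_mult n y = sgn_mult n (x * y)"
  by (simp_all add: sgn_mult_def minus_one_power_iff)

lemma sgn_mult_sum: "sgn_mult n (sum f A) = (\<Sum>i\<in>A. sgn_mult n (f i))"
  by (simp add: sgn_mult_def sum_distrib_left)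

lemmas sign_simps = mult.assoc sgn_mult_simps

text \<open>
  The sign by which \<open>E\<^bsub>I\<^sub>1J\<^sub>1\<^esub> \<otimes> \<dots> \<otimes> E\<^bsub>I\<^sub>kJ\<^sub>k\<^esub>\<close> has to be multiplied for graded products of even tensors
  to become products of matrices.
\<close>
definition twist :: "nat \<Rightarrow> nat \<Rightarrow> nat list \<Rightarrow> nat list \<Rightarrow> nat" where
  "twist M k I J = (\<Sum>b<k. \<Sum>a<Suc b. (par M (I ! a) + par M (J ! a)) * par M (J ! b))"

definition tparity :: "nat \<Rightarrow> nat \<Rightarrow> nat list \<Rightarrow> nat list \<Rightarrow> nat" where
  "tparity M k I J = (\<Sum>a<k. par M (I ! a) + par M (J ! a))"

lemma twist_swap: "twist M k I J = (\<Sum>a<k. (par M (I ! a) + par M (J ! a)) * (\<Sum>b\<in>{a..<k}. par M (J ! b)))"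
proof (induction k)
  case (Suc k)
  have "(\<Sum>a<k. (par M (I ! a) + par M (J ! a)) * (\<Sum>b\<in>{a..<Suc k}. par M (J ! b))) =
    (\<Sum>a<k. (par M (I ! a) + par M (J ! a)) * (\<Sum>b\<in>{a..<k}. par M (J ! b)) +
      (par M (I ! a) + par M (J ! a)) * par M (J ! k))"
    by (rule sum.cong) (auto simp: distrib_left)
  thus ?case using Suc by (simp add: twist_def sum.distrib)
qed (simp add: twist_def)

text \<open>
  The second summand is the sign in the graded product of matrix units, the third one is the
  sign that arises when the second coefficient passes the first units, and the remaining terms
  are the coboundary of \<open>twist\<close>. The proof compares the contributions of the last tensor factor.
\<close>
lemma twist_cocycle:
  "even (twist M k I K + (\<Sum>a<k. \<Sum>b<a. (par M (I ! a) + par M (J ! a)) * (par M (J ! b) + par M (K ! b)))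
    + tparity M k I J * tparity M k J K + (twist M k I J + twist M k J K))"
proof (induction k)
  case (Suc k)
  define i j l where "i = par M (I ! k)" and "j = par M (J ! k)" and "l = par M (K ! k)"
  define Si Sj Sl where "Si = (\<Sum>a<k. par M (I ! a))" and "Sj = (\<Sum>a<k. par M (J ! a))"
    and "Sl = (\<Sum>a<k. par M (K ! a))"
  have t: "twist M (Suc k) I K = twist M k I K + (Si + Sl + i + l) * l"
    "twist M (Suc k) I J = twist M k I J + (Si + Sj + i + j) * j"
    "twist M (Suc k) J K = twist M k J K + (Sj + Sl + j + l) * l"
    by (simp_all add: twist_def Si_def Sj_def Sl_def i_def j_def l_def sum.distrib sum_distrib_right[symmetric]
        algebra_simps)
  have p: "tparity M k I J = Si + Sj" "tparity M k J K = Sj + Sl"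
    "tparity M (Suc k) I J = Si + Sj + (i + j)" "tparity M (Suc k) J K = Sj + Sl + (j + l)"
    by (simp_all add: tparity_def Si_def Sj_def Sl_def i_def j_def l_def sum.distrib)
  have e: "(\<Sum>a<Suc k. \<Sum>b<a. (par M (I ! a) + par M (J ! a)) * (par M (J ! b) + par M (K ! b))) =
    (\<Sum>a<k. \<Sum>b<a. (par M (I ! a) + par M (J ! a)) * (par M (J ! b) + par M (K ! b))) + (i + j) * (Sj + Sl)"
    by (simp add: i_def j_def Sj_def Sl_def sum_distrib_left[symmetric] sum.distrib)
  show ?case using Suc unfolding t p e even_add even_mult_iff by blast
qed (simp add: twist_def tparity_def)

lemma tparity_add: "even (tparity M k I J + tparity M k J K + tparity M k I K)"
  by (induction k) (auto simp: tparity_def)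

lemma tparity_same: "even (tparity M k I I)"
  by (simp add: tparity_def sum.distrib)

lemma twist_same: "even (twist M k I I)"
  unfolding twist_swap by (intro dvd_sum) simp

lemma finite_idx [simp]: "finite (idx M N k)"
proof -
  have "idx M N k = {I. set I \<subseteq> {1..M+N} \<and> length I = k}" by (auto simp: idx_def)
  thus ?thesis using finite_lists_length_eq[of "{1..M+N}" k] by simp
qed

lift_definition tens_op :: "nat \<Rightarrow> nat \<Rightarrow> nat \<Rightarrow> 'a::ring_1 tens \<Rightarrow> (nat list, 'a) linop" is
  "\<lambda>M N k X v I. if I \<in> idx M N k then \<Sum>J\<in>idx M N k. (- 1) ^ twist M k I J * X I J * v J else 0"
  by (auto simp: fun_eq_iff distrib_left sum.distrib sum_distrib_right mult.assoc)

lemma app_tens_op: "app (tens_op M N k X) v I =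
   (if I \<in> idx M N k then \<Sum>J\<in>idx M N k. (- 1) ^ twist M k I J * X I J * v J else 0)"
  by transfer simp

text \<open>
  The coefficient at \<open>I, J\<close> is homogeneous of the parity of its matrix unit, so that the tensor
  is an even element. For \<open>s = id\<close> in characteristic zero this says that the coefficients of odd
  units vanish.
\<close>
definition even_tens :: "nat \<Rightarrow> nat \<Rightarrow> nat \<Rightarrow> ('a \<Rightarrow> 'a) \<Rightarrow> 'a::ring_1 tens \<Rightarrow> bool" where
  "even_tens M N k s X \<longleftrightarrow>
     (\<forall>I\<in>idx M N k. \<forall>J\<in>idx M N k. s (X I J) = (- 1) ^ tparity M k I J * X I J)"

lemma even_tens_funpow:
  assumes "even_tens M N k s X" "\<And>x. s (- x) = - s x" "I \<in> idx M N k" "J \<in> idx M N k"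
  shows "(s ^^ n) (X I J) = (- 1) ^ (n * tparity M k I J) * X I J"
proof -
  have s: "s ((- 1) ^ m * x) = (- 1) ^ m * s x" for m x
    by (induction m) (simp_all add: assms(2))
  show ?thesis
    using assms(1,3,4) by (induction n) (simp_all add: s even_tens_def power_add mult.assoc minus_one_power_iff assms(2))
qed

lemma tmul_even:
  assumes "even_tens M N k s Y" "\<And>x. s (- x) = - s x" "I \<in> idx M N k" "K \<in> idx M N k"
  shows "tmul M N k s X Y I K =
    (\<Sum>J\<in>idx M N k. (- 1) ^ (twist M k I K + twist M k I J + twist M k J K) * (X I J * Y J K))"
  unfolding tmul_def
proof (rule sum.cong[OF refl])
  fix J assume J: "J \<in> idx M N k"
  let ?e = "\<Sum>a<k. \<Sum>b<a. (par M (I ! a) + par M (J ! a)) * (par M (J ! b) + par M (K ! b))"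
  have p: "(\<Sum>a<k. par M (I ! a) + par M (J ! a)) = tparity M k I J" by (simp add: tparity_def)
  have "(- 1) ^ ?e * X I J * (s ^^ (\<Sum>a<k. par M (I ! a) + par M (J ! a))) (Y J K) =
      (- 1) ^ (?e + tparity M k I J * tparity M k J K) * (X I J * Y J K)"
    unfolding p using even_tens_funpow[OF assms(1,2) J assms(4)] by (simp add: sign_simps add.commute)
  also have "(- 1 :: 'a) ^ (?e + tparity M k I J * tparity M k J K) = (- 1) ^ (twist M k I K + twist M k I J + twist M k J K)"
    using twist_cocycle[of M k I K J] by (intro minus_one_power_cong) (simp add: add_ac)
  finally show "(- 1) ^ ?e * X I J * (s ^^ (\<Sum>a<k. par M (I ! a) + par M (J ! a))) (Y J K) =
      (- 1) ^ (twist M k I K + twist M k I J + twist M k J K) * (X I J * Y J K)" .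
qed

text \<open>
  Only the second factor has to be even: the grading involution is applied to its coefficients
  alone.
\<close>
lemma tens_op_tmul:
  assumes "even_tens M N k s Y" "\<And>x. s (- x) = - s x"
  shows "tens_op M N k (tmul M N k s X Y) = tens_op M N k X * tens_op M N k Y"
proof (rule linop_eqI)
  fix v I
  let ?B = "idx M N k"
  show "app (tens_op M N k (tmul M N k s X Y)) v I = app (tens_op M N k X * tens_op M N k Y) v I"
  proof (cases "I \<in> ?B")
    case I: True
    have "app (tens_op M N k (tmul M N k s X Y)) v I =
      (\<Sum>K\<in>?B. (- 1) ^ twist M k I K *
         (\<Sum>J\<in>?B. (- 1) ^ (twist M k I K + twist M k I J + twist M k J K) * (X I J * Y J K)) * v K)"
      using I assms by (simp add: app_tens_op tmul_even)
    also have "\<dots> = (\<Sum>K\<in>?B. \<Sum>J\<in>?B. (- 1) ^ (twist M k I J + twist M k J K) * (X I J * (Y J K * v K)))"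
      by (intro sum.cong refl) (auto simp: sum_distrib_left sum_distrib_right sgn_mult_sum sign_simps
          intro!: sum.cong sgn_mult_cong)
    also have "\<dots> = (\<Sum>J\<in>?B. \<Sum>K\<in>?B. (- 1) ^ (twist M k I J + twist M k J K) * (X I J * (Y J K * v K)))"
      by (rule sum.swap)
    also have "\<dots> = (\<Sum>J\<in>?B. (- 1) ^ twist M k I J * X I J * (\<Sum>K\<in>?B. (- 1) ^ twist M k J K * Y J K * v K))"
      by (intro sum.cong refl) (simp add: sum_distrib_left sgn_mult_sum sign_simps add.commute)
    finally show ?thesis using I by (simp add: app_tens_op)
  qed (simp add: app_tens_op)
qed

lemma even_tens_tmul:
  assumes "even_tens M N k s X" "even_tens M N k s Y"
    and s: "\<And>x. s (- x) = - s x" "\<And>x y. s (x + y) = s x + s y" "\<And>x y. s (x * y) = s x * s y"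
  shows "even_tens M N k s (tmul M N k s X Y)"
  unfolding even_tens_def
proof safe
  fix I K assume IK: "I \<in> idx M N k" "K \<in> idx M N k"
  have s0: "s 0 = 0" using s(2)[of 0 0] by simp
  have ssum: "s (sum f A) = (\<Sum>x\<in>A. s (f x))" for f :: "nat list \<Rightarrow> 'a" and A
    by (induction A rule: infinite_finite_induct) (simp_all add: s s0)
  have sneg: "s ((- 1) ^ m * x) = (- 1) ^ m * s x" for m x
    by (induction m) (simp_all add: s)
  have "s (tmul M N k s X Y I K) =
    (\<Sum>J\<in>idx M N k. (- 1) ^ (twist M k I K + twist M k I J + twist M k J K) * (s (X I J) * s (Y J K)))"
    by (simp only: tmul_even[OF assms(2) s(1) IK] ssum sneg) (simp only: s(3))
  also have "\<dots> = (\<Sum>J\<in>idx M N k. (- 1) ^ tparity M k I K *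
      ((- 1) ^ (twist M k I K + twist M k I J + twist M k J K) * (X I J * Y J K)))"
  proof (rule sum.cong[OF refl])
    fix J assume "J \<in> idx M N k"
    hence "s (X I J) = (- 1) ^ tparity M k I J * X I J" "s (Y J K) = (- 1) ^ tparity M k J K * Y J K"
      using assms(1,2) IK by (auto simp: even_tens_def)
    moreover have "sgn_mult (twist M k I K + twist M k I J + twist M k J K + (tparity M k I J + tparity M k J K)) (X I J * Y J K) =
      sgn_mult (tparity M k I K + (twist M k I K + twist M k I J + twist M k J K)) (X I J * Y J K)"
      using tparity_add[of M k I J K] by (intro sgn_mult_cong) auto
    ultimately show "(- 1) ^ (twist M k I K + twist M k I J + twist M k J K) * (s (X I J) * s (Y J K)) =
      (- 1) ^ tparity M k I K * ((- 1) ^ (twist M k I K + twist M k I J + twist M k J K) * (X I J * Y J K))"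
      by (simp add: sign_simps add_ac)
  qed
  finally show "s (tmul M N k s X Y I K) = (- 1) ^ tparity M k I K * tmul M N k s X Y I K"
    by (simp add: tmul_even[OF assms(2) s(1) IK] sum_distrib_left)
qed

lemma even_tens_tone: "s 0 = 0 \<Longrightarrow> s 1 = 1 \<Longrightarrow> even_tens M N k s tone"
  unfolding even_tens_def tone_def using tparity_same by (auto simp: minus_one_power_iff)

lemma app_tens_op_tone: "app (tens_op M N k tone) v I = (if I \<in> idx M N k then v I else 0)"
proof (cases "I \<in> idx M N k")
  case True
  have "app (tens_op M N k tone) v I = (\<Sum>J\<in>idx M N k. if I = J then v J else 0)"
    unfolding app_tens_op tone_def if_P[OF True]
    by (intro sum.cong refl) (use twist_same[of M k] in \<open>auto simp: minus_one_power_iff\<close>)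
  thus ?thesis using True by (simp add: sum.delta')
qed (simp add: app_tens_op)

lemma entry_tens_op:
  assumes "I \<in> idx M N k" "J \<in> idx M N k"
  shows "entry (tens_op M N k X) I J = (- 1) ^ twist M k I J * X I J"
proof -
  have "entry (tens_op M N k X) I J = (\<Sum>K\<in>idx M N k. if J = K then (- 1) ^ twist M k I K * X I K else 0)"
    unfolding entry_def app_tens_op unitvec_def if_P[OF assms(1)] by (intro sum.cong refl) auto
  thus ?thesis using assms by (simp add: sum.delta')
qed

lemma str_eq: "str M N k X =
  (\<Sum>I\<in>idx M N k. (- 1) ^ (\<Sum>a<k. par M (I ! a)) * entry (tens_op M N k X) I I)"
  unfolding str_def by (intro sum.cong refl) (use twist_same in \<open>auto simp: entry_tens_op minus_one_power_iff\<close>)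

definition tail_parity :: "nat \<Rightarrow> nat \<Rightarrow> nat \<Rightarrow> nat list \<Rightarrow> nat" where
  "tail_parity M k p I = (\<Sum>c\<in>{Suc p..<k}. par M (I ! c))"

text \<open>
  The operators of tensors concentrated in the copy \<open>p+1\<close>, or in the copies \<open>p+1\<close> and \<open>p+2\<close>;
  positions in a multi-index are counted from \<open>0\<close>. An odd entry in one copy picks up the parity
  of all later indices, which is the price for turning graded products into compositions.
\<close>
lift_definition one_site :: "nat \<Rightarrow> nat \<Rightarrow> nat \<Rightarrow> nat \<Rightarrow> (nat \<Rightarrow> nat \<Rightarrow> 'a::ring_1) \<Rightarrow> (nat list, 'a) linop" is
  "\<lambda>M N k p l v I. if I \<in> idx M N k
     then \<Sum>x\<in>{1..M+N}. (- 1) ^ ((par M (I ! p) + par M x) * (par M x + tail_parity M k p I)) * l (I ! p) x * v (I[p := x])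
     else 0"
  by (auto simp: fun_eq_iff distrib_left sum.distrib sum_distrib_right mult.assoc)

lift_definition two_site :: "nat \<Rightarrow> nat \<Rightarrow> nat \<Rightarrow> nat \<Rightarrow> (nat \<Rightarrow> nat \<Rightarrow> nat \<Rightarrow> nat \<Rightarrow> 'a::ring_1) \<Rightarrow> (nat list, 'a) linop" is
  "\<lambda>M N k p r v I. if I \<in> idx M N k
     then \<Sum>x\<in>{1..M+N}. \<Sum>y\<in>{1..M+N}. r (I ! p) (I ! Suc p) x y * v (I[p := x, Suc p := y])
     else 0"
  by (auto simp: fun_eq_iff distrib_left sum.distrib sum_distrib_right mult.assoc)

lemma app_one_site: "app (one_site M N k p l) v I = (if I \<in> idx M N k
     then \<Sum>x\<in>{1..M+N}. (- 1) ^ ((par M (I ! p) + par M x) * (par M x + tail_parity M k p I)) * l (I ! p) x * v (I[p := x])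
     else 0)"
  by transfer simp

lemma app_two_site: "app (two_site M N k p r) v I = (if I \<in> idx M N k
     then \<Sum>x\<in>{1..M+N}. \<Sum>y\<in>{1..M+N}. r (I ! p) (I ! Suc p) x y * v (I[p := x, Suc p := y])
     else 0)"
  by transfer simp

lemma idx_update: "I \<in> idx M N k \<Longrightarrow> x \<in> {1..M+N} \<Longrightarrow> I[p := x] \<in> idx M N k"
  using set_update_subset_insert[of I p x] by (auto simp: idx_def)

lemma idx_length: "I \<in> idx M N k \<Longrightarrow> length I = k"
  by (simp add: idx_def)

lemma idx_nth: "I \<in> idx M N k \<Longrightarrow> p < k \<Longrightarrow> I ! p \<in> {1..M+N}"
  by (metis (mono_tags, lifting) idx_def mem_Collect_eq nth_mem subsetD)

text \<open>
  Only multi-indices that differ from \<open>I\<close> at most at \<open>p\<close> contribute, and in \<open>twist\<close> only the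
  terms with \<open>a = p\<close> can be odd.
\<close>
lemma tens_op_place1:
  assumes p: "p < k"
  shows "tens_op M N k (place k [Suc p] X) = one_site M N k p (\<lambda>i j. X [i] [j])"
proof (rule linop_eqI)
  fix v I
  let ?B = "idx M N k"
  show "app (tens_op M N k (place k [Suc p] X)) v I = app (one_site M N k p (\<lambda>i j. X [i] [j])) v I"
  proof (cases "I \<in> ?B")
    case I: True
    note len = idx_length[OF I]
    let ?f = "\<lambda>J. (- 1) ^ twist M k I J * place k [Suc p] X I J * v J"
    let ?A = "(\<lambda>x. I[p := x]) ` {1..M+N}"
    have inj: "inj_on (\<lambda>x. I[p := x]) {1..M+N}"
      using p len by (auto simp: inj_on_def dest: arg_cong[where f = "\<lambda>J. J ! p"])
    have "?f J = 0" if J: "J \<in> ?B - ?A" for J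
    proof -
      have lJ: "length J = k" using J idx_length by blast
      have "\<not> (\<forall>b\<in>{1..k} - set [Suc p]. I ! (b - 1) = J ! (b - 1))"
      proof
        assume a: "\<forall>b\<in>{1..k} - set [Suc p]. I ! (b - 1) = J ! (b - 1)"
        have "J = I[p := J ! p]"
        proof (rule nth_equalityI)
          show "length J = length (I[p := J ! p])" using lJ len by simp
          fix i assume "i < length J"
          thus "J ! i = I[p := J ! p] ! i" using a[rule_format, of "Suc i"] lJ len p
            by (cases "i = p") auto
        qed
        moreover have "J ! p \<in> {1..M+N}" using J p idx_nth by blast
        ultimately show False using J by blast
      qed
      thus ?thesis by (auto simp: place_def)
    qed
    hence "(\<Sum>J\<in>?B. ?f J) = (\<Sum>J\<in>?A. ?f J)"
      using I idx_update by (intro sum.mono_neutral_right) auto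
    also have "\<dots> = (\<Sum>x\<in>{1..M+N}. ?f (I[p := x]))" by (rule sum.reindex[OF inj, unfolded comp_def])
    also have "\<dots> = (\<Sum>x\<in>{1..M+N}. (- 1) ^ ((par M (I ! p) + par M x) * (par M x + tail_parity M k p I)) * X [I ! p] [x] * v (I[p := x]))"
    proof (intro sum.cong refl arg_cong2[where f = "(*)"])
      fix x assume "x \<in> {1..M+N}"
      let ?J = "I[p := x]"
      let ?g = "\<lambda>a. (par M (I ! a) + par M (?J ! a)) * (\<Sum>b\<in>{a..<k}. par M (?J ! b))"
      have "even (\<Sum>a\<in>{..<k} - {p}. ?g a)"
        by (intro dvd_sum) (auto simp: nth_list_update)
      moreover have "twist M k I ?J = ?g p + (\<Sum>a\<in>{..<k} - {p}. ?g a)"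
        unfolding twist_swap using p by (subst sum.remove[of _ p]) auto
      moreover have "?g p = (par M (I ! p) + par M x) * (par M x + tail_parity M k p I)"
      proof -
        have "{p..<k} = insert p {Suc p..<k}" using p by auto
        thus ?thesis using p len by (simp add: tail_parity_def)
      qed
      ultimately show "(- 1 :: 'a) ^ twist M k I ?J = (- 1) ^ ((par M (I ! p) + par M x) * (par M x + tail_parity M k p I))"
        by (intro minus_one_power_cong) auto
      show "place k [Suc p] X I ?J = X [I ! p] [x]" using p len by (auto simp: place_def nth_list_update)
    qed
    finally show ?thesis using I by (simp add: app_tens_op app_one_site)
  qed (simp add: app_tens_op app_one_site)
qed

text \<open>
  As for one copy; the parities of the later indices cancel because the total parity of the two
  matrix units is even.
\<close>
lemma tens_op_place2:
  assumes p: "Suc p < k"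
    and X: "\<And>i j x y. odd (par M i + par M x + par M j + par M y) \<Longrightarrow> X [i, j] [x, y] = 0"
  shows "tens_op M N k (place k [Suc p, Suc (Suc p)] X) = two_site M N k p (\<lambda>i j x y.
    (- 1) ^ ((par M i + par M x) * (par M x + par M y) + (par M j + par M y) * par M y) * X [i, j] [x, y])"
proof (rule linop_eqI)
  fix v I
  let ?B = "idx M N k"
  let ?r = "\<lambda>i j x y. (- 1) ^ ((par M i + par M x) * (par M x + par M y) + (par M j + par M y) * par M y) * X [i, j] [x, y]"
  show "app (tens_op M N k (place k [Suc p, Suc (Suc p)] X)) v I = app (two_site M N k p ?r) v I"
  proof (cases "I \<in> ?B")
    case I: True
    note len = idx_length[OF I]
    let ?f = "\<lambda>J. (- 1) ^ twist M k I J * place k [Suc p, Suc (Suc p)] X I J * v J"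
    let ?u = "\<lambda>(x, y). I[p := x, Suc p := y]"
    let ?A = "?u ` ({1..M+N} \<times> {1..M+N})"
    have inj: "inj_on ?u ({1..M+N} \<times> {1..M+N})"
    proof (rule inj_onI, clarify)
      fix x y x' y' assume "I[p := x, Suc p := y] = I[p := x', Suc p := y']"
      from arg_cong[OF this, of "\<lambda>J. J ! p"] arg_cong[OF this, of "\<lambda>J. J ! Suc p"]
      show "x = x' \<and> y = y'" using p len by simp
    qed
    have "?f J = 0" if J: "J \<in> ?B - ?A" for J
    proof -
      have lJ: "length J = k" using J idx_length by blast
      have "\<not> (\<forall>b\<in>{1..k} - set [Suc p, Suc (Suc p)]. I ! (b - 1) = J ! (b - 1))"
      proof
        assume a: "\<forall>b\<in>{1..k} - set [Suc p, Suc (Suc p)]. I ! (b - 1) = J ! (b - 1)"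
        have "J = ?u (J ! p, J ! Suc p)"
        proof (rule nth_equalityI)
          show "length J = length (?u (J ! p, J ! Suc p))" using lJ len by simp
          fix i assume "i < length J"
          thus "J ! i = ?u (J ! p, J ! Suc p) ! i" using a[rule_format, of "Suc i"] lJ len p
            by (cases "i = p"; cases "i = Suc p") auto
        qed
        moreover have "J ! p \<in> {1..M+N}" "J ! Suc p \<in> {1..M+N}" using J p idx_nth by (auto simp del: atLeastAtMost_iff)
        ultimately show False using J by blast
      qed
      thus ?thesis by (auto simp: place_def)
    qed
    hence "(\<Sum>J\<in>?B. ?f J) = (\<Sum>J\<in>?A. ?f J)"
      using I idx_update by (intro sum.mono_neutral_right) auto
    also have "\<dots> = (\<Sum>z\<in>{1..M+N} \<times> {1..M+N}. ?f (?u z))"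
      by (rule sum.reindex[OF inj, unfolded comp_def])
    also have "\<dots> = (\<Sum>(x, y)\<in>{1..M+N} \<times> {1..M+N}. ?f (I[p := x, Suc p := y]))"
      by (simp only: case_prod_unfold)
    also have "\<dots> = (\<Sum>(x, y)\<in>{1..M+N} \<times> {1..M+N}. ?r (I ! p) (I ! Suc p) x y * v (I[p := x, Suc p := y]))"
    proof (intro sum.cong refl, clarify)
      fix x y assume "x \<in> {1..M+N}" "y \<in> {1..M+N}"
      let ?J = "I[p := x, Suc p := y]"
      have pl: "place k [Suc p, Suc (Suc p)] X I ?J = X [I ! p, I ! Suc p] [x, y]"
        using p len by (auto simp: place_def nth_list_update)
      show "?f ?J = ?r (I ! p) (I ! Suc p) x y * v ?J"
      proof (cases "odd (par M (I ! p) + par M x + par M (I ! Suc p) + par M y)")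
        case True thus ?thesis unfolding pl by (simp add: X)
      next
        case False
        let ?g = "\<lambda>a. (par M (I ! a) + par M (?J ! a)) * (\<Sum>b\<in>{a..<k}. par M (?J ! b))"
        have e: "even (\<Sum>a\<in>{..<k} - {p} - {Suc p}. ?g a)"
          by (intro dvd_sum) (auto simp: nth_list_update)
        have s: "twist M k I ?J = ?g p + (?g (Suc p) + (\<Sum>a\<in>{..<k} - {p} - {Suc p}. ?g a))"
          unfolding twist_swap using p by (subst sum.remove[of _ p], simp_all) (subst sum.remove[of _ "Suc p"], simp_all)
        have "{p..<k} = insert p (insert (Suc p) {Suc (Suc p)..<k})"
          "{Suc p..<k} = insert (Suc p) {Suc (Suc p)..<k}" using p by auto
        hence g: "?g p = (par M (I ! p) + par M x) * (par M x + par M y + tail_parity M k (Suc p) I)"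
          "?g (Suc p) = (par M (I ! Suc p) + par M y) * (par M y + tail_parity M k (Suc p) I)"
          using p len by (simp_all add: tail_parity_def)
        have "(- 1 :: 'a) ^ twist M k I ?J = (- 1) ^ ((par M (I ! p) + par M x) * (par M x + par M y) + (par M (I ! Suc p) + par M y) * par M y)"
          using False e unfolding s g by (intro minus_one_power_cong) (simp, blast)
        thus ?thesis unfolding pl by simp
      qed
    qed
    finally show ?thesis using I by (simp add: app_tens_op app_two_site sum.cartesian_product)
  qed (simp add: app_tens_op app_two_site)
qed

lemma even_tens_place_L:
  assumes "\<And>i j. s (X [i] [j]) = (- 1) ^ (par M i + par M j) * X [i] [j]" "s 0 = 0" "p < k"
  shows "even_tens M N k s (place k [Suc p] X)"
  unfolding even_tens_def
proof safe
  fix I J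
  show "s (place k [Suc p] X I J) = (- 1) ^ tparity M k I J * place k [Suc p] X I J"
  proof (cases "\<forall>b\<in>{1..k} - set [Suc p]. I ! (b - 1) = J ! (b - 1)")
    case True
    have "I ! a = J ! a" if "a < k" "a \<noteq> p" for a
      using True[rule_format, of "Suc a"] that by auto
    hence "even (\<Sum>a\<in>{..<k} - {p}. par M (I ! a) + par M (J ! a))"
      by (intro dvd_sum) auto
    hence "even (tparity M k I J + (par M (I ! p) + par M (J ! p)))"
      using assms(3) unfolding tparity_def by (subst sum.remove[of _ p]) auto
    hence "(- 1 :: 'a) ^ tparity M k I J = (- 1) ^ (par M (I ! p) + par M (J ! p))"
      by (rule minus_one_power_cong)
    thus ?thesis using True assms(1) by (simp add: place_def)
  next
    case False
    hence "place k [Suc p] X I J = 0" unfolding place_def by (rule if_not_P)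
    thus ?thesis using assms(2) by simp
  qed
qed

lemma even_tens_place2:
  assumes X: "\<And>i j x y. s (X [i, j] [x, y]) = (- 1) ^ (par M i + par M x + (par M j + par M y)) * X [i, j] [x, y]"
    and "s 0 = 0" "Suc p < k"
  shows "even_tens M N k s (place k [Suc p, Suc (Suc p)] X)"
  unfolding even_tens_def
proof safe
  fix I J
  show "s (place k [Suc p, Suc (Suc p)] X I J) = (- 1) ^ tparity M k I J * place k [Suc p, Suc (Suc p)] X I J"
  proof (cases "\<forall>b\<in>{1..k} - set [Suc p, Suc (Suc p)]. I ! (b - 1) = J ! (b - 1)")
    case True
    let ?f = "\<lambda>a. par M (I ! a) + par M (J ! a)"
    have "I ! a = J ! a" if "a < k" "a \<noteq> p" "a \<noteq> Suc p" for a
      using True[rule_format, of "Suc a"] that by auto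
    hence "even (\<Sum>a\<in>{..<k} - {p} - {Suc p}. ?f a)"
      by (intro dvd_sum) auto
    moreover have "tparity M k I J = ?f p + (?f (Suc p) + (\<Sum>a\<in>{..<k} - {p} - {Suc p}. ?f a))"
      using assms(3) unfolding tparity_def by (simp add: sum.remove[of "{..<k}" p] sum.remove[of "{..<k} - {p}" "Suc p"])
    ultimately have "(- 1 :: 'a) ^ tparity M k I J = (- 1) ^ (?f p + ?f (Suc p))"
      by (intro minus_one_power_cong) auto
    thus ?thesis using True X by (simp add: place_def)
  next
    case False
    hence "place k [Suc p, Suc (Suc p)] X I J = 0" unfolding place_def by (rule if_not_P)
    thus ?thesis using assms(2) by simp
  qed
qed

section \<open>The free algebra and the ideal of relations\<close>

lemma poly_mapping_add_induct:
  fixes p :: "'a \<Rightarrow>\<^sub>0 'b::comm_monoid_add"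
  assumes "\<And>w c. P (Poly_Mapping.single w c)" "\<And>p q. P p \<Longrightarrow> P q \<Longrightarrow> P (p + q)"
  shows "P p"
proof (induction p rule: Poly_Mapping.update_induct)
  case const
  have "P (Poly_Mapping.single undefined 0)" by (rule assms(1))
  thus ?case by simp
next
  case (update p a b)
  have "Poly_Mapping.update a b p = p + Poly_Mapping.single a b"
    using update(1) by (intro poly_mapping_eqI) (auto simp: lookup_update lookup_add lookup_single in_keys_iff when_def)
  thus ?case using update assms by simp
qed

lemma lookup_grinv: "Poly_Mapping.lookup (grinv M p) w = (- 1) ^ (\<Sum>g\<leftarrow>letters w. gen_par M g) * Poly_Mapping.lookup p w"
  by (simp add: grinv_def lookup_mapp when_def in_keys_iff)

lemma grinv_add: "grinv M (x + y) = grinv M x + grinv M y"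
  by (rule poly_mapping_eqI) (simp add: lookup_grinv lookup_add distrib_left)

lemma grinv_uminus: "grinv M (- x) = - grinv M x"
  by (rule poly_mapping_eqI) (simp add: lookup_grinv)

lemma grinv_single:
  "grinv M (Poly_Mapping.single w c) = Poly_Mapping.single w ((- 1) ^ (\<Sum>g\<leftarrow>letters w. gen_par M g) * c)"
  by (rule poly_mapping_eqI) (auto simp: lookup_grinv lookup_single when_def)

lemma grinv_mult: "grinv M (x * y) = grinv M x * grinv M y"
proof (induction x rule: poly_mapping_add_induct)
  case (1 w c)
  show ?case
    by (induction y rule: poly_mapping_add_induct)
      (simp_all add: grinv_add grinv_single mult_single distrib_left plus_fword_def power_add mult_ac)
qed (simp add: grinv_add distrib_right)

lemma grinv_scal [simp]: "grinv M (scal c) = scal c"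
  by (simp add: scal_def grinv_single zero_fword_def)

lemma grinv_0 [simp]: "grinv M 0 = 0"
  using grinv_add[of M 0 0] by simp

lemma grinv_1 [simp]: "grinv M 1 = 1"
  using grinv_scal[of M 1] by (simp add: scal_def)

lemma grinv_gen: "grinv M (gen g) = (- 1) ^ gen_par M g * gen g"
proof -
  have "(- 1) ^ n * gen g = Poly_Mapping.single (Word [g]) ((- 1) ^ n)" for n
    by (induction n) (simp_all add: gen_def single_uminus[symmetric])
  thus ?thesis by (simp add: gen_def grinv_single)
qed

lemma grinv_sum: "grinv M (sum f A) = (\<Sum>i\<in>A. grinv M (f i))"
  by (induction A rule: infinite_finite_induct) (simp_all add: grinv_add)

lemma grinv_fps_uminus: "grinv_fps M (- x) = - grinv_fps M x"
  by (rule fps_ext) (simp add: grinv_fps_def grinv_uminus)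

lemma grinv_fps_add: "grinv_fps M (x + y) = grinv_fps M x + grinv_fps M y"
  by (rule fps_ext) (simp add: grinv_fps_def grinv_add)

lemma grinv_fps_mult: "grinv_fps M (x * y) = grinv_fps M x * grinv_fps M y"
  by (rule fps_ext) (simp add: grinv_fps_def fps_mult_nth grinv_sum grinv_mult)

lemma grinv_fps_const [simp]: "grinv_fps M (fps_const x) = fps_const (grinv M x)"
  by (rule fps_ext) (simp add: grinv_fps_def)

lemma scal_add: "scal (x + y) = scal x + scal y"
  by (simp add: scal_def single_add)

lemma scal_mult: "scal (x * y) = scal x * scal y"
  by (simp add: scal_def mult_single)

lemma scal_0 [simp]: "scal 0 = 0" and scal_1 [simp]: "scal 1 = 1"
  by (simp_all add: scal_def)

lemma scal_uminus: "scal (- x) = - scal x"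
  using scal_add[of x "- x"] by (simp add: eq_neg_iff_add_eq_0 add.commute)

lemma scal_comm: "p * scal c = scal c * p"
proof (induction p rule: poly_mapping_add_induct)
  case (1 w d) thus ?case by (simp add: scal_def mult_single mult.commute)
qed (simp add: distrib_left distrib_right)

lemma scal_left: "p * (scal c * p') = scal c * (p * p')"
  by (metis scal_comm mult.assoc)

definition scalar :: "cq \<Rightarrow> falg fps" where "scalar c = fps_const (scal c)"

lemma scalar_add: "scalar (x + y) = scalar x + scalar y" by (simp add: scalar_def scal_add)
lemma scalar_mult: "scalar (x * y) = scalar x * scalar y" by (simp add: scalar_def scal_mult)
lemma scalar_0 [simp]: "scalar 0 = 0" and scalar_1 [simp]: "scalar 1 = 1" by (simp_all add: scalar_def)
lemma scalar_uminus: "scalar (- x) = - scalar x"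
  using scalar_add[of x "- x"] by (simp add: eq_neg_iff_add_eq_0 add.commute)
lemma scalar_diff: "scalar (x - y) = scalar x - scalar y"
  using scalar_add[of x "- y"] by (simp add: scalar_uminus)

lemma scalar_sum: "scalar (sum f A) = (\<Sum>i\<in>A. scalar (f i))"
  by (induction A rule: infinite_finite_induct) (simp_all add: scalar_add)
lemma scalar_comm: "p * scalar c = scalar c * p"
  by (rule fps_ext) (simp add: scalar_def scal_comm)
lemma scalar_left: "p * (scalar c * p') = scalar c * (p * p')"
  by (metis scalar_comm mult.assoc)
lemma scalar_sign: "scalar ((- 1) ^ n * x) = (- 1) ^ n * scalar x"
  by (induction n) (simp_all add: scalar_uminus)
lemma scal_sign: "scal ((- 1) ^ n * x) = (- 1) ^ n * scal x"
  by (induction n) (simp_all add: scal_uminus)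

lemma free_alg_simps: "mult (free_alg M N) = (*)" "add (free_alg M N) = (+)" "zero (free_alg M N) = 0"
  by (simp_all add: free_alg_def)

lemma uq_ideal_0: "0 \<in> uq_ideal M N"
  using additive_subgroup.zero_closed[OF ideal.axioms(1)[OF uq_ideal]] by (simp add: free_alg_simps)

lemma uq_ideal_add: "a \<in> uq_ideal M N \<Longrightarrow> b \<in> uq_ideal M N \<Longrightarrow> a + b \<in> uq_ideal M N"
  using additive_subgroup.a_closed[OF ideal.axioms(1)[OF uq_ideal]] by (simp add: free_alg_simps)

lemma uq_ideal_mult_left: "a \<in> uq_ideal M N \<Longrightarrow> x \<in> carrier (free_alg M N) \<Longrightarrow> x * a \<in> uq_ideal M N"
  using ideal.I_l_closed[OF uq_ideal] by (simp add: free_alg_simps)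

lemma uq_ideal_mult_right: "a \<in> uq_ideal M N \<Longrightarrow> x \<in> carrier (free_alg M N) \<Longrightarrow> a * x \<in> uq_ideal M N"
  using ideal.I_r_closed[OF uq_ideal] by (simp add: free_alg_simps)

lemma uq_ideal_scal: "a \<in> uq_ideal M N \<Longrightarrow> scal c * a \<in> uq_ideal M N"
  by (intro uq_ideal_mult_left free_alg_closed(7))

lemma uq_ideal_uminus: "a \<in> uq_ideal M N \<Longrightarrow> - a \<in> uq_ideal M N"
  using uq_ideal_scal[of a M N "- 1"] by (simp add: scal_uminus)

lemma uq_ideal_diff: "a \<in> uq_ideal M N \<Longrightarrow> b \<in> uq_ideal M N \<Longrightarrow> a - b \<in> uq_ideal M N"
  using uq_ideal_add[of a M N "- b"] uq_ideal_uminus[of b M N] by simp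

lemma uq_ideal_sum: "(\<And>i. i \<in> A \<Longrightarrow> f i \<in> uq_ideal M N) \<Longrightarrow> sum f A \<in> uq_ideal M N"
  by (induction A rule: infinite_finite_induct) (auto intro: uq_ideal_0 uq_ideal_add)

lemma uq_ideal_sign: "a \<in> uq_ideal M N \<Longrightarrow> (- 1) ^ n * a \<in> uq_ideal M N"
  by (induction n) (auto dest: uq_ideal_uminus)

lemma uq_ideal_scal_iff: "c \<noteq> 0 \<Longrightarrow> scal c * a \<in> uq_ideal M N \<longleftrightarrow> a \<in> uq_ideal M N"
  using uq_ideal_scal[of "scal c * a" M N "inverse c"] uq_ideal_scal[of a M N c]
  by (auto simp: mult.assoc[symmetric] scal_mult[symmetric])

lemma uq_proj_zero: "a \<in> uq_ideal M N \<Longrightarrow> uq_proj M N a = \<zero>\<^bsub>Uq M N\<^esub>"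
proof -
  assume a: "a \<in> uq_ideal M N"
  interpret ideal "uq_ideal M N" "free_alg M N" by (rule uq_ideal)
  show ?thesis unfolding uq_proj_def Uq_def FactRing_def using a_rcos_const[OF a] by simp
qed

text \<open>
  An entry of \<open>R L\<^sub>1 L'\<^sub>2 - L'\<^sub>2 L\<^sub>1 R\<close> in terms of the entries \<open>r\<close>, \<open>l\<close>, \<open>l'\<close> of the three
  operators when there are just two copies. It serves both the defining relations and their
  consequences on \<open>k\<close> copies.
\<close>
definition rll_comp :: "nat \<Rightarrow> nat \<Rightarrow> (nat \<Rightarrow> nat \<Rightarrow> nat \<Rightarrow> nat \<Rightarrow> 'a::ring_1) \<Rightarrow>
    (nat \<Rightarrow> nat \<Rightarrow> 'a) \<Rightarrow> (nat \<Rightarrow> nat \<Rightarrow> 'a) \<Rightarrow> nat \<Rightarrow> nat \<Rightarrow> nat \<Rightarrow> nat \<Rightarrow> 'a" where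
  "rll_comp M N r l l' i j z w =
     (\<Sum>x\<in>{1..M+N}. \<Sum>y\<in>{1..M+N}.
        (- 1) ^ ((par M x + par M z) * (par M z + par M y) + (par M y + par M w) * par M w) *
          (r i j x y * (l x z * l' y w))
        - (- 1) ^ ((par M j + par M y) * par M y + (par M i + par M x) * (par M x + par M y)) *
          (l' j y * (l i x * r x y z w)))"

lemma sum_swap4:
  "(\<Sum>x\<in>A. \<Sum>y\<in>B. \<Sum>z\<in>C. \<Sum>w\<in>D. f x y z w) = (\<Sum>z\<in>C. \<Sum>w\<in>D. \<Sum>x\<in>A. \<Sum>y\<in>B. f x y z w)"
proof -
  have "(\<Sum>x\<in>A. \<Sum>y\<in>B. \<Sum>z\<in>C. \<Sum>w\<in>D. f x y z w) = (\<Sum>x\<in>A. \<Sum>z\<in>C. \<Sum>y\<in>B. \<Sum>w\<in>D. f x y z w)"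
    by (intro sum.cong refl sum.swap)
  also have "\<dots> = (\<Sum>z\<in>C. \<Sum>x\<in>A. \<Sum>y\<in>B. \<Sum>w\<in>D. f x y z w)" by (rule sum.swap)
  also have "\<dots> = (\<Sum>z\<in>C. \<Sum>x\<in>A. \<Sum>w\<in>D. \<Sum>y\<in>B. f x y z w)" by (intro sum.cong refl sum.swap)
  also have "\<dots> = (\<Sum>z\<in>C. \<Sum>w\<in>D. \<Sum>x\<in>A. \<Sum>y\<in>B. f x y z w)" by (intro sum.cong refl sum.swap)
  finally show ?thesis .
qed

text \<open>
  On \<open>k\<close> copies the components of the RLL relation are those on two copies up to a sign that
  depends only on the outer indices: the parity \<open>t\<close> of the indices after the two sites
  contributes to each of the \<open>L\<close>-operators, and in the product of the two the dependence on the
  inner indices \<open>x, y\<close> cancels since \<open>r\<close> is even.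
\<close>
lemma linop_rll:
  fixes r :: "nat \<Rightarrow> nat \<Rightarrow> nat \<Rightarrow> nat \<Rightarrow> 'a::ring_1"
  assumes p: "Suc p < k" and I: "I \<in> idx M N k"
    and r: "\<And>i j x y. odd (par M i + par M j + par M x + par M y) \<Longrightarrow> r i j x y = 0"
  shows "app (two_site M N k p r * one_site M N k p l * one_site M N k (Suc p) l'
      - one_site M N k (Suc p) l' * one_site M N k p l * two_site M N k p r) v I =
    (\<Sum>z\<in>{1..M+N}. \<Sum>w\<in>{1..M+N}.
      (- 1) ^ (tail_parity M k (Suc p) I * (par M (I ! p) + par M (I ! Suc p) + par M z + par M w)) *
      (rll_comp M N r l l' (I ! p) (I ! Suc p) z w * v (I[p := z, Suc p := w])))"
proof -
  note len = idx_length[OF I]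
  let ?A = "{1..M+N}"
  define i j t where "i = I ! p" and "j = I ! Suc p" and "t = tail_parity M k (Suc p) I"
  define u where "u z w = v (I[p := z, Suc p := w])" for z w
  have tl1: "tail_parity M k (Suc p) J = t" if "\<And>c. c > Suc p \<Longrightarrow> J ! c = I ! c" for J
    using that by (auto simp: tail_parity_def t_def intro!: sum.cong)
  have tl2: "tail_parity M k p J = par M (J ! Suc p) + t" if "\<And>c. c > Suc p \<Longrightarrow> J ! c = I ! c" for J
  proof -
    have "{Suc p..<k} = insert (Suc p) {Suc (Suc p)..<k}" using p by auto
    thus ?thesis using tl1[OF that] by (simp add: tail_parity_def)
  qed
  have 1: "app (two_site M N k p r * one_site M N k p l * one_site M N k (Suc p) l') v I =
    (\<Sum>z\<in>?A. \<Sum>w\<in>?A. \<Sum>x\<in>?A. \<Sum>y\<in>?A.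
      (- 1) ^ (t * (par M i + par M j + par M z + par M w)) *
      ((- 1) ^ ((par M x + par M z) * (par M z + par M y) + (par M y + par M w) * par M w) *
          (r i j x y * (l x z * (l' y w * u z w)))))" (is "?L = ?R")
  proof -
    have "?L = (\<Sum>x\<in>?A. \<Sum>y\<in>?A. r i j x y * (\<Sum>z\<in>?A. (- 1) ^ ((par M x + par M z) * (par M z + (par M y + t))) *
       l x z * (\<Sum>w\<in>?A. (- 1) ^ ((par M y + par M w) * (par M w + t)) * l' y w * u z w)))"
      unfolding app_times app_two_site[of M N k p r] if_P[OF I]
    proof (intro sum.cong refl arg_cong2[where f = "(*)"])
      fix x y assume xy: "x \<in> ?A" "y \<in> ?A"
      let ?J = "I[p := x, Suc p := y]"
      have J: "?J \<in> idx M N k" using I xy by (intro idx_update)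
      have tJ: "tail_parity M k p ?J = par M y + t" using tl2[of ?J] p len by simp
      show "app (one_site M N k p l) (app (one_site M N k (Suc p) l') v) ?J =
        (\<Sum>z\<in>?A. (- 1) ^ ((par M x + par M z) * (par M z + (par M y + t))) *
         l x z * (\<Sum>w\<in>?A. (- 1) ^ ((par M y + par M w) * (par M w + t)) * l' y w * u z w))"
        unfolding app_one_site[of M N k p] if_P[OF J]
      proof (intro sum.cong refl arg_cong2[where f = "(*)"])
        fix z assume z: "z \<in> ?A"
        let ?K = "?J[p := z]"
        have K: "?K \<in> idx M N k" using J z by (rule idx_update)
        have tK: "tail_parity M k (Suc p) ?K = t" using tl1[of ?K] p len by simp
        have K': "?K ! Suc p = y" using p len by simp
        have Kw: "?K[Suc p := w] = I[p := z, Suc p := w]" for w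
          using p len by (simp add: list_update_swap)
        show "app (one_site M N k (Suc p) l') v ?K =
            (\<Sum>w\<in>?A. (- 1) ^ ((par M y + par M w) * (par M w + t)) * l' y w * u z w)"
          unfolding app_one_site if_P[OF K] tK K' u_def Kw ..
      qed (use tJ p len in \<open>simp_all\<close>)
    qed (simp_all add: i_def j_def)
    also have "\<dots> = (\<Sum>x\<in>?A. \<Sum>y\<in>?A. \<Sum>z\<in>?A. \<Sum>w\<in>?A.
      (- 1) ^ (t * (par M i + par M j + par M z + par M w)) *
      ((- 1) ^ ((par M x + par M z) * (par M z + par M y) + (par M y + par M w) * par M w) *
          (r i j x y * (l x z * (l' y w * u z w)))))"
    proof (intro sum.cong refl)
      fix x y
      show "r i j x y * (\<Sum>z\<in>?A. (- 1) ^ ((par M x + par M z) * (par M z + (par M y + t))) *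
         l x z * (\<Sum>w\<in>?A. (- 1) ^ ((par M y + par M w) * (par M w + t)) * l' y w * u z w)) =
        (\<Sum>z\<in>?A. \<Sum>w\<in>?A.
        (- 1) ^ (t * (par M i + par M j + par M z + par M w)) *
        ((- 1) ^ ((par M x + par M z) * (par M z + par M y) + (par M y + par M w) * par M w) *
            (r i j x y * (l x z * (l' y w * u z w)))))"
      proof (cases "odd (par M i + par M j + par M x + par M y)")
        case False
        thus ?thesis
          by (simp add: sum_distrib_left sgn_mult_sum sign_simps)
            (intro sum.cong refl sgn_mult_cong, simp, blast)
      qed (simp add: r)
    qed
    also have "\<dots> = ?R" by (rule sum_swap4)
    finally show ?thesis .
  qed
  have 2: "app (one_site M N k (Suc p) l' * one_site M N k p l * two_site M N k p r) v I =
    (\<Sum>z\<in>?A. \<Sum>w\<in>?A. \<Sum>x\<in>?A. \<Sum>y\<in>?A.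
      (- 1) ^ (t * (par M i + par M j + par M z + par M w)) *
      ((- 1) ^ ((par M j + par M y) * par M y + (par M i + par M x) * (par M x + par M y)) *
          (l' j y * (l i x * (r x y z w * u z w)))))" (is "?L = ?R")
  proof -
    have "?L = (\<Sum>y\<in>?A. (- 1) ^ ((par M j + par M y) * (par M y + t)) * l' j y *
      (\<Sum>x\<in>?A. (- 1) ^ ((par M i + par M x) * (par M x + (par M y + t))) * l i x *
        (\<Sum>z\<in>?A. \<Sum>w\<in>?A. r x y z w * u z w)))"
      unfolding app_times app_one_site[of M N k "Suc p"] if_P[OF I]
    proof (intro sum.cong refl arg_cong2[where f = "(*)"])
      fix y assume y: "y \<in> ?A"
      let ?J = "I[Suc p := y]"
      have J: "?J \<in> idx M N k" using I y by (intro idx_update)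
      have tJ: "tail_parity M k p ?J = par M y + t" using tl2[of ?J] p len by simp
      have J': "?J ! p = i" using p len by (simp add: i_def)
      show "app (one_site M N k p l) (app (two_site M N k p r) v) ?J =
        (\<Sum>x\<in>?A. (- 1) ^ ((par M i + par M x) * (par M x + (par M y + t))) * l i x *
        (\<Sum>z\<in>?A. \<Sum>w\<in>?A. r x y z w * u z w))"
        unfolding app_one_site[of M N k p] if_P[OF J] tJ J'
      proof (intro sum.cong refl arg_cong2[where f = "(*)"])
        fix x assume x: "x \<in> ?A"
        let ?K = "?J[p := x]"
        have K: "?K \<in> idx M N k" using J x by (rule idx_update)
        have K': "?K ! p = x" "?K ! Suc p = y" using p len by simp_all
        have Kw: "?K[p := z, Suc p := w] = I[p := z, Suc p := w]" for z w
          using p len by (simp add: list_update_swap[of "Suc p" p])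
        show "app (two_site M N k p r) v ?K = (\<Sum>z\<in>?A. \<Sum>w\<in>?A. r x y z w * u z w)"
          unfolding app_two_site if_P[OF K] K' u_def Kw ..
      qed
    qed (simp_all add: j_def t_def)
    also have "\<dots> = (\<Sum>y\<in>?A. \<Sum>x\<in>?A. \<Sum>z\<in>?A. \<Sum>w\<in>?A.
      (- 1) ^ (t * (par M i + par M j + par M z + par M w)) *
      ((- 1) ^ ((par M j + par M y) * par M y + (par M i + par M x) * (par M x + par M y)) *
          (l' j y * (l i x * (r x y z w * u z w)))))"
    proof -
      have e: "(- 1) ^ ((par M j + par M y) * (par M y + t)) * l' j y *
         ((- 1) ^ ((par M i + par M x) * (par M x + (par M y + t))) * l i x * (r x y z w * u z w)) =
        (- 1) ^ (t * (par M i + par M j + par M z + par M w)) *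
      ((- 1) ^ ((par M j + par M y) * par M y + (par M i + par M x) * (par M x + par M y)) *
          (l' j y * (l i x * (r x y z w * u z w))))" for x y z w
      proof (cases "odd (par M x + par M y + par M z + par M w)")
        case False
        thus ?thesis by (simp add: sign_simps) (intro sgn_mult_cong, simp, blast)
      qed (simp add: r)
      show ?thesis unfolding sum_distrib_left by (intro sum.cong refl e)
    qed
    also have "\<dots> = (\<Sum>x\<in>?A. \<Sum>y\<in>?A. \<Sum>z\<in>?A. \<Sum>w\<in>?A.
      (- 1) ^ (t * (par M i + par M j + par M z + par M w)) *
      ((- 1) ^ ((par M j + par M y) * par M y + (par M i + par M x) * (par M x + par M y)) *
          (l' j y * (l i x * (r x y z w * u z w)))))"
      by (rule sum.swap)
    also have "\<dots> = ?R" by (rule sum_swap4)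
    finally show ?thesis .
  qed
  show ?thesis
    unfolding app_minus 1 2 rll_comp_def i_def[symmetric] j_def[symmetric] t_def[symmetric] u_def[symmetric]
    unfolding sum_subtractf[symmetric] sum_distrib_left sum_distrib_right
    by (intro sum.cong refl) (simp add: left_diff_distrib right_diff_distrib mult.assoc)
qed

section \<open>The RLL relation with a polynomial R-matrix\<close>

lemma Rzw_entry:
  assumes "i \<in> {1..M+N}" "j \<in> {1..M+N}" "x \<in> {1..M+N}" "y \<in> {1..M+N}"
  shows "Rzw M N q z w [i, j] [x, y] =
    (if x = i \<and> y = j then (if i = j then z * qi M q i - w * inverse (qi M q i) else z - w)
     else if x = j \<and> y = i then (if i < j then z else w) * (qi M q j - inverse (qi M q j)) else 0)"
proof -
  have A: "(\<Sum>a\<in>{1..M+N}. (z * qi M q a - w * inverse (qi M q a)) * E2 a a a a [i, j] [x, y]) =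
    (if x = i \<and> y = j \<and> i = j then z * qi M q i - w * inverse (qi M q i) else 0)"
  proof -
    have "(\<Sum>a\<in>{1..M+N}. (z * qi M q a - w * inverse (qi M q a)) * E2 a a a a [i, j] [x, y]) =
      (\<Sum>a\<in>{1..M+N}. if a = i then (if x = i \<and> y = j \<and> i = j then z * qi M q i - w * inverse (qi M q i) else 0) else 0)"
      by (intro sum.cong refl) (auto simp: E2_def)
    thus ?thesis using assms by simp
  qed
  have B: "(\<Sum>a\<in>{1..M+N}. \<Sum>b\<in>{1..M+N} - {a}. E2 a a b b [i, j] [x, y]) =
    (if x = i \<and> y = j \<and> i \<noteq> j then 1 else 0 :: 'a)"
  proof -
    have "(\<Sum>b\<in>{1..M+N} - {a}. E2 a a b b [i, j] [x, y]) =
       (if a = i then (if x = i \<and> y = j \<and> i \<noteq> j then 1 else 0 :: 'a) else 0)" for a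
    proof -
      have "(\<Sum>b\<in>{1..M+N} - {a}. E2 a a b b [i, j] [x, y]) =
        (\<Sum>b\<in>{1..M+N} - {a}. if b = j then (if a = i \<and> x = i \<and> y = j then 1 else 0 :: 'a) else 0)"
        by (intro sum.cong refl) (auto simp: E2_def)
      thus ?thesis using assms by (auto simp: sum.delta)
    qed
    thus ?thesis using assms by simp
  qed
  have C: "(\<Sum>a\<in>{1..M+N}. \<Sum>b\<in>S a. (qi M q b - inverse (qi M q b)) * E2 a b b a [i, j] [x, y]) =
    (if j \<in> S i \<and> x = j \<and> y = i then qi M q j - inverse (qi M q j) else 0)"
    if fin: "\<And>a. finite (S a)" for S
  proof -
    have "(\<Sum>b\<in>S a. (qi M q b - inverse (qi M q b)) * E2 a b b a [i, j] [x, y]) =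
       (if a = i then (if j \<in> S i \<and> x = j \<and> y = i then qi M q j - inverse (qi M q j) else 0) else 0)" for a
    proof -
      have "(\<Sum>b\<in>S a. (qi M q b - inverse (qi M q b)) * E2 a b b a [i, j] [x, y]) =
        (\<Sum>b\<in>S a. if b = j then (if a = i \<and> x = j \<and> y = i then qi M q j - inverse (qi M q j) else 0) else 0)"
        by (intro sum.cong refl) (auto simp: E2_def)
      thus ?thesis using fin by (auto simp: sum.delta)
    qed
    thus ?thesis using assms by simp
  qed
  note C1 = C[of "\<lambda>i. {i<..M+N}", simplified finite_greaterThanAtMost, OF TrueI]
    and C2 = C[of "\<lambda>i. {1..<i}", simplified finite_atLeastLessThan, OF TrueI]
  have m: "j \<in> {i<..M+N} \<longleftrightarrow> i < j" "j \<in> {1..<i} \<longleftrightarrow> j < i" using assms by auto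
  have fin: "(if x = i \<and> y = j \<and> i = j then a else 0) + c * (if x = i \<and> y = j \<and> i \<noteq> j then 1 else 0)
     + z * (if i < j \<and> x = j \<and> y = i then b else 0) + w * (if j < i \<and> x = j \<and> y = i then b else 0) =
    (if x = i \<and> y = j then (if i = j then a else c) else if x = j \<and> y = i then (if i < j then z else w) * b else 0)"
    for a b c :: 'a
  proof (cases i j rule: linorder_cases)
    case less thus ?thesis by simp
  next
    case equal thus ?thesis by simp
  next
    case greater thus ?thesis by simp
  qed
  show ?thesis unfolding Rzw_def A B C1 C2 m by (rule fin)
qed

lemma Rzw_linear: "Rzw M N q z w I J = z * Rzw M N q 1 0 I J + w * Rzw M N q 0 1 I J"
proof -
  have 1: "(\<Sum>i\<in>A. (z * f i - w * g i) * e i) = z * (\<Sum>i\<in>A. f i * e i) - w * (\<Sum>i\<in>A. g i * e i)"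
    for A :: "nat set" and f g e :: "nat \<Rightarrow> 'a"
    by (simp add: sum_distrib_left sum_subtractf[symmetric] left_diff_distrib mult.assoc)
  show ?thesis unfolding Rzw_def 1 by (simp add: sum_negf algebra_simps)
qed

text \<open>
  The scalar series \<open>f(x) / (q - q\<^sup>-\<^sup>1 x\<^sup>-\<^sup>1)\<close> in \<open>x\<^sup>-\<^sup>1\<close>, for which \<open>R(x)\<close> is this series times
  \<open>R(1, x\<^sup>-\<^sup>1)\<close>.
\<close>
definition R_prefactor :: "nat \<Rightarrow> nat \<Rightarrow> cq fps" where
  "R_prefactor M N = fser M N * inverse (fps_const qq - fps_const (inverse qq) * fps_X)"

lemma fls_const_powi: "fls_const (c powi n) = fls_const (c :: cq) powi n"
  by (cases n) (auto simp: power_int_def fls_const_power fls_inverse_const)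

lemma qi_fls: "qi M (fls_const q) i = fls_const (qi M (q::cq) i)"
  by (simp add: qi_def fls_const_powi)

lemma Rzw_fls: "Rzw M N (fls_const q) (fls_const a) (fls_const b) I J = fls_const (Rzw M N (q::cq) a b I J)"
proof -
  have E: "E2 i j k l I J = fls_const (E2 i j k l I J :: cq)" for i j k l
    by (simp add: E2_def)
  have S: "(\<Sum>x\<in>A. fls_const (f x)) = fls_const (\<Sum>x\<in>A. f x :: cq)" for A :: "nat set" and f
    by (induction A rule: infinite_finite_induct) (simp_all add: fls_plus_const)
  show ?thesis unfolding Rzw_def qi_fls E fls_inverse_const
    by (simp only: S fls_const_mult_const fls_plus_const fls_minus_const)
qed

text \<open>
  Dividing the numerator and the denominator of \<open>R(x,1) / (xq - q\<^sup>-\<^sup>1)\<close> by \<open>x\<close> gives the matrix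
  \<open>R(1,0) + x\<^sup>-\<^sup>1 R(0,1)\<close> and a denominator that is invertible as a series in \<open>x\<^sup>-\<^sup>1\<close>.
\<close>
lemma Rcoeff_eq:
  assumes "M \<noteq> N"
  shows "Rcoeff M N n I J = fps_nth (R_prefactor M N) n * Rzw M N qq 1 0 I J +
    (if n = 0 then 0 else fps_nth (R_prefactor M N) (n - 1) * Rzw M N qq 0 1 I J)"
    and "fps_nth (R_prefactor M N) 0 \<noteq> 0"
proof -
  define a b where "a = Rzw M N qq 1 0 I J" and "b = Rzw M N qq 0 1 I J"
  let ?D = "fps_const qq - fps_const (inverse qq) * fps_X :: cq fps"
  have D0: "fps_nth ?D 0 \<noteq> 0" by simp
  hence Dnz: "?D \<noteq> 0" by (metis fps_zero_nth)
  have X: "fls_X_inv * fls_X = (1 :: cq fls)" by (simp add: fls_X_inv_times_conv_shift)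
  have num: "Rzw M N (fls_const qq) fls_X_inv 1 I J = fls_X_inv * fps_to_fls (fps_const a + fps_const b * fps_X)"
  proof -
    have "Rzw M N (fls_const qq) fls_X_inv 1 I J =
        fls_X_inv * Rzw M N (fls_const qq) (fls_const 1) (fls_const 0) I J + Rzw M N (fls_const qq) (fls_const 0) (fls_const 1) I J"
      by (subst Rzw_linear) simp
    also have "\<dots> = fls_X_inv * fls_const a + (fls_X_inv * fls_X) * fls_const b"
      unfolding Rzw_fls a_def b_def X by simp
    also have "\<dots> = fls_X_inv * (fls_const a + fls_const b * fls_X)" by (simp add: algebra_simps)
    also have "fls_const a + fls_const b * fls_X = fps_to_fls (fps_const a + fps_const b * fps_X)"
      by (simp add: fls_times_fps_to_fls)
    finally show ?thesis .
  qed
  have den: "fls_X_inv * fls_const qq - inverse (fls_const qq) = fls_X_inv * fps_to_fls ?D"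
  proof -
    have "fls_X_inv * fps_to_fls ?D = fls_X_inv * fls_const qq - (fls_X_inv * fls_X) * fls_const (inverse qq)"
      by (simp add: fls_times_fps_to_fls algebra_simps)
    thus ?thesis unfolding X by (simp add: fls_inverse_const)
  qed
  have Xi: "fls_X_inv \<noteq> (0 :: cq fls)" by simp
  have "Rx M N I J = fps_to_fls (fser M N) * (fps_to_fls (fps_const a + fps_const b * fps_X) / fps_to_fls ?D)"
    unfolding Rx_def Rbar_def num den using Xi by simp
  also have "\<dots> = fps_to_fls (R_prefactor M N * (fps_const a + fps_const b * fps_X))"
  proof -
    have "fps_to_fls ?D * fps_to_fls (inverse ?D) = 1"
      using inverse_mult_eq_1'[OF D0] by (metis fls_times_fps_to_fls fps_one_to_fls)
    hence "inverse (fps_to_fls ?D) = fps_to_fls (inverse ?D)" by (rule inverse_unique)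
    thus ?thesis by (simp only: divide_inverse R_prefactor_def fls_times_fps_to_fls mult_ac)
  qed
  finally have "Rcoeff M N n I J = fps_nth (R_prefactor M N * (fps_const a + fps_const b * fps_X)) n"
    by (simp add: Rcoeff_def)
  also have "\<dots> = fps_nth (R_prefactor M N) n * a + (if n = 0 then 0 else fps_nth (R_prefactor M N) (n - 1) * b)"
    by (simp add: distrib_left mult.assoc[symmetric])
  finally show "Rcoeff M N n I J = fps_nth (R_prefactor M N) n * Rzw M N qq 1 0 I J +
    (if n = 0 then 0 else fps_nth (R_prefactor M N) (n - 1) * Rzw M N qq 0 1 I J)"
    unfolding a_def b_def .
  have "is_f M N (fser M N)" unfolding fser_def by (rule theI') (rule is_f_ex1[OF assms])
  hence "fps_nth (fser M N) 0 = 1" by (simp add: is_f_def)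
  thus "fps_nth (R_prefactor M N) 0 \<noteq> 0" by (simp add: R_prefactor_def)
qed

text \<open>The sign in \<open>tens_op_place2\<close>.\<close>
definition twist2 :: "nat \<Rightarrow> nat \<Rightarrow> nat \<Rightarrow> nat \<Rightarrow> nat \<Rightarrow> nat" where
  "twist2 M i j x y = (par M i + par M x) * (par M x + par M y) + (par M j + par M y) * par M y"

definition L_entry :: "pm \<Rightarrow> int \<Rightarrow> nat \<Rightarrow> nat \<Rightarrow> falg" where
  "L_entry s e i j = Lcoeff s e [i] [j]"

definition R_entry :: "nat \<Rightarrow> (nat list \<Rightarrow> nat list \<Rightarrow> cq) \<Rightarrow> nat \<Rightarrow> nat \<Rightarrow> nat \<Rightarrow> nat \<Rightarrow> falg" where
  "R_entry M X i j x y = scal ((- 1) ^ twist2 M i j x y * X [i, j] [x, y])"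

lemma Rzw_parity: "odd (par M i + par M j + par M x + par M y) \<Longrightarrow> Rzw M N q a b [i, j] [x, y] = 0"
proof -
  assume o: "odd (par M i + par M j + par M x + par M y)"
  hence z: "E2 c d e f [i, j] [x, y] = (0::'a)" if "{c, e} = {d, f} \<or> c = d \<and> e = f" for c d e f
    using that by (auto simp: E2_def doubleton_eq_iff)
  show ?thesis unfolding Rzw_def by (simp add: z insert_commute)
qed

lemma Rcoeff_parity: "M \<noteq> N \<Longrightarrow> odd (par M i + par M j + par M x + par M y) \<Longrightarrow> Rcoeff M N n [i, j] [x, y] = 0"
  by (simp add: Rcoeff_eq(1) Rzw_parity)

lemma tmul_cong:
  assumes "\<And>I J. I \<in> idx M N k \<Longrightarrow> J \<in> idx M N k \<Longrightarrow> X I J = X' I J"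
    "\<And>I J. I \<in> idx M N k \<Longrightarrow> J \<in> idx M N k \<Longrightarrow> Y I J = Y' I J" "I \<in> idx M N k" "K \<in> idx M N k"
  shows "tmul M N k s X Y I K = tmul M N k s X' Y' I K"
  unfolding tmul_def using assms by (intro sum.cong refl) simp

lemma mem_idx_2: "I \<in> idx M N 2 \<longleftrightarrow> (\<exists>i j. i \<in> {1..M+N} \<and> j \<in> {1..M+N} \<and> I = [i, j])"
  by (auto simp: idx_def numeral_2_eq_2 length_Suc_conv)

lemma entry_linop_rll:
  assumes r: "\<And>i j x y. odd (par M i + par M j + par M x + par M y) \<Longrightarrow> r i j x y = 0"
    and "i \<in> {1..M+N}" "j \<in> {1..M+N}" "z \<in> {1..M+N}" "w \<in> {1..M+N}"
  shows "entry (two_site M N 2 0 r * one_site M N 2 0 l * one_site M N 2 (Suc 0) l'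
      - one_site M N 2 (Suc 0) l' * one_site M N 2 0 l * two_site M N 2 0 r) [i, j] [z, w] = rll_comp M N r l l' i j z w"
proof -
  have I: "[i, j] \<in> idx M N 2" using assms by (simp add: mem_idx_2)
  have "entry (two_site M N 2 0 r * one_site M N 2 0 l * one_site M N 2 (Suc 0) l'
      - one_site M N 2 (Suc 0) l' * one_site M N 2 0 l * two_site M N 2 0 r) [i, j] [z, w] =
    (\<Sum>a\<in>{1..M+N}. \<Sum>b\<in>{1..M+N}. rll_comp M N r l l' i j a b * unitvec [z, w] [a, b])"
    unfolding entry_def by (subst linop_rll[OF _ I r]) (simp_all add: tail_parity_def)
  also have "\<dots> = (\<Sum>a\<in>{1..M+N}. \<Sum>b\<in>{1..M+N}. if b = w then if a = z then rll_comp M N r l l' i j z w else 0 else 0)"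
    by (intro sum.cong refl) (auto simp: unitvec_def)
  also have "\<dots> = rll_comp M N r l l' i j z w" using assms by simp
  finally show ?thesis .
qed

text \<open>One summand of the defining relation, translated from graded products into operators.\<close>
lemma rll_term:
  assumes MN: "M \<noteq> N" and "i \<in> {1..M+N}" "j \<in> {1..M+N}" "z \<in> {1..M+N}" "w \<in> {1..M+N}"
  shows "tmul M N 2 (grinv M) (tmul M N 2 (grinv M) (tmap scal (Rcoeff M N d)) (place 2 [1] (Lcoeff s m))) (place 2 [2] (Lcoeff s n)) [i, j] [z, w]
    - tmul M N 2 (grinv M) (tmul M N 2 (grinv M) (place 2 [2] (Lcoeff s n)) (place 2 [1] (Lcoeff s m))) (tmap scal (Rcoeff M N d)) [i, j] [z, w] =
    (- 1) ^ twist M 2 [i, j] [z, w] * rll_comp M N (R_entry M (Rcoeff M N d)) (L_entry s m) (L_entry s n) i j z w"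
proof -
  let ?mul = "tmul M N 2 (grinv M)"
  let ?R = "place 2 [1, 2] (tmap scal (Rcoeff M N d))"
  let ?L1 = "place 2 [1] (Lcoeff s m)" and ?L2 = "place 2 [2] (Lcoeff s n)"
  have R: "tmap scal (Rcoeff M N d) I J = ?R I J" if IJ': "I \<in> idx M N 2" "J \<in> idx M N 2" for I J
  proof -
    obtain a b c e where IJ: "I = [a, b]" "J = [c, e]" using IJ' by (auto simp: mem_idx_2)
    have "{1..2} - set [1, 2] = ({} :: nat set)" by auto
    thus ?thesis by (simp add: IJ place_def)
  qed
  have Iin: "[i, j] \<in> idx M N 2" "[z, w] \<in> idx M N 2" using assms by (simp_all add: mem_idx_2)
  have Lpar: "grinv M (Lcoeff s e [i] [j]) = (- 1) ^ (par M i + par M j) * Lcoeff s e [i] [j]" for e i j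
    by (simp add: Lcoeff_def grinv_gen)
  have evL1: "even_tens M N 2 (grinv M) ?L1"
    using even_tens_place_L[where p = 0 and k = 2, of "grinv M" "Lcoeff s m" M N] Lpar by simp
  have evL2: "even_tens M N 2 (grinv M) ?L2"
    using even_tens_place_L[where p = "Suc 0" and k = 2, of "grinv M" "Lcoeff s n" M N] Lpar by (simp add: numeral_2_eq_2)
  have evR: "even_tens M N 2 (grinv M) ?R"
  proof -
    have "grinv M (tmap scal (Rcoeff M N d) [a, b] [c, e]) =
        (- 1) ^ (par M a + par M c + (par M b + par M e)) * tmap scal (Rcoeff M N d) [a, b] [c, e]" for a b c e
    proof (cases "odd (par M a + par M b + par M c + par M e)")
      case True thus ?thesis by (simp add: tmap_def Rcoeff_parity[OF MN])
    next
      case False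
      hence "even (par M a + par M c + (par M b + par M e))" by auto
      thus ?thesis by (simp add: tmap_def minus_one_power_iff)
    qed
    from even_tens_place2[OF this, of 0 2] show ?thesis by (simp add: numeral_2_eq_2)
  qed
  have o1: "tens_op M N 2 ?L1 = one_site M N 2 0 (L_entry s m)"
    using tens_op_place1[of 0 2 M N "Lcoeff s m"] by (simp add: L_entry_def[abs_def])
  have o2: "tens_op M N 2 ?L2 = one_site M N 2 (Suc 0) (L_entry s n)"
    using tens_op_place1[of "Suc 0" 2 M N "Lcoeff s n"] by (simp add: L_entry_def[abs_def] numeral_2_eq_2)
  have oR: "tens_op M N 2 ?R = two_site M N 2 0 (R_entry M (Rcoeff M N d))"
  proof -
    have "tens_op M N 2 (place 2 [Suc 0, Suc (Suc 0)] (tmap scal (Rcoeff M N d))) =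
      two_site M N 2 0 (\<lambda>i j x y. (- 1) ^ ((par M i + par M x) * (par M x + par M y) + (par M j + par M y) * par M y) *
        tmap scal (Rcoeff M N d) [i, j] [x, y])"
    proof (rule tens_op_place2)
      fix i j x y assume "odd (par M i + par M x + par M j + par M y)"
      hence "Rcoeff M N d [i, j] [x, y] = 0" by (intro Rcoeff_parity[OF MN]) auto
      thus "tmap scal (Rcoeff M N d) [i, j] [x, y] = 0" by (simp add: tmap_def)
    qed simp
    thus ?thesis by (simp add: R_entry_def[abs_def] scal_sign twist2_def tmap_def numeral_2_eq_2)
  qed
  have e: "Z [i, j] [z, w] = (- 1) ^ twist M 2 [i, j] [z, w] * entry (tens_op M N 2 Z) [i, j] [z, w]" for Z :: "falg tens"
    unfolding entry_tens_op[OF Iin] by (simp add: minus_one_power_iff)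
  have c1: "?mul (?mul (tmap scal (Rcoeff M N d)) ?L1) ?L2 [i, j] [z, w] = ?mul (?mul ?R ?L1) ?L2 [i, j] [z, w]"
    by (intro tmul_cong[OF tmul_cong] Iin R refl)
  have c2: "?mul (?mul ?L2 ?L1) (tmap scal (Rcoeff M N d)) [i, j] [z, w] = ?mul (?mul ?L2 ?L1) ?R [i, j] [z, w]"
    by (intro tmul_cong Iin R refl)
  have rp: "odd (par M i + par M j + par M x + par M y) \<Longrightarrow> R_entry M (Rcoeff M N d) i j x y = 0" for i j x y
    by (simp add: R_entry_def Rcoeff_parity[OF MN])
  have "entry (tens_op M N 2 (?mul (?mul ?R ?L1) ?L2)) [i, j] [z, w] - entry (tens_op M N 2 (?mul (?mul ?L2 ?L1) ?R)) [i, j] [z, w] =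
    entry (two_site M N 2 0 (R_entry M (Rcoeff M N d)) * one_site M N 2 0 (L_entry s m) * one_site M N 2 (Suc 0) (L_entry s n)
      - one_site M N 2 (Suc 0) (L_entry s n) * one_site M N 2 0 (L_entry s m) * two_site M N 2 0 (R_entry M (Rcoeff M N d))) [i, j] [z, w]"
    unfolding tens_op_tmul[OF evL2 grinv_uminus] tens_op_tmul[OF evL1 grinv_uminus]
      tens_op_tmul[OF evR grinv_uminus] o1 o2 oR by (simp add: entry_def)
  also have "\<dots> = rll_comp M N (R_entry M (Rcoeff M N d)) (L_entry s m) (L_entry s n) i j z w"
    using assms by (intro entry_linop_rll rp)
  finally show ?thesis unfolding c1 c2 e[of "?mul (?mul ?R ?L1) ?L2"] e[of "?mul (?mul ?L2 ?L1) ?R"]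
    by (simp add: right_diff_distrib[symmetric])
qed

lemma rll_comp_ideal:
  assumes MN: "M \<noteq> N" and "i \<in> {1..M+N}" "j \<in> {1..M+N}" "z \<in> {1..M+N}" "w \<in> {1..M+N}"
  shows "(\<Sum>d\<le>nat (\<bar>m\<bar> + \<bar>n\<bar>). rll_comp M N (R_entry M (Rcoeff M N d)) (L_entry s (m + int d)) (L_entry s (n - int d)) i j z w) \<in> uq_ideal M N"
proof -
  have "rll M N s s 1 1 m n [i, j] [z, w] \<in> uq_relators M N"
  proof -
    have "[i, j] \<in> idx M N 2" "[z, w] \<in> idx M N 2" using assms by (simp_all add: mem_idx_2)
    hence "rll M N s s 1 1 m n [i, j] [z, w] \<in>
      {rll M N s s 1 1 m n I J | s m n I J. I \<in> idx M N 2 \<and> J \<in> idx M N 2}" by blast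
    thus ?thesis unfolding uq_relators_def by (simp only: Un_iff simp_thms)
  qed
  hence "rll M N s s 1 1 m n [i, j] [z, w] \<in> uq_ideal M N"
    unfolding uq_ideal_def using ring.genideal_self[OF free_alg_ring uq_relators_carrier] by blast
  hence "(- 1) ^ twist M 2 [i, j] [z, w] * (\<Sum>d\<le>nat (\<bar>m\<bar> + \<bar>n\<bar>). rll_comp M N (R_entry M (Rcoeff M N d)) (L_entry s (m + int d)) (L_entry s (n - int d)) i j z w) \<in> uq_ideal M N"
    unfolding rll_def Let_def power_one mult_1 rll_term[OF assms] sum_distrib_left .
  from uq_ideal_sign[OF this, of "twist M 2 [i, j] [z, w]"] show ?thesis
    by (simp add: mult.assoc[symmetric] power_add[symmetric] minus_one_power_iff split: if_splits)
qed

lemma rll_comp_add: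
  "rll_comp M N (\<lambda>i j x y. r i j x y + r' i j x y) l l' i j z w = rll_comp M N r l l' i j z w + rll_comp M N r' l l' i j z w"
  unfolding rll_comp_def sum.distrib[symmetric]
  by (intro sum.cong refl) (simp add: distrib_left distrib_right)

lemma rll_comp_scal_r:
  fixes l l' :: "nat \<Rightarrow> nat \<Rightarrow> falg"
  shows "rll_comp M N (\<lambda>i j x y. scal a * r i j x y) l l' i j z w = scal a * rll_comp M N r l l' i j z w"
  unfolding rll_comp_def sum_distrib_left
  by (intro sum.cong refl) (simp add: right_diff_distrib mult.assoc scal_left)

lemma rll_comp_scal_l:
  fixes l l' :: "nat \<Rightarrow> nat \<Rightarrow> falg"
  shows "rll_comp M N r (\<lambda>i j. scal a * l i j) l' i j z w = scal a * rll_comp M N r l l' i j z w"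
  unfolding rll_comp_def sum_distrib_left
  by (intro sum.cong refl) (simp add: right_diff_distrib mult.assoc scal_left)

lemma rll_comp_scal_l':
  fixes l l' :: "nat \<Rightarrow> nat \<Rightarrow> falg"
  shows "rll_comp M N r l (\<lambda>i j. scal a * l' i j) i j z w = scal a * rll_comp M N r l l' i j z w"
  unfolding rll_comp_def sum_distrib_left
  by (intro sum.cong refl) (simp add: right_diff_distrib mult.assoc scal_left)

definition rll_coeff :: "nat \<Rightarrow> nat \<Rightarrow> pm \<Rightarrow> nat \<Rightarrow> nat \<Rightarrow> nat \<Rightarrow> nat \<Rightarrow> cq tens \<Rightarrow> int \<Rightarrow> int \<Rightarrow> falg" where
  "rll_coeff M N s i j z w X m n = rll_comp M N (R_entry M X) (L_entry s m) (L_entry s n) i j z w"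

lemma rll_coeff_linear: "rll_coeff M N s i j z w (\<lambda>I J. a * X I J + b * Y I J) m n =
    scal a * rll_coeff M N s i j z w X m n + scal b * rll_coeff M N s i j z w Y m n"
proof -
  have "R_entry M (\<lambda>I J. a * X I J + b * Y I J) = (\<lambda>i j x y. scal a * R_entry M X i j x y + scal b * R_entry M Y i j x y)"
    by (simp add: R_entry_def fun_eq_iff scal_mult[symmetric] scal_add[symmetric] algebra_simps)
  thus ?thesis by (simp add: rll_coeff_def rll_comp_add rll_comp_scal_r)
qed

lemma rll_coeff_zero: "zdir s * m < 0 \<or> zdir s * n < 0 \<Longrightarrow> rll_coeff M N s i j z w X m n = 0"
  by (auto simp: rll_coeff_def rll_comp_def L_entry_def Lcoeff_def)

text \<open>The coefficient of \<open>z\<^sup>m w\<^sup>n\<close> in the RLL relation with \<open>R(1, w/z) = R(1,0) + (w/z) R(0,1)\<close>.\<close>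
definition poly_rll :: "nat \<Rightarrow> nat \<Rightarrow> pm \<Rightarrow> nat \<Rightarrow> nat \<Rightarrow> nat \<Rightarrow> nat \<Rightarrow> int \<Rightarrow> int \<Rightarrow> falg" where
  "poly_rll M N s i j z w m n = rll_coeff M N s i j z w (Rzw M N qq 1 0) m n + rll_coeff M N s i j z w (Rzw M N qq 0 1) (m + 1) (n - 1)"

text \<open>
  The defining relation is the one with \<open>R(1, w/z)\<close> multiplied by the series \<open>R_prefactor\<close> in
  \<open>w/z\<close>.
\<close>
lemma sum_poly_rll_ideal:
  assumes MN: "M \<noteq> N" and "i \<in> {1..M+N}" "j \<in> {1..M+N}" "z \<in> {1..M+N}" "w \<in> {1..M+N}"
  shows "(\<Sum>d\<le>nat (\<bar>m\<bar> + \<bar>n\<bar>). scal (fps_nth (R_prefactor M N) d) * poly_rll M N s i j z w (m + int d) (n - int d)) \<in> uq_ideal M N"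
proof -
  define D where "D = nat (\<bar>m\<bar> + \<bar>n\<bar>)"
  define u where "u = fps_nth (R_prefactor M N)"
  let ?f = "rll_coeff M N s i j z w (Rzw M N qq 1 0)" and ?g = "rll_coeff M N s i j z w (Rzw M N qq 0 1)"
  have "Rcoeff M N d = (\<lambda>I J. u d * Rzw M N qq 1 0 I J + (if d = 0 then 0 else u (d - 1)) * Rzw M N qq 0 1 I J)" for d
    by (auto simp: fun_eq_iff Rcoeff_eq(1)[OF MN] u_def)
  hence R: "rll_comp M N (R_entry M (Rcoeff M N d)) (L_entry s m) (L_entry s n) i j z w =
     scal (u d) * ?f m n + scal (if d = 0 then 0 else u (d - 1)) * ?g m n" for d m n
    using rll_coeff_linear[of M N s i j z w "u d" "Rzw M N qq 1 0" "if d = 0 then 0 else u (d - 1)" "Rzw M N qq 0 1" m n]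
    by (simp only: rll_coeff_def)
  have "(\<Sum>d\<le>D. rll_comp M N (R_entry M (Rcoeff M N d)) (L_entry s (m + int d)) (L_entry s (n - int d)) i j z w) =
    (\<Sum>d\<le>D. scal (u d) * ?f (m + int d) (n - int d)) +
    (\<Sum>d\<le>D. scal (if d = 0 then 0 else u (d - 1)) * ?g (m + int d) (n - int d))"
    unfolding R sum.distrib ..
  also have "(\<Sum>d\<le>D. scal (if d = 0 then 0 else u (d - 1)) * ?g (m + int d) (n - int d)) =
    (\<Sum>d<D. scal (u d) * ?g (m + int d + 1) (n - int d - 1))"
    by (subst sum.atMost_shift) (simp add: algebra_simps)
  also have "\<dots> = (\<Sum>d\<le>D. scal (u d) * ?g (m + int d + 1) (n - int d - 1))"
  \<comment> \<open>The shift leaves out the last term, which lies beyond the range of the series.\<close>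
  proof -
    have "?g (m + int D + 1) (n - int D - 1) = 0"
      by (rule rll_coeff_zero) (cases s, auto simp: D_def)
    thus ?thesis by (simp add: lessThan_Suc_atMost[symmetric])
  qed
  also have "(\<Sum>d\<le>D. scal (u d) * ?f (m + int d) (n - int d)) + \<dots> =
     (\<Sum>d\<le>D. scal (u d) * poly_rll M N s i j z w (m + int d) (n - int d))"
    by (simp add: poly_rll_def sum.distrib distrib_left)
  finally show ?thesis using rll_comp_ideal[OF assms, where m = m and n = n and s = s] by (simp add: D_def u_def)
qed

text \<open>
  The scalar series is invertible, so it can be removed. On coefficients this is an induction:
  the relation expresses the coefficient at \<open>(m, n)\<close> by those at \<open>(m+d, n-d)\<close> with \<open>d > 0\<close>, and
  these vanish for large \<open>d\<close> because \<open>L\<close> is a series in one direction.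
\<close>
lemma poly_rll_ideal:
  assumes MN: "M \<noteq> N" and "i \<in> {1..M+N}" "j \<in> {1..M+N}" "z \<in> {1..M+N}" "w \<in> {1..M+N}"
  shows "poly_rll M N s i j z w m n \<in> uq_ideal M N"
proof -
  \<comment> \<open>The number of steps \<open>(m, n) \<mapsto> (m+1, n-1)\<close> after which the coefficients certainly vanish.\<close>
  define b where "b = (\<lambda>m n. case s of Plus \<Rightarrow> nat (1 - m) | Minus \<Rightarrow> nat (n + 1))"
  show ?thesis
  proof (induction "b m n" arbitrary: m n rule: less_induct)
    case less
    show ?case
    proof (cases "b m n = 0")
      case True
      hence "poly_rll M N s i j z w m n = 0" unfolding poly_rll_def
        by (cases s) (auto simp: b_def rll_coeff_zero)
      thus ?thesis by (simp add: uq_ideal_0)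
    next
      case False
      let ?u = "fps_nth (R_prefactor M N)"
      define D where "D = nat (\<bar>m\<bar> + \<bar>n\<bar>)"
      have "(\<Sum>d\<in>{1..D}. scal (?u d) * poly_rll M N s i j z w (m + int d) (n - int d)) \<in> uq_ideal M N"
      proof (intro uq_ideal_sum uq_ideal_scal less)
        fix d assume "d \<in> {1..D}"
        thus "b (m + int d) (n - int d) < b m n" using False by (cases s) (auto simp: b_def)
      qed
      moreover have "(\<Sum>d\<le>D. scal (?u d) * poly_rll M N s i j z w (m + int d) (n - int d)) =
        scal (?u 0) * poly_rll M N s i j z w m n + (\<Sum>d\<in>{1..D}. scal (?u d) * poly_rll M N s i j z w (m + int d) (n - int d))"
      proof -
        have "{..D} = insert 0 {1..D}" by auto
        thus ?thesis by simp
      qed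
      ultimately have "scal (?u 0) * poly_rll M N s i j z w m n \<in> uq_ideal M N"
        using uq_ideal_diff[OF sum_poly_rll_ideal[OF assms, where m = m and n = n and s = s]] unfolding D_def[symmetric] by fastforce
      thus ?thesis using uq_ideal_scal_iff Rcoeff_eq(2)[OF MN] by blast
    qed
  qed
qed

text \<open>
  The coefficients of the RLL relation at \<open>w = z q\<^sup>2\<close>. Each one is a finite sum of the
  coefficients of \<open>z\<^sup>m w\<^sup>n\<close> with \<open>m + n\<close> fixed, weighted by \<open>q\<^bsup>2n\<^esup>\<close>.
\<close>
lemma fused_ideal:
  assumes MN: "M \<noteq> N" and "i \<in> {1..M+N}" "j \<in> {1..M+N}" "z \<in> {1..M+N}" "w \<in> {1..M+N}"
  shows "(\<Sum>a\<le>p. scal (qq powi (2 * zdir s * int (p - a))) *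
     rll_coeff M N s i j z w (Rzw M N qq 1 (qq ^ 2)) (zdir s * int a) (zdir s * int (p - a))) \<in> uq_ideal M N"
proof -
  let ?f = "rll_coeff M N s i j z w (Rzw M N qq 1 0)" and ?g = "rll_coeff M N s i j z w (Rzw M N qq 0 1)"
  have R: "Rzw M N qq 1 (qq ^ 2) = (\<lambda>I J. 1 * Rzw M N qq 1 0 I J + qq ^ 2 * Rzw M N qq 0 1 I J)"
    using Rzw_linear[of M N qq 1 "qq ^ 2"] by (simp add: fun_eq_iff)
  define F where "F m n = scal (qq powi (2 * n)) * ?f m n" for m n
  define G where "G m n = scal (qq powi (2 * (n + 1))) * ?g m n" for m n
  have q2: "scal (qq powi (2 * n)) * (scal (qq ^ 2) * x) = scal (qq powi (2 * (n + 1))) * x" for n x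
    by (simp add: mult.assoc[symmetric] scal_mult[symmetric] power_int_add distrib_left)
  have "scal (qq powi (2 * zdir s * int (p - a))) *
      rll_coeff M N s i j z w (Rzw M N qq 1 (qq ^ 2)) (zdir s * int a) (zdir s * int (p - a)) =
    F (zdir s * int a) (zdir s * int (p - a)) + G (zdir s * int a) (zdir s * int (p - a))" for a
    unfolding R rll_coeff_linear F_def G_def by (simp add: distrib_left q2 mult.assoc)
  hence "(\<Sum>a\<le>p. scal (qq powi (2 * zdir s * int (p - a))) *
     rll_coeff M N s i j z w (Rzw M N qq 1 (qq ^ 2)) (zdir s * int a) (zdir s * int (p - a))) =
     (\<Sum>a\<le>p. F (zdir s * int a) (zdir s * int (p - a))) + (\<Sum>a\<le>p. G (zdir s * int a) (zdir s * int (p - a)))"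
    by (simp only: sum.distrib)
  \<comment> \<open>There is one more pair \<open>(m, n)\<close> than there are products \<open>L\<^sub>1 L\<^sub>2\<close> in this degree: multiplication
    by \<open>w/z\<close> shifts the pairs of exponents by one.\<close>
  also have "\<dots> = (\<Sum>a\<le>Suc p. scal (qq powi (2 * (case s of Plus \<Rightarrow> int a - int p | Minus \<Rightarrow> int p + 1 - int a))) *
     poly_rll M N s i j z w (case s of Plus \<Rightarrow> - int a | Minus \<Rightarrow> int a - 1)
      (case s of Plus \<Rightarrow> int a - int p | Minus \<Rightarrow> int p + 1 - int a))"
  proof (cases s)
    case Plus
    have t: "scal (qq powi (2 * (int a - int p))) * poly_rll M N s i j z w (- int a) (int a - int p) =
      F (- int a) (int a - int p) + G (1 - int a) (int a - int p - 1)" for a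
      by (simp add: F_def G_def poly_rll_def distrib_left)
    have z: "F (- int (Suc p)) (int (Suc p) - int p) = 0" "G (1 - int 0) (int 0 - int p - 1) = 0"
      unfolding F_def G_def using Plus by (simp_all add: rll_coeff_zero)
    have "(\<Sum>a\<le>p. F (- int a) (- int (p - a))) = (\<Sum>a\<le>p. F (- int a) (int a - int p))"
      by (rule sum.cong) (auto simp: of_nat_diff)
    moreover have "\<dots> = (\<Sum>a\<le>Suc p. F (- int a) (int a - int p))" using z(1) by simp
    moreover have "(\<Sum>a\<le>p. G (- int a) (- int (p - a))) = (\<Sum>a\<le>p. G (1 - int (Suc a)) (int (Suc a) - int p - 1))"
      by (rule sum.cong) (auto simp: of_nat_diff)
    moreover have "\<dots> = (\<Sum>a\<le>Suc p. G (1 - int a) (int a - int p - 1))"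
      by (subst sum.atMost_Suc_shift) (simp only: z(2) add_0)
    ultimately show ?thesis unfolding Plus pm.case t[unfolded Plus] by (simp only: zdir.simps mult_minus1 sum.distrib)
  next
    case Minus
    have t: "scal (qq powi (2 * (int p + 1 - int a))) * poly_rll M N s i j z w (int a - 1) (int p + 1 - int a) =
      F (int a - 1) (int p + 1 - int a) + G (int a) (int p - int a)" for a
      by (simp add: F_def G_def poly_rll_def distrib_left algebra_simps)
    have z: "G (int (Suc p)) (int p - int (Suc p)) = 0" "F (int 0 - 1) (int p + 1 - int 0) = 0"
      unfolding F_def G_def using Minus by (simp_all add: rll_coeff_zero)
    have "(\<Sum>a\<le>p. G (int a) (int (p - a))) = (\<Sum>a\<le>p. G (int a) (int p - int a))"
      by (rule sum.cong) (auto simp: of_nat_diff)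
    moreover have "\<dots> = (\<Sum>a\<le>Suc p. G (int a) (int p - int a))" using z(1) by simp
    moreover have "(\<Sum>a\<le>p. F (int a) (int (p - a))) = (\<Sum>a\<le>p. F (int (Suc a) - 1) (int p + 1 - int (Suc a)))"
      by (rule sum.cong) (auto simp: of_nat_diff)
    moreover have "\<dots> = (\<Sum>a\<le>Suc p. F (int a - 1) (int p + 1 - int a))"
      by (subst sum.atMost_Suc_shift) (simp only: z(2) add_0)
    ultimately show ?thesis unfolding Minus pm.case t[unfolded Minus] by (simp only: zdir.simps mult_1 sum.distrib)
  qed
  also have "\<dots> \<in> uq_ideal M N" by (intro uq_ideal_sum uq_ideal_scal poly_rll_ideal assms)
  finally show ?thesis .
qed

lemma fps_nth_sign: "fps_nth ((- 1) ^ n * f) p = (- 1) ^ n * (fps_nth f p :: 'a::ring_1)"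
  by (simp add: minus_one_power_iff)

lemma fps_nth_rll_comp:
  fixes r :: "nat \<Rightarrow> nat \<Rightarrow> nat \<Rightarrow> nat \<Rightarrow> falg"
  shows "fps_nth (rll_comp M N (\<lambda>i j x y. fps_const (r i j x y)) l l' i j z w) p =
    (\<Sum>a\<le>p. rll_comp M N r (\<lambda>x y. fps_nth (l x y) a) (\<lambda>x y. fps_nth (l' x y) (p - a)) i j z w)"
proof -
  have 1: "fps_nth (fps_const c * (f * g)) p = (\<Sum>a\<le>p. c * (fps_nth f a * fps_nth g (p - a)))"
    for c :: falg and f g
    by (simp only: fps_mult_left_const_nth fps_mult_nth[of f] sum_distrib_left atLeast0AtMost)
  have 2: "fps_nth (g * (f * fps_const c)) p = (\<Sum>a\<le>p. fps_nth g (p - a) * (fps_nth f a * c))"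
    for c :: falg and f g
    unfolding fps_mult_nth[of g] atLeast0AtMost fps_mult_right_const_nth
    by (rule sum.reindex_bij_witness[of _ "\<lambda>a. p - a" "\<lambda>a. p - a"]) auto
  have "fps_nth (rll_comp M N (\<lambda>i j x y. fps_const (r i j x y)) l l' i j z w) p =
    (\<Sum>x\<in>{1..M+N}. \<Sum>y\<in>{1..M+N}. \<Sum>a\<le>p.
      (- 1) ^ ((par M x + par M z) * (par M z + par M y) + (par M y + par M w) * par M w) *
          (r i j x y * (fps_nth (l x z) a * fps_nth (l' y w) (p - a)))
        - (- 1) ^ ((par M j + par M y) * par M y + (par M i + par M x) * (par M x + par M y)) *
          (fps_nth (l' j y) (p - a) * (fps_nth (l i x) a * r x y z w)))"
    unfolding rll_comp_def
    by (simp only: fps_sum_nth fps_sub_nth fps_nth_sign 1 2 sum_distrib_left sum_subtractf)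
  also have "\<dots> = (\<Sum>x\<in>{1..M+N}. \<Sum>a\<le>p. \<Sum>y\<in>{1..M+N}.
      (- 1) ^ ((par M x + par M z) * (par M z + par M y) + (par M y + par M w) * par M w) *
          (r i j x y * (fps_nth (l x z) a * fps_nth (l' y w) (p - a)))
        - (- 1) ^ ((par M j + par M y) * par M y + (par M i + par M x) * (par M x + par M y)) *
          (fps_nth (l' j y) (p - a) * (fps_nth (l i x) a * r x y z w)))"
    by (intro sum.cong refl sum.swap)
  also have "\<dots> = (\<Sum>a\<le>p. rll_comp M N r (\<lambda>x y. fps_nth (l x y) a) (\<lambda>x y. fps_nth (l' x y) (p - a)) i j z w)"
    unfolding rll_comp_def by (rule sum.swap)
  finally show ?thesis .
qed

text \<open>
  Rescaling \<open>z\<close> by \<open>c\<close> multiplies the coefficients of degree \<open>p\<close> by a power of \<open>c\<close>, so the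
  relation at \<open>w = z q\<^sup>2\<close> holds at \<open>zc\<close> and \<open>zcq\<^sup>2\<close>.
\<close>
lemma Lser_rll:
  assumes MN: "M \<noteq> N" and "i \<in> {1..M+N}" "j \<in> {1..M+N}" "z \<in> {1..M+N}" "w \<in> {1..M+N}" and c: "c \<noteq> 0"
  shows "fps_nth (rll_comp M N (\<lambda>i j x y. scalar ((- 1) ^ twist2 M i j x y * Rzw M N qq 1 (qq ^ 2) [i, j] [x, y]))
     (\<lambda>x y. Lser s c [x] [y]) (\<lambda>x y. Lser s (c * qq ^ 2) [x] [y]) i j z w) p \<in> uq_ideal M N"
proof -
  have L: "(\<lambda>x y. fps_nth (Lser s d [x] [y]) a) = (\<lambda>x y. scal (d powi (zdir s * int a)) * L_entry s (zdir s * int a) x y)" for d a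
    by (cases s) (auto simp: fun_eq_iff Lser_def L_entry_def Lcoeff_def)
  have sc: "scal (c powi (zdir s * int a)) * (scal ((c * qq ^ 2) powi (zdir s * int (p - a))) * x) =
    scal (c powi (zdir s * int p)) * (scal (qq powi (2 * zdir s * int (p - a))) * x)" if "a \<le> p" for a x
  proof -
    have "c powi (zdir s * int a) * (c * qq ^ 2) powi (zdir s * int (p - a)) =
      (c powi (zdir s * int a) * c powi (zdir s * int (p - a))) * (qq ^ 2) powi (zdir s * int (p - a))"
      by (simp add: power_int_mult_distrib)
    also have "c powi (zdir s * int a) * c powi (zdir s * int (p - a)) = c powi (zdir s * int p)"
      using c that by (simp add: power_int_add[symmetric] distrib_left[symmetric] of_nat_diff)
    also have "(qq ^ 2) powi (zdir s * int (p - a)) = qq powi (2 * zdir s * int (p - a))"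
      using power_int_mult[of qq 2 "zdir s * int (p - a)"] by (simp add: mult.assoc)
    finally show ?thesis by (simp add: mult.assoc[symmetric] scal_mult[symmetric])
  qed
  have "fps_nth (rll_comp M N (\<lambda>i j x y. scalar ((- 1) ^ twist2 M i j x y * Rzw M N qq 1 (qq ^ 2) [i, j] [x, y]))
     (\<lambda>x y. Lser s c [x] [y]) (\<lambda>x y. Lser s (c * qq ^ 2) [x] [y]) i j z w) p =
    (\<Sum>a\<le>p. scal (c powi (zdir s * int a)) * (scal ((c * qq ^ 2) powi (zdir s * int (p - a))) *
      rll_coeff M N s i j z w (Rzw M N qq 1 (qq ^ 2)) (zdir s * int a) (zdir s * int (p - a))))"
    unfolding scalar_def fps_nth_rll_comp L rll_comp_scal_l rll_comp_scal_l' rll_coeff_def R_entry_def[abs_def] ..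
  also have "\<dots> = (\<Sum>a\<le>p. scal (c powi (zdir s * int p)) * (scal (qq powi (2 * zdir s * int (p - a))) *
      rll_coeff M N s i j z w (Rzw M N qq 1 (qq ^ 2)) (zdir s * int a) (zdir s * int (p - a))))"
    by (intro sum.cong refl sc) simp
  also have "\<dots> \<in> uq_ideal M N"
    unfolding sum_distrib_left[symmetric] by (intro uq_ideal_scal fused_ideal assms)
  finally show ?thesis .
qed

section \<open>The Hecke operators on the tensor space\<close>

lemma scalar_comm': "scalar a * scalar b = scalar b * scalar a" by (simp add: scalar_mult[symmetric] mult.commute)
lemma scalar_lcomm: "scalar a * (scalar b * x) = scalar b * (scalar a * x)"
  by (simp add: mult.assoc[symmetric] scalar_comm')

lift_definition lscale :: "'a::ring_1 \<Rightarrow> ('i, 'a) linop \<Rightarrow> ('i, 'a) linop" is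
  "\<lambda>c f v I. c * f v I"
  by (simp add: fun_eq_iff distrib_left mult.assoc)

lemma app_lscale: "app (lscale c F) v I = c * app F v I"
  by transfer simp

text \<open>
  Scalars are central in the coefficient ring, so multiplying values from the left makes the
  operators an algebra over the base field.
\<close>
definition scale :: "cq \<Rightarrow> (nat list, falg fps) linop \<Rightarrow> (nat list, falg fps) linop" where
  "scale c = lscale (scalar c)"

lemma app_scale [simp]: "app (scale c F) v I = scalar c * app F v I"
  by (simp add: scale_def app_lscale)

lemma app_scalar: "app F (\<lambda>I. scalar c * v I) I = scalar c * app F v I"
  using app_mult_right[of F v "scalar c" I] by (simp add: scalar_comm)

interpretation scaled: scaled_ring scale
proof
  fix x y and a b :: "(nat list, falg fps) linop"
  show "scale x (a + b) = scale x a + scale x b" by (rule linop_eqI) (simp add: distrib_left)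
  show "scale (x + y) a = scale x a + scale y a" by (rule linop_eqI) (simp add: scalar_add distrib_right)
  show "scale x (scale y a) = scale (x * y) a" by (rule linop_eqI) (simp add: scalar_mult mult.assoc)
  show "scale 1 a = a" by (rule linop_eqI) simp
  show "scale x a * b = scale x (a * b)" by (rule linop_eqI) simp
  show "a * scale x b = scale x (a * b)"
  proof (rule linop_eqI)
    fix v I
    have "app (scale x b) v = (\<lambda>J. scalar x * app b v J)" by (simp add: fun_eq_iff)
    thus "app (a * scale x b) v I = app (scale x (a * b)) v I" by (simp add: app_scalar)
  qed
qed

definition swap_at :: "nat \<Rightarrow> nat list \<Rightarrow> nat list" where
  "swap_at p I = I[p := I ! Suc p, Suc p := I ! p]"

text \<open>
  With the signs of \<open>twist\<close>, the operator \<open>P R(1,0)\<close> sends \<open>v\<close> to a function whose value at an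
  index \<open>I\<close> with the entries \<open>x, y\<close> at the two sites is \<open>Rdiag x y * v I + Rswap x y * v I'\<close>,
  where \<open>I'\<close> has \<open>x\<close> and \<open>y\<close> exchanged.
\<close>
definition Rdiag :: "nat \<Rightarrow> nat \<Rightarrow> nat \<Rightarrow> cq" where
  "Rdiag M x y = (if x = y then (- 1) ^ par M x * qi M qq x else if y < x then qq - inverse qq else 0)"

definition Rswap :: "nat \<Rightarrow> nat \<Rightarrow> nat \<Rightarrow> cq" where
  "Rswap M x y = (if x = y then 0 else (- 1) ^ (par M x * par M y))"

lift_definition diag_swap_op :: "'i set \<Rightarrow> ('i \<Rightarrow> 'a) \<Rightarrow> ('i \<Rightarrow> 'a) \<Rightarrow> ('i \<Rightarrow> 'i) \<Rightarrow> 'a \<Rightarrow> ('i, 'a::ring_1) linop" is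
  "\<lambda>B d e s c v I. if I \<in> B then d I * v I + e I * v (s I) else c * v I"
  by (auto simp: fun_eq_iff distrib_left distrib_right mult.assoc)

lemma app_diag_swap_op: "app (diag_swap_op B d e s c) v I = (if I \<in> B then d I * v I + e I * v (s I) else c * v I)"
  by transfer simp

text \<open>
  The operator \<open>P R(1,0)\<close> at the sites \<open>p, p+1\<close> on multi-indices of length \<open>k\<close>. On all other
  index lists it is the multiplication by \<open>q\<close>; this makes the quadratic and the braid relations
  hold with the unit of the ring of all operators.
\<close>
definition T_op :: "nat \<Rightarrow> nat \<Rightarrow> nat \<Rightarrow> nat \<Rightarrow> (nat list, falg fps) linop" where
  "T_op M N k p = diag_swap_op (idx M N k) (\<lambda>I. scalar (Rdiag M (I ! p) (I ! Suc p))) (\<lambda>I. scalar (Rswap M (I ! p) (I ! Suc p))) (swap_at p) (scalar qq)"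

lemma app_T_op: "app (T_op M N k p) v I = (if I \<in> idx M N k
     then scalar (Rdiag M (I ! p) (I ! Suc p)) * v I + scalar (Rswap M (I ! p) (I ! Suc p)) * v (swap_at p I)
     else scalar qq * v I)"
  by (simp add: T_op_def app_diag_swap_op)

lemma Rdiag_same: "Rdiag M x x * Rdiag M x x = 1 + (qq - inverse qq) * Rdiag M x x"
proof (cases "par M x = 0")
  case True
  hence "Rdiag M x x = qq" by (simp add: Rdiag_def qi_def)
  thus ?thesis by (simp add: algebra_simps)
next
  case False
  hence "par M x = 1" by (auto simp: par_def split: if_splits)
  hence "Rdiag M x x = - inverse qq" by (simp add: Rdiag_def qi_def power_int_minus)
  thus ?thesis by (simp add: algebra_simps)
qed

lemma Rswap_sym: "Rswap M x y = Rswap M y x" by (simp add: Rswap_def mult.commute)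

lemma Rswap_sq: "Rswap M x y * Rswap M x y = (if x = y then 0 else 1)"
  by (simp add: Rswap_def power_mult_distrib[symmetric] flip: power_add mult_2)

text \<open>The quadratic relation, read off at \<open>I\<close> and at the exchanged index.\<close>
lemma Rdiag_quad:
  "Rdiag M x y * Rdiag M x y + Rswap M x y * Rswap M x y = 1 + (qq - inverse qq) * Rdiag M x y"
  "Rswap M x y * (Rdiag M x y + Rdiag M y x) = (qq - inverse qq) * Rswap M x y"
  unfolding Rswap_sq using Rdiag_same[of M x]
  by (cases x y rule: linorder_cases; simp add: Rdiag_def Rswap_def algebra_simps)+

text \<open>
  The braid relation compares the coefficients at the six permutations of \<open>x, y, z\<close>. Three of
  the comparisons are trivial; these are the other ones.
\<close>
lemma Rdiag_braid:
  "Rdiag M x y * Rdiag M x y * Rdiag M y z + Rswap M x y * Rswap M x y * Rdiag M x z =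
   Rdiag M x y * Rdiag M y z * Rdiag M y z + Rswap M y z * Rswap M y z * Rdiag M x z"
  "Rswap M x y * (Rdiag M x y * Rdiag M y z + Rdiag M x z * Rdiag M y x) = Rswap M x y * (Rdiag M y z * Rdiag M x z)"
  "Rswap M y z * (Rdiag M x y * Rdiag M x z) = Rswap M y z * (Rdiag M y z * Rdiag M x y + Rdiag M x z * Rdiag M z y)"
proof -
  define D where "D x = Rdiag M x x" for x
  define \<delta> where "\<delta> = qq - inverse qq"
  have D: "D x * D x = 1 + \<delta> * D x" for x unfolding D_def \<delta>_def by (rule Rdiag_same)
  have d: "Rdiag M x y = (if x = y then D x else if y < x then \<delta> else 0)" for x y
    by (simp add: D_def \<delta>_def Rdiag_def)
  have D': "D x * (D x * w) = w + \<delta> * D x * w" for x w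
    using D[of x] by (simp add: mult.assoc[symmetric] distrib_right)
  show "Rdiag M x y * Rdiag M x y * Rdiag M y z + Rswap M x y * Rswap M x y * Rdiag M x z =
   Rdiag M x y * Rdiag M y z * Rdiag M y z + Rswap M y z * Rswap M y z * Rdiag M x z"
    unfolding Rswap_sq d using D[of x] D'[of x] D[of y] D'[of y]
    by (cases x y rule: linorder_cases; cases y z rule: linorder_cases; cases x z rule: linorder_cases;
        simp add: algebra_simps)
  have oz: "Rswap M x x = 0" for x by (simp add: Rswap_def)
  show "Rswap M x y * (Rdiag M x y * Rdiag M y z + Rdiag M x z * Rdiag M y x) = Rswap M x y * (Rdiag M y z * Rdiag M x z)"
    unfolding d
    by (cases x y rule: linorder_cases; cases y z rule: linorder_cases; cases x z rule: linorder_cases;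
        simp add: oz)
  show "Rswap M y z * (Rdiag M x y * Rdiag M x z) = Rswap M y z * (Rdiag M y z * Rdiag M x y + Rdiag M x z * Rdiag M z y)"
    unfolding d
    by (cases x y rule: linorder_cases; cases y z rule: linorder_cases; cases x z rule: linorder_cases;
        simp add: oz)
qed

lemma swap_at_idx: "I \<in> idx M N k \<Longrightarrow> Suc p < k \<Longrightarrow> swap_at p I \<in> idx M N k"
  unfolding swap_at_def by (intro idx_update idx_nth[where k = k]) auto

lemma swap_at_nth: "Suc p < length I \<Longrightarrow> swap_at p I ! p = I ! Suc p" "Suc p < length I \<Longrightarrow> swap_at p I ! Suc p = I ! p"
  "c \<noteq> p \<Longrightarrow> c \<noteq> Suc p \<Longrightarrow> swap_at p I ! c = I ! c"
  by (simp_all add: swap_at_def)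

lemma swap_at_swap_at: "Suc p < length I \<Longrightarrow> swap_at p (swap_at p I) = I"
  by (rule nth_equalityI) (auto simp: swap_at_def nth_list_update)

lemma T_op_square:
  assumes "Suc p < k"
  shows "T_op M N k p * T_op M N k p = 1 + scale (qq - inverse qq) (T_op M N k p)"
proof (rule linop_eqI)
  fix v I
  show "app (T_op M N k p * T_op M N k p) v I = app (1 + scale (qq - inverse qq) (T_op M N k p)) v I"
  proof (cases "I \<in> idx M N k")
    case True
    have len: "length I = k" using True by (rule idx_length)
    define x y where "x = I ! p" and "y = I ! Suc p"
    have "app (T_op M N k p * T_op M N k p) v I =
        scalar (Rdiag M x y * Rdiag M x y + Rswap M x y * Rswap M x y) * v I + scalar (Rswap M x y * (Rdiag M x y + Rdiag M y x)) * v (swap_at p I)"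
      using True swap_at_idx[OF True assms] assms len swap_at_nth(1,2)[of p I] swap_at_swap_at[of p I]
      by (simp add: app_T_op x_def[symmetric] y_def[symmetric] scalar_add scalar_mult distrib_left distrib_right mult.assoc
          Rswap_sym[of M y x] scalar_lcomm add_ac)
    also have "\<dots> = app (1 + scale (qq - inverse qq) (T_op M N k p)) v I"
      unfolding Rdiag_quad using True
      by (simp add: app_T_op x_def[symmetric] y_def[symmetric] scalar_add scalar_mult distrib_left distrib_right mult.assoc)
    finally show ?thesis .
  next
    case False
    have "qq * qq = 1 + (qq - inverse qq) * qq" by (simp add: algebra_simps)
    hence "scalar qq * scalar qq = 1 + scalar (qq - inverse qq) * scalar qq" by (metis scalar_mult scalar_add scalar_1)
    thus ?thesis using False by (simp add: app_T_op distrib_right mult.assoc[symmetric])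
  qed
qed

lemma T_op_far:
  assumes "Suc p < p'" "Suc p' < k"
  shows "T_op M N k p * T_op M N k p' = T_op M N k p' * T_op M N k p"
proof (rule linop_eqI)
  fix v I
  show "app (T_op M N k p * T_op M N k p') v I = app (T_op M N k p' * T_op M N k p) v I"
  proof (cases "I \<in> idx M N k")
    case True
    have "swap_at p I \<in> idx M N k" "swap_at p' I \<in> idx M N k" using True assms by (auto intro!: swap_at_idx)
    moreover have "swap_at p (swap_at p' I) = swap_at p' (swap_at p I)"
      using assms by (auto simp: swap_at_def list_update_swap)
    moreover have "swap_at p I ! p' = I ! p'" "swap_at p I ! Suc p' = I ! Suc p'"
      "swap_at p' I ! p = I ! p" "swap_at p' I ! Suc p = I ! Suc p" using assms by (auto intro!: swap_at_nth(3))
    ultimately show ?thesis using True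
      by (simp add: app_T_op distrib_left scalar_lcomm[of "Rdiag M (I ! p) (I ! Suc p)"] scalar_lcomm[of "Rswap M (I ! p) (I ! Suc p)"] add_ac)
  qed (simp add: app_T_op)
qed

lemma T_op_braid:
  assumes "Suc (Suc p) < k"
  shows "T_op M N k p * T_op M N k (Suc p) * T_op M N k p = T_op M N k (Suc p) * T_op M N k p * T_op M N k (Suc p)"
proof (rule linop_eqI)
  fix v I
  let ?S = "T_op M N k p" and ?T = "T_op M N k (Suc p)"
  show "app (?S * ?T * ?S) v I = app (?T * ?S * ?T) v I"
  proof (cases "I \<in> idx M N k")
    case True
    note len = idx_length[OF True]
    \<comment> \<open>All index lists that occur differ from \<open>I\<close> in the three sites only.\<close>
    define L where "L x y z = I[p := x, Suc p := y, Suc (Suc p) := z]" for x y z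
    let ?A = "{1..M+N}"
    have LB: "L x y z \<in> idx M N k" if "x \<in> ?A" "y \<in> ?A" "z \<in> ?A" for x y z
      unfolding L_def using that True by (intro idx_update)
    have Ln: "L x y z ! p = x" "L x y z ! Suc p = y" "L x y z ! Suc (Suc p) = z" for x y z
      using len assms by (simp_all add: L_def)
    have s: "swap_at p (L x y z) = L y x z" "swap_at (Suc p) (L x y z) = L x z y" for x y z
      unfolding swap_at_def Ln using len assms
      by (auto simp: L_def nth_list_update intro!: nth_equalityI)
    have S: "app ?S u (L x y z) = scalar (Rdiag M x y) * u (L x y z) + scalar (Rswap M x y) * u (L y x z)"
      and T: "app ?T u (L x y z) = scalar (Rdiag M y z) * u (L x y z) + scalar (Rswap M y z) * u (L x z y)"
      if "x \<in> ?A" "y \<in> ?A" "z \<in> ?A" for x y z u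
      using LB[OF that] by (simp_all add: app_T_op Ln s)
    define x y z where "x = I ! p" and "y = I ! Suc p" and "z = I ! Suc (Suc p)"
    have xyz: "x \<in> ?A" "y \<in> ?A" "z \<in> ?A"
      unfolding x_def y_def z_def using idx_nth[OF True] assms by auto
    have I: "I = L x y z" by (simp add: L_def x_def y_def z_def)
    have "app (?S * ?T * ?S) v (L x y z) =
      scalar (Rdiag M x y * Rdiag M x y * Rdiag M y z + Rswap M x y * Rswap M x y * Rdiag M x z) * v (L x y z)
      + scalar (Rswap M x y * (Rdiag M x y * Rdiag M y z + Rdiag M x z * Rdiag M y x)) * v (L y x z)
      + scalar (Rswap M y z * (Rdiag M x y * Rdiag M x z)) * v (L x z y)
      + scalar (Rdiag M x y * Rswap M y z * Rswap M x z) * v (L z x y)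
      + scalar (Rswap M x y * Rswap M x z * Rdiag M y z) * v (L y z x)
      + scalar (Rswap M x y * Rswap M x z * Rswap M y z) * v (L z y x)"
      using xyz by (simp add: S T scalar_add scalar_mult distrib_left distrib_right mult.assoc scalar_comm' scalar_lcomm Rswap_sym[of M y x] add_ac)
    also have "\<dots> =
      scalar (Rdiag M x y * Rdiag M y z * Rdiag M y z + Rswap M y z * Rswap M y z * Rdiag M x z) * v (L x y z)
      + scalar (Rswap M x y * (Rdiag M y z * Rdiag M x z)) * v (L y x z)
      + scalar (Rswap M y z * (Rdiag M y z * Rdiag M x y + Rdiag M x z * Rdiag M z y)) * v (L x z y)
      + scalar (Rdiag M x y * Rswap M y z * Rswap M x z) * v (L z x y)
      + scalar (Rswap M x y * Rswap M x z * Rdiag M y z) * v (L y z x)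
      + scalar (Rswap M x y * Rswap M x z * Rswap M y z) * v (L z y x)"
      unfolding Rdiag_braid[where x = x and y = y and z = z] ..
    also have "\<dots> = app (?T * ?S * ?T) v (L x y z)"
      using xyz by (simp add: S T scalar_add scalar_mult distrib_left distrib_right mult.assoc scalar_comm' scalar_lcomm Rswap_sym[of M z y] add_ac)
    finally show ?thesis unfolding I .
  qed (simp add: app_T_op)
qed

lemma qnum_closed: "(t * t - 1) * qnum t n = t ^ (2 * n) - 1"
  by (induction n) (simp_all add: qnum_def algebra_simps power_add power2_eq_square)

lemma qnum_qq_nonzero: "n > 0 \<Longrightarrow> qnum qq n \<noteq> 0"
  using qnum_closed[of qq n] qq_power_neq_1[of "2 * n"] by auto

lemma qnum_qq'_nonzero: "n > 0 \<Longrightarrow> qnum (- inverse qq) n \<noteq> 0"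
proof -
  assume n: "n > 0"
  have "(- inverse qq) ^ (2 * n) = inverse (qq ^ (2 * n))" by (simp add: power_mult power_inverse)
  moreover have "inverse (qq ^ (2 * n)) \<noteq> 1" using qq_power_neq_1[of "2 * n"] n by simp
  ultimately show ?thesis using qnum_closed[of "- inverse qq" n] by auto
qed

text \<open>The same operators, labelled from \<open>1\<close> as in the Hecke algebra.\<close>
definition T_gen :: "nat \<Rightarrow> nat \<Rightarrow> nat \<Rightarrow> nat \<Rightarrow> (nat list, falg fps) linop" where
  "T_gen M N k i = T_op M N k (i - 1)"

lemma hecke_T_gen: "hecke scale qq (T_gen M N k) k" "hecke scale (- inverse qq) (T_gen M N k) k"
proof -
  have b: "T_gen M N k i * T_gen M N k (Suc i) * T_gen M N k i = T_gen M N k (Suc i) * T_gen M N k i * T_gen M N k (Suc i)"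
    if i: "1 \<le> i" "Suc i < k" for i
  proof -
    obtain p where "i = Suc p" using i by (cases i) auto
    thus ?thesis using T_op_braid[of p k M N] i by (simp add: T_gen_def)
  qed
  have f: "T_gen M N k i * T_gen M N k j = T_gen M N k j * T_gen M N k i" if i: "1 \<le> i" "Suc i < j" "j < k" for i j
    unfolding T_gen_def using i by (intro T_op_far) auto
  have s: "T_gen M N k i * T_gen M N k i = 1 + scale (qq - inverse qq) (T_gen M N k i)" if "1 \<le> i" "i < k" for i
    unfolding T_gen_def using that by (intro T_op_square) auto
  have s': "T_gen M N k i * T_gen M N k i = 1 + scale (- inverse qq - inverse (- inverse qq)) (T_gen M N k i)" if "1 \<le> i" "i < k" for i
    using s[OF that] by (simp add: algebra_simps)
  show "hecke scale qq (T_gen M N k) k"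
    by unfold_locales (use b f s qnum_qq_nonzero in auto)
  show "hecke scale (- inverse qq) (T_gen M N k) k"
    by unfold_locales (use b f s' qnum_qq'_nonzero in auto)
qed

section \<open>The L-operators and the supertrace\<close>

text \<open>
  The operator maps vectors supported in \<open>B\<close> to such vectors, so that the entries in \<open>B\<close>
  multiply as matrices do.
\<close>
definition block_op :: "'i set \<Rightarrow> ('i, 'a::ring_1) linop \<Rightarrow> bool" where
  "block_op B F \<longleftrightarrow> (\<forall>J\<in>B. \<forall>I. I \<notin> B \<longrightarrow> entry F I J = 0)"

definition coeffs_in :: "'i set \<Rightarrow> 'b set \<Rightarrow> ('i, 'b::ring_1 fps) linop \<Rightarrow> bool" where
  "coeffs_in B S F \<longleftrightarrow> (\<forall>I\<in>B. \<forall>J\<in>B. \<forall>n. fps_nth (entry F I J) n \<in> S)"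

lemma entry_plus: "entry (F + G) I J = entry F I J + entry G I J"
  and entry_minus: "entry (F - G) I J = entry F I J - entry G I J"
  by (simp_all add: entry_def)

lemma entry_scale: "entry (scale c F) I J = scalar c * entry F I J"
  by (simp add: entry_def)

lemma entry_times:
  assumes "finite B" "block_op B G" "J \<in> B"
  shows "entry (F * G) I J = (\<Sum>K\<in>B. entry F I K * entry G K J)"
proof -
  have "entry (F * G) I J = app F (app G (unitvec J)) I" by (simp add: entry_def)
  also have "\<dots> = (\<Sum>K\<in>B. entry F I K * app G (unitvec J) K)"
    using assms by (intro app_expand) (auto simp: block_op_def entry_def)
  finally show ?thesis by (simp add: entry_def)
qed

lemma block_op_plus: "block_op B F \<Longrightarrow> block_op B G \<Longrightarrow> block_op B (F + G)"
  by (simp add: block_op_def entry_plus)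

lemma block_op_scale: "block_op B F \<Longrightarrow> block_op B (scale c F)"
  by (simp add: block_op_def entry_scale)

lemma block_op_times: "finite B \<Longrightarrow> block_op B F \<Longrightarrow> block_op B G \<Longrightarrow> block_op B (F * G)"
  unfolding block_op_def[of B "F * G"] by (simp add: entry_times) (simp add: block_op_def)

lemma entry_1: "entry 1 I J = (if I = J then 1 else 0)"
  by (simp add: entry_def unitvec_def)

lemma block_op_1: "block_op B 1"
  by (auto simp: block_op_def entry_1)

abbreviation ideal_op :: "nat \<Rightarrow> nat \<Rightarrow> nat \<Rightarrow> (nat list, falg fps) linop \<Rightarrow> bool" where
  "ideal_op M N k F \<equiv> block_op (idx M N k) F \<and> coeffs_in (idx M N k) (uq_ideal M N) F"

abbreviation carrier_op :: "nat \<Rightarrow> nat \<Rightarrow> nat \<Rightarrow> (nat list, falg fps) linop \<Rightarrow> bool" where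
  "carrier_op M N k F \<equiv> block_op (idx M N k) F \<and> coeffs_in (idx M N k) (carrier (free_alg M N)) F"

lemma carrier_op_plus: "carrier_op M N k F \<Longrightarrow> carrier_op M N k G \<Longrightarrow> carrier_op M N k (F + G)"
  by (auto simp: coeffs_in_def entry_plus intro: block_op_plus free_alg_closed)

lemma carrier_op_1: "carrier_op M N k 1"
  by (auto simp: coeffs_in_def entry_1 block_op_1 intro: free_alg_closed)

lemma carrier_op_scale: "carrier_op M N k F \<Longrightarrow> carrier_op M N k (scale c F)"
  by (auto simp: coeffs_in_def entry_scale scalar_def block_op_scale intro: free_alg_closed)

lemma coeffs_in_times:
  fixes B :: "'i set"
  assumes G: "block_op B G" and "finite B"
    and S: "\<And>(f :: 'i \<Rightarrow> 'b::ring_1) A. (\<And>K. K \<in> A \<Longrightarrow> f K \<in> S) \<Longrightarrow> sum f A \<in> S"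
      "\<And>(f :: nat \<Rightarrow> 'b) A. (\<And>i. i \<in> A \<Longrightarrow> f i \<in> S) \<Longrightarrow> sum f A \<in> S"
    and "\<And>a b. a \<in> S1 \<Longrightarrow> b \<in> S2 \<Longrightarrow> a * b \<in> S"
    and "coeffs_in B S1 F" "coeffs_in B S2 G"
  shows "coeffs_in B S (F * G)"
  unfolding coeffs_in_def
proof safe
  fix I J n assume "I \<in> B" "J \<in> B"
  thus "fps_nth (entry (F * G) I J) n \<in> S"
    unfolding entry_times[OF \<open>finite B\<close> G \<open>J \<in> B\<close>] fps_sum_nth fps_mult_nth
    using assms(5-7) by (intro S) (auto simp: coeffs_in_def)
qed

lemma carrier_op_times: "carrier_op M N k F \<Longrightarrow> carrier_op M N k G \<Longrightarrow> carrier_op M N k (F * G)"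
  by (auto intro!: block_op_times elim!: coeffs_in_times[rotated 5] intro: free_alg_sum_closed free_alg_closed)

lemma ideal_op_scale: "ideal_op M N k F \<Longrightarrow> ideal_op M N k (scale c F)"
  by (auto simp: coeffs_in_def entry_scale scalar_def block_op_scale intro: uq_ideal_scal)

lemma ideal_op_left: "carrier_op M N k F \<Longrightarrow> ideal_op M N k G \<Longrightarrow> ideal_op M N k (F * G)"
  by (auto intro!: block_op_times elim!: coeffs_in_times[rotated 5] intro: uq_ideal_sum uq_ideal_mult_left)

lemma ideal_op_right: "ideal_op M N k F \<Longrightarrow> carrier_op M N k G \<Longrightarrow> ideal_op M N k (F * G)"
  by (auto intro!: block_op_times elim!: coeffs_in_times[rotated 5] intro: uq_ideal_sum uq_ideal_mult_right)

definition strace :: "nat \<Rightarrow> nat \<Rightarrow> nat \<Rightarrow> (nat list, falg fps) linop \<Rightarrow> falg fps" where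
  "strace M N k F = (\<Sum>I\<in>idx M N k. (- 1) ^ (\<Sum>a<k. par M (I ! a)) * entry F I I)"

lemma strace_plus: "strace M N k (F + G) = strace M N k F + strace M N k G"
  by (simp add: strace_def entry_plus distrib_left sum.distrib)

lemma strace_minus: "strace M N k (F - G) = strace M N k F - strace M N k G"
  by (simp add: strace_def entry_minus right_diff_distrib sum_subtractf)

lemma strace_scale: "strace M N k (scale c F) = scalar c * strace M N k F"
  by (simp add: strace_def entry_scale sum_distrib_left scalar_left)

lemma strace_ideal: "ideal_op M N k F \<Longrightarrow> fps_nth (strace M N k F) n \<in> uq_ideal M N"
  unfolding strace_def fps_sum_nth fps_nth_sign
  by (intro uq_ideal_sum uq_ideal_sign) (simp add: coeffs_in_def)

lemma par_sum_swap_at: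
  assumes "S \<subseteq> {..<length I}" "finite S" "p \<in> S \<longleftrightarrow> Suc p \<in> S" "Suc p < length I"
  shows "(\<Sum>c\<in>S. par M (swap_at p I ! c)) = (\<Sum>c\<in>S. par M (I ! c))"
proof (cases "p \<in> S")
  case True
  have split: "sum f S = f p + (f (Suc p) + sum f (S - {p} - {Suc p}))" for f :: "nat \<Rightarrow> nat"
    using True assms by (simp add: sum.remove[of S p] sum.remove[of "S - {p}" "Suc p"])
  have "(\<Sum>c\<in>S. par M (swap_at p I ! c)) = par M (swap_at p I ! p) + (par M (swap_at p I ! Suc p) + (\<Sum>c\<in>S - {p} - {Suc p}. par M (swap_at p I ! c)))"
    by (rule split)
  also have "(\<Sum>c\<in>S - {p} - {Suc p}. par M (swap_at p I ! c)) = (\<Sum>c\<in>S - {p} - {Suc p}. par M (I ! c))"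
    by (intro sum.cong refl) (auto simp: swap_at_nth(3))
  also have "par M (swap_at p I ! p) + (par M (swap_at p I ! Suc p) + \<dots>) = par M (I ! p) + (par M (I ! Suc p) + \<dots>)"
    using assms by (simp add: swap_at_nth)
  also have "\<dots> = (\<Sum>c\<in>S. par M (I ! c))"
    by (rule split[symmetric])
  finally show ?thesis .
next
  case False
  hence "c \<noteq> p \<and> c \<noteq> Suc p" if "c \<in> S" for c using that assms by auto
  thus ?thesis by (intro sum.cong refl) (auto simp: swap_at_nth(3))
qed

text \<open>
  The supertrace is not cyclic for matrices over a noncommutative ring. It is so against \<open>T\<close>,
  whose entries are central scalars and which preserves the parity of multi-indices.
\<close>
lemma strace_T_op:
  assumes p: "Suc p < k"
  shows "strace M N k (T_op M N k p * F) = strace M N k (F * T_op M N k p)"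
proof -
  let ?B = "idx M N k"
  define sg where "sg I = (\<Sum>a<k. par M (I ! a))" for I :: "nat list"
  define d where "d I = scalar (Rdiag M (I ! p) (I ! Suc p))" for I
  define e where "e I = scalar (Rswap M (I ! p) (I ! Suc p))" for I
  have len: "I \<in> ?B \<Longrightarrow> length I = k" for I by (rule idx_length)
  have L: "entry (T_op M N k p * F) I I = d I * entry F I I + e I * entry F (swap_at p I) I" if "I \<in> ?B" for I
    using that by (simp add: entry_def app_T_op d_def e_def)
  have es: "e (swap_at p I) = e I" if "I \<in> ?B" for I
    using p len[OF that] by (simp add: e_def swap_at_nth Rswap_sym[of M "I ! Suc p"])
  have R: "entry (F * T_op M N k p) I I = d I * entry F I I + e I * entry F I (swap_at p I)" if I: "I \<in> ?B" for I
  proof -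
    have "app (T_op M N k p) (unitvec I) = (\<lambda>J. unitvec I J * d I + unitvec (swap_at p I) J * e I)"
    proof
      fix J
      show "app (T_op M N k p) (unitvec I) J = unitvec I J * d I + unitvec (swap_at p I) J * e I"
      proof (cases "J \<in> ?B")
        case True
        have "swap_at p J = I \<longleftrightarrow> J = swap_at p I"
          using swap_at_swap_at[of p I] swap_at_swap_at[of p J] p len[OF I] len[OF True] by metis
        thus ?thesis using True es[OF I]
          by (auto simp: app_T_op unitvec_def d_def[symmetric] e_def[symmetric])
      next
        case False
        hence "J \<noteq> I" "J \<noteq> swap_at p I" using I swap_at_idx[OF I p] by auto
        thus ?thesis using False by (simp add: app_T_op unitvec_def)
      qed
    qed
    hence "entry (F * T_op M N k p) I I = entry F I I * d I + entry F I (swap_at p I) * e I"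
      by (simp add: entry_def app_add app_mult_right)
    thus ?thesis by (simp add: d_def e_def scalar_comm)
  qed
  have "(\<Sum>I\<in>?B. (- 1) ^ sg I * (e I * entry F (swap_at p I) I)) = (\<Sum>I\<in>?B. (- 1) ^ sg (swap_at p I) * (e (swap_at p I) * entry F (swap_at p (swap_at p I)) (swap_at p I)))"
    by (rule sum.reindex_bij_witness[of _ "swap_at p" "swap_at p"])
      (use p len swap_at_swap_at swap_at_idx in auto)
  also have "\<dots> = (\<Sum>I\<in>?B. (- 1) ^ sg I * (e I * entry F I (swap_at p I)))"
  proof (intro sum.cong refl)
    fix I assume I: "I \<in> ?B"
    have "sg (swap_at p I) = sg I"
      unfolding sg_def using p len[OF I] by (intro par_sum_swap_at) auto
    thus "(- 1) ^ sg (swap_at p I) * (e (swap_at p I) * entry F (swap_at p (swap_at p I)) (swap_at p I)) =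
      (- 1) ^ sg I * (e I * entry F I (swap_at p I))"
      using es[OF I] swap_at_swap_at[of p I] p len[OF I] by simp
  qed
  finally show ?thesis
    by (simp add: strace_def L R sg_def[symmetric] distrib_left sum.distrib)
qed

text \<open>\<open>L\<close> in the copy \<open>p+1\<close> at the spectral parameter \<open>z q\<^bsup>2p\<^esup>\<close>.\<close>
definition L_op :: "nat \<Rightarrow> nat \<Rightarrow> nat \<Rightarrow> pm \<Rightarrow> nat \<Rightarrow> (nat list, falg fps) linop" where
  "L_op M N k s p = one_site M N k p (\<lambda>x y. Lser s (qq ^ (2 * p)) [x] [y])"

lemma free_alg_sign: "a \<in> carrier (free_alg M N) \<Longrightarrow> (- 1) ^ n * a \<in> carrier (free_alg M N)"
  by (induction n) (auto intro: free_alg_closed)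

lemma carrier_op_L_op: "p < k \<Longrightarrow> carrier_op M N k (L_op M N k s p)"
proof (intro conjI)
  show "block_op (idx M N k) (L_op M N k s p)"
    by (simp add: block_op_def L_op_def entry_def app_one_site)
  assume p: "p < k"
  show "coeffs_in (idx M N k) (carrier (free_alg M N)) (L_op M N k s p)"
    unfolding coeffs_in_def
  proof safe
    fix I J n assume I: "I \<in> idx M N k" and "J \<in> idx M N k"
    show "fps_nth (entry (L_op M N k s p) I J) n \<in> carrier (free_alg M N)"
      unfolding entry_def L_op_def app_one_site if_P[OF I] fps_sum_nth
    proof (intro free_alg_sum_closed)
      fix x assume "x \<in> {1..M+N}"
      hence "Lgen s (I ! p) x n \<in> gens M N" using idx_nth[OF I p] by (auto simp: gens_def)
      thus "fps_nth ((- 1) ^ ((par M (I ! p) + par M x) * (par M x + tail_parity M k p I)) * Lser s (qq ^ (2 * p)) [I ! p] [x] * unitvec J (I[p := x])) n \<in> carrier (free_alg M N)"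
        by (auto simp: unitvec_def fps_nth_sign Lser_def intro!: free_alg_sign free_alg_closed)
    qed
  qed
qed

lemma carrier_op_T_op: "Suc p < k \<Longrightarrow> carrier_op M N k (T_op M N k p)"
proof (intro conjI)
  assume p: "Suc p < k"
  show "block_op (idx M N k) (T_op M N k p)"
    by (auto simp: block_op_def entry_def app_T_op unitvec_def)
  show "coeffs_in (idx M N k) (carrier (free_alg M N)) (T_op M N k p)"
    by (auto simp: coeffs_in_def entry_def app_T_op unitvec_def scalar_def
        intro!: free_alg_closed)
qed

text \<open>
  If \<open>b < p\<close>, the sign in \<open>L\<close> involves the parities of the indices at \<open>p\<close> and \<open>p+1\<close>, but only
  their sum, which \<open>T\<close> preserves.
\<close>
lemma T_op_L_op:
  assumes p: "Suc p < k" and b: "b < k" "b \<noteq> p" "b \<noteq> Suc p"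
  shows "T_op M N k p * L_op M N k s b = L_op M N k s b * T_op M N k p"
proof (rule linop_eqI)
  fix v I
  show "app (T_op M N k p * L_op M N k s b) v I = app (L_op M N k s b * T_op M N k p) v I"
  proof (cases "I \<in> idx M N k")
    case I: True
    note len = idx_length[OF I]
    let ?l = "\<lambda>x y. Lser s (qq ^ (2 * b)) [x] [y]"
    let ?d = "scalar (Rdiag M (I ! p) (I ! Suc p))" and ?e = "scalar (Rswap M (I ! p) (I ! Suc p))"
    let ?s = "\<lambda>x. (- 1) ^ ((par M (I ! b) + par M x) * (par M x + tail_parity M k b I)) :: falg fps"
    have sI: "swap_at p I \<in> idx M N k" using I p by (rule swap_at_idx)
    have sb: "swap_at p I ! b = I ! b" using b by (simp add: swap_at_nth(3))
    have tl: "tail_parity M k b (swap_at p I) = tail_parity M k b I"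
      unfolding tail_parity_def using b p len by (intro par_sum_swap_at) auto
    have sw: "(swap_at p I)[b := x] = swap_at p (I[b := x])" for x
      using b by (auto simp: swap_at_def list_update_swap)
    have "app (T_op M N k p * L_op M N k s b) v I =
      ?d * (\<Sum>x\<in>{1..M+N}. ?s x * ?l (I ! b) x * v (I[b := x])) +
      ?e * (\<Sum>x\<in>{1..M+N}. ?s x * ?l (I ! b) x * v (swap_at p (I[b := x])))"
      using I sI by (simp add: app_T_op L_op_def app_one_site sb tl sw)
    also have "\<dots> = (\<Sum>x\<in>{1..M+N}. ?s x * ?l (I ! b) x * (?d * v (I[b := x]) + ?e * v (swap_at p (I[b := x]))))"
      by (simp add: sum_distrib_left sum.distrib[symmetric] distrib_left scalar_left mult.assoc)
    also have "\<dots> = app (L_op M N k s b * T_op M N k p) v I"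
      unfolding app_times L_op_def app_one_site if_P[OF I]
    proof (intro sum.cong refl arg_cong2[where f = "(*)"])
      fix x assume "x \<in> {1..M+N}"
      hence "I[b := x] \<in> idx M N k" using I by (intro idx_update)
      moreover have "I[b := x] ! p = I ! p" "I[b := x] ! Suc p = I ! Suc p" using b by auto
      ultimately show "?d * v (I[b := x]) + ?e * v (swap_at p (I[b := x])) = app (T_op M N k p) v (I[b := x])"
        by (simp add: app_T_op)
    qed
    finally show ?thesis .
  qed (simp add: app_T_op L_op_def app_one_site)
qed

definition R_op :: "nat \<Rightarrow> nat \<Rightarrow> nat \<Rightarrow> nat \<Rightarrow> cq \<Rightarrow> (nat list, falg fps) linop" where
  "R_op M N k p w = two_site M N k p (\<lambda>i j x y. scalar ((- 1) ^ twist2 M i j x y * Rzw M N qq 1 w [i, j] [x, y]))"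

definition P_op :: "nat \<Rightarrow> nat \<Rightarrow> nat \<Rightarrow> nat \<Rightarrow> (nat list, falg fps) linop" where
  "P_op M N k p = two_site M N k p (\<lambda>i j x y. scalar ((- 1) ^ twist2 M i j x y * Pgr M N [i, j] [x, y]))"

lemma app_two_site_swap:
  assumes I: "I \<in> idx M N k" and p: "Suc p < k"
    and r: "\<And>i j x y. {i, j, x, y} \<subseteq> {1..M+N} \<Longrightarrow>
      r i j x y = (if x = i \<and> y = j then D i j else 0) + (if x = j \<and> y = i then G i j else 0)"
  shows "app (two_site M N k p r) v I = D (I ! p) (I ! Suc p) * v I + G (I ! p) (I ! Suc p) * v (swap_at p I)"
proof -
  define i j where "i = I ! p" and "j = I ! Suc p"
  have ij: "i \<in> {1..M+N}" "j \<in> {1..M+N}" unfolding i_def j_def using idx_nth[OF I] p by auto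
  have "app (two_site M N k p r) v I = (\<Sum>x\<in>{1..M+N}. \<Sum>y\<in>{1..M+N}. r i j x y * v (I[p := x, Suc p := y]))"
    using I by (simp add: app_two_site i_def j_def)
  also have "\<dots> = (\<Sum>x\<in>{1..M+N}. \<Sum>y\<in>{1..M+N}.
      (if y = j then if x = i then D i j * v I else 0 else 0) +
      (if y = i then if x = j then G i j * v (swap_at p I) else 0 else 0))"
    using ij by (intro sum.cong refl) (auto simp: r swap_at_def i_def j_def distrib_right)
  also have "\<dots> = D i j * v I + G i j * v (swap_at p I)"
    using ij by (simp add: sum.distrib)
  finally show ?thesis by (simp add: i_def j_def)
qed

lemma qi_diff: "qi M qq j - inverse (qi M qq j) = (- 1) ^ par M j * (qq - inverse qq)"
  by (simp add: qi_def par_def power_int_minus)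

lemma twist2_same: "even (twist2 M i j i j)" by (simp add: twist2_def)

lemma twist2_swap: "even (twist2 M i j j i + par M j + par M i * par M j)"
  by (auto simp: twist2_def)

lemma app_P_op:
  assumes I: "I \<in> idx M N k" and p: "Suc p < k"
  shows "app (P_op M N k p) v I = scalar ((- 1) ^ (par M (I ! p) * par M (I ! Suc p))) * v (swap_at p I)"
proof -
  have P: "Pgr M N [i, j] [x, y] = (if x = j \<and> y = i then (- 1) ^ par M j else 0)"
    if "{i, j, x, y} \<subseteq> {1..M+N}" for i j x y
  proof -
    have "Pgr M N [i, j] [x, y] = (\<Sum>a\<in>{1..M+N}. \<Sum>b\<in>{1..M+N}.
      if b = j then if a = i then if x = j \<and> y = i then (- 1) ^ par M j else 0 else 0 else 0)"
      unfolding Pgr_def by (intro sum.cong refl) (auto simp: E2_def)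
    thus ?thesis using that by simp
  qed
  have "app (P_op M N k p) v I = 0 * v I + scalar ((- 1) ^ (par M (I ! p) * par M (I ! Suc p))) * v (swap_at p I)"
    unfolding P_op_def
  proof (rule app_two_site_swap[OF I p])
    fix i j x y assume a: "{i, j, x, y} \<subseteq> {1..M+N}"
    have "(- 1) ^ (twist2 M i j j i + par M j) = ((- 1) ^ (par M i * par M j) :: cq)"
      using twist2_swap[of M i j] by (intro minus_one_power_cong)
    thus "scalar ((- 1) ^ twist2 M i j x y * Pgr M N [i, j] [x, y]) =
      (if x = i \<and> y = j then 0 else 0) + (if x = j \<and> y = i then scalar ((- 1) ^ (par M i * par M j)) else 0)"
      by (simp add: P[OF a] power_add)
  qed
  thus ?thesis by simp
qed

lemma app_R_op:
  assumes I: "I \<in> idx M N k" and p: "Suc p < k"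
  shows "app (R_op M N k p w) v I =
    scalar (let i = I ! p; j = I ! Suc p in if i = j then qi M qq i - w * inverse (qi M qq i) else 1 - w) * v I +
    scalar (let i = I ! p; j = I ! Suc p in if i = j then 0 else
        (- 1) ^ (par M i * par M j) * (if i < j then 1 else w) * (qq - inverse qq)) * v (swap_at p I)"
  unfolding R_op_def
proof (rule app_two_site_swap[OF I p])
  fix i j x y assume a: "{i, j, x, y} \<subseteq> {1..M+N}"
  have R: "Rzw M N qq 1 w [i, j] [x, y] = (if x = i \<and> y = j then (if i = j then 1 * qi M qq i - w * inverse (qi M qq i) else 1 - w)
     else if x = j \<and> y = i then (if i < j then 1 else w) * (qi M qq j - inverse (qi M qq j)) else 0)"
    using a by (intro Rzw_entry) auto
  have s: "(- 1) ^ twist2 M i j i j = (1 :: cq)" using twist2_same by (simp add: minus_one_power_iff)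
  have "(- 1) ^ (twist2 M i j j i + par M j) = ((- 1) ^ (par M i * par M j) :: cq)"
    using twist2_swap[of M i j] by (intro minus_one_power_cong)
  hence t: "(- 1) ^ twist2 M i j j i * ((- 1) ^ par M j * c) = (- 1) ^ (par M i * par M j) * c" for c :: cq
    by (simp add: power_add mult.assoc[symmetric])
  show "scalar ((- 1) ^ twist2 M i j x y * Rzw M N qq 1 w [i, j] [x, y]) =
      (if x = i \<and> y = j then scalar (let i = i; j = j in if i = j then qi M qq i - w * inverse (qi M qq i) else 1 - w) else 0) +
      (if x = j \<and> y = i then scalar (let i = i; j = j in if i = j then 0 else
        (- 1) ^ (par M i * par M j) * (if i < j then 1 else w) * (qq - inverse qq)) else 0)"
  proof (cases "i = j")
    case True thus ?thesis unfolding R using s by auto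
  next
    case False
    thus ?thesis unfolding R qi_diff using s t[of "(if i < j then 1 else w) * (qq - inverse qq)"]
      by (auto simp: mult_ac)
  qed
qed

text \<open>
  The unit tensor acts as the projection onto the multi-indices of length \<open>k\<close>, not as the unit
  of the ring.
\<close>
abbreviation unit_op :: "nat \<Rightarrow> nat \<Rightarrow> nat \<Rightarrow> (nat list, falg fps) linop" where
  "unit_op M N k \<equiv> tens_op M N k tone"

lemma P_op_P_op: "Suc p < k \<Longrightarrow> P_op M N k p * P_op M N k p = unit_op M N k"
proof (rule linop_eqI)
  fix v I assume p: "Suc p < k"
  show "app (P_op M N k p * P_op M N k p) v I = app (unit_op M N k) v I"
  proof (cases "I \<in> idx M N k")
    case True
    have "(- 1 :: cq) ^ (par M (I ! p) * par M (I ! Suc p)) * (- 1) ^ (par M (I ! p) * par M (I ! Suc p)) = 1"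
      by (simp flip: power_add mult_2)
    hence "scalar ((- 1) ^ (par M (I ! p) * par M (I ! Suc p))) * (scalar ((- 1) ^ (par M (I ! p) * par M (I ! Suc p))) * v I) = v I"
      by (simp add: mult.assoc[symmetric] scalar_mult[symmetric])
    thus ?thesis using True p swap_at_idx[OF True p] idx_length[OF True]
      by (simp add: app_P_op app_tens_op_tone swap_at_nth swap_at_swap_at mult.commute[of "par M (I ! Suc p)"])
  qed (simp add: P_op_def app_two_site app_tens_op_tone)
qed

lemma swap_at_same: "I ! p = I ! Suc p \<Longrightarrow> swap_at p I = I"
  unfolding swap_at_def by (metis list_update_id)

lemma app_P_op_R_op:
  assumes I: "I \<in> idx M N k" and p: "Suc p < k" and i: "i = I ! p" and j: "j = I ! Suc p"
  shows "app (P_op M N k p * R_op M N k p w) v I =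
    scalar ((- 1) ^ (par M i * par M j) * (if i = j then qi M qq i - w * inverse (qi M qq i) else 1 - w)) * v (swap_at p I) +
    scalar (if i = j then 0 else (if j < i then 1 else w) * (qq - inverse qq)) * v I"
proof -
  note len = idx_length[OF I]
  let ?c = "(- 1) ^ (par M i * par M j) :: cq"
  have n: "swap_at p I ! p = j" "swap_at p I ! Suc p = i" using p len by (simp_all add: swap_at_nth i j)
  have ss: "swap_at p (swap_at p I) = I" using p len by (simp add: swap_at_swap_at)
  have c: "?c * (?c * a) = a" for a by (simp add: mult.assoc[symmetric] flip: power_add mult_2)
  have "app (R_op M N k p w) v (swap_at p I) =
      scalar (if i = j then qi M qq i - w * inverse (qi M qq i) else 1 - w) * v (swap_at p I) +
      scalar (if i = j then 0 else ?c * ((if j < i then 1 else w) * (qq - inverse qq))) * v I"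
    unfolding app_R_op[OF swap_at_idx[OF I p] p] n ss Let_def by (auto simp: mult.commute[of "par M j"] mult.assoc)
  hence "app (P_op M N k p * R_op M N k p w) v I =
      scalar ?c * (scalar (if i = j then qi M qq i - w * inverse (qi M qq i) else 1 - w) * v (swap_at p I) +
      scalar (if i = j then 0 else ?c * ((if j < i then 1 else w) * (qq - inverse qq))) * v I)"
    by (simp only: app_times app_P_op[OF I p] i[symmetric] j[symmetric])
  also have "\<dots> = scalar (?c * (if i = j then qi M qq i - w * inverse (qi M qq i) else 1 - w)) * v (swap_at p I) +
      scalar (?c * (if i = j then 0 else ?c * ((if j < i then 1 else w) * (qq - inverse qq)))) * v I"
    by (simp only: distrib_left scalar_mult mult.assoc)
  also have "?c * (if i = j then 0 else ?c * ((if j < i then 1 else w) * (qq - inverse qq))) =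
      (if i = j then 0 else (if j < i then 1 else w) * (qq - inverse qq))"
    by (simp only: if_distrib[of "\<lambda>x. ?c * x"] c mult_zero_right)
  finally show ?thesis .
qed

lemma P_op_R_op_0: "Suc p < k \<Longrightarrow> P_op M N k p * R_op M N k p 0 = unit_op M N k * T_op M N k p"
proof (rule linop_eqI)
  fix v I assume p: "Suc p < k"
  show "app (P_op M N k p * R_op M N k p 0) v I = app (unit_op M N k * T_op M N k p) v I"
  proof (cases "I \<in> idx M N k")
    case True
    define i j where "i = I ! p" and "j = I ! Suc p"
    note P = app_P_op_R_op[OF True p i_def j_def, of 0 v]
    have R: "app (unit_op M N k * T_op M N k p) v I = scalar (Rdiag M i j) * v I + scalar (Rswap M i j) * v (swap_at p I)"
      using True by (simp add: app_tens_op_tone app_T_op i_def j_def)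
    show ?thesis
    proof (cases "i = j")
      case True
      have "swap_at p I = I" using True swap_at_same[of I p] by (simp add: i_def j_def)
      moreover have "(- 1 :: cq) ^ (par M i * par M i) = (- 1) ^ par M i" by (simp add: par_def)
      ultimately show ?thesis unfolding P R using True by (simp add: Rswap_def Rdiag_def)
    next
      case False
      thus ?thesis unfolding P R by (simp add: Rswap_def Rdiag_def add.commute)
    qed
  qed (simp add: P_op_def app_two_site app_tens_op_tone)
qed

text \<open>The degeneration of the R-matrix at \<open>w/z = q\<^sup>2\<close>, where it becomes a multiple of a projection.\<close>
lemma P_op_R_op_q2:
  "Suc p < k \<Longrightarrow> P_op M N k p * R_op M N k p (qq ^ 2) = scale (1 - qq ^ 2) (unit_op M N k * (T_op M N k p - scale qq 1))"
proof (rule linop_eqI)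
  fix v I assume p: "Suc p < k"
  show "app (P_op M N k p * R_op M N k p (qq ^ 2)) v I = app (scale (1 - qq ^ 2) (unit_op M N k * (T_op M N k p - scale qq 1))) v I"
  proof (cases "I \<in> idx M N k")
    case True
    define i j where "i = I ! p" and "j = I ! Suc p"
    note P = app_P_op_R_op[OF True p i_def j_def, of "qq ^ 2" v]
    define c where "c = 1 - qq ^ 2"
    have "app (scale c (unit_op M N k * (T_op M N k p - scale qq 1))) v I =
       scalar c * (scalar (Rdiag M i j) * v I + scalar (Rswap M i j) * v (swap_at p I) - scalar qq * v I)"
      using True by (simp add: app_tens_op_tone app_T_op i_def j_def)
    also have "\<dots> = scalar (c * Rswap M i j) * v (swap_at p I) + scalar (c * (Rdiag M i j - qq)) * v I"
      by (simp add: scalar_mult right_diff_distrib left_diff_distrib distrib_left mult.assoc scalar_diff)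
    finally have R: "app (scale c (unit_op M N k * (T_op M N k p - scale qq 1))) v I =
      scalar (c * Rswap M i j) * v (swap_at p I) + scalar (c * (Rdiag M i j - qq)) * v I" .
    show ?thesis
    proof (cases "i = j")
      case True
      have "swap_at p I = I" using True swap_at_same[of I p] by (simp add: i_def j_def)
      moreover have "(- 1 :: cq) ^ (par M i * par M i) = (- 1) ^ par M i" by (simp add: par_def)
      moreover have "(- 1) ^ par M i * (qi M qq i - qq ^ 2 * inverse (qi M qq i)) = c * ((- 1) ^ par M i * qi M qq i - qq)"
        by (auto simp: c_def qi_def par_def power_int_minus power2_eq_square algebra_simps)
      ultimately show ?thesis unfolding P c_def[symmetric] R using True by (simp add: Rswap_def Rdiag_def)
    next
      case False
      have "(if j < i then 1 else qq ^ 2) * (qq - inverse qq) = c * (Rdiag M i j - qq)"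
        using False by (auto simp: c_def Rdiag_def power2_eq_square algebra_simps)
      thus ?thesis unfolding P c_def[symmetric] R using False by (simp add: Rswap_def mult.commute)
    qed
  qed (simp add: P_op_def app_two_site app_tens_op_tone)
qed

lemma carrier_op_P_op: "Suc p < k \<Longrightarrow> carrier_op M N k (P_op M N k p)"
proof (intro conjI)
  assume p: "Suc p < k"
  show "block_op (idx M N k) (P_op M N k p)"
    by (simp add: block_op_def P_op_def entry_def app_two_site)
  show "coeffs_in (idx M N k) (carrier (free_alg M N)) (P_op M N k p)"
    using p by (auto simp: coeffs_in_def entry_def app_P_op unitvec_def scalar_def intro!: free_alg_closed)
qed

lemma ideal_op_rll:
  assumes MN: "M \<noteq> N" and p: "Suc p < k"
  shows "ideal_op M N k (R_op M N k p (qq ^ 2) * L_op M N k s p * L_op M N k s (Suc p)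
    - L_op M N k s (Suc p) * L_op M N k s p * R_op M N k p (qq ^ 2))"
proof (intro conjI)
  show "block_op (idx M N k) (R_op M N k p (qq ^ 2) * L_op M N k s p * L_op M N k s (Suc p)
    - L_op M N k s (Suc p) * L_op M N k s p * R_op M N k p (qq ^ 2))"
    by (simp add: block_op_def entry_def R_op_def L_op_def app_two_site app_one_site)
  show "coeffs_in (idx M N k) (uq_ideal M N) (R_op M N k p (qq ^ 2) * L_op M N k s p * L_op M N k s (Suc p)
    - L_op M N k s (Suc p) * L_op M N k s p * R_op M N k p (qq ^ 2))"
    unfolding coeffs_in_def
  proof safe
    fix I J n assume I: "I \<in> idx M N k" and J: "J \<in> idx M N k"
    have q: "qq ^ (2 * Suc p) = qq ^ (2 * p) * qq ^ 2" by (simp add: power_add power2_eq_square mult_ac)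
    let ?r = "\<lambda>i j x y. scalar ((- 1) ^ twist2 M i j x y * Rzw M N qq 1 (qq ^ 2) [i, j] [x, y])"
    have r0: "?r i j x y = 0"
      if "odd (par M i + par M j + par M x + par M y)" for i j x y
      using that by (simp add: Rzw_parity)
    have rll: "entry (R_op M N k p (qq ^ 2) * L_op M N k s p * L_op M N k s (Suc p)
      - L_op M N k s (Suc p) * L_op M N k s p * R_op M N k p (qq ^ 2)) I J =
      (\<Sum>z\<in>{1..M+N}. \<Sum>w\<in>{1..M+N}.
      (- 1) ^ (tail_parity M k (Suc p) I * (par M (I ! p) + par M (I ! Suc p) + par M z + par M w)) *
      (rll_comp M N ?r (\<lambda>x y. Lser s (qq ^ (2 * p)) [x] [y]) (\<lambda>x y. Lser s (qq ^ (2 * p) * qq ^ 2) [x] [y])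
        (I ! p) (I ! Suc p) z w * unitvec J (I[p := z, Suc p := w])))"
      unfolding entry_def R_op_def L_op_def q by (rule linop_rll[OF p I]) (rule r0)
    show "fps_nth (entry (R_op M N k p (qq ^ 2) * L_op M N k s p * L_op M N k s (Suc p)
      - L_op M N k s (Suc p) * L_op M N k s p * R_op M N k p (qq ^ 2)) I J) n \<in> uq_ideal M N"
      unfolding rll fps_sum_nth fps_nth_sign
    proof (intro uq_ideal_sum uq_ideal_sign)
      fix z w assume zw: "z \<in> {1..M+N}" "w \<in> {1..M+N}"
      have "I ! p \<in> {1..M+N}" "I ! Suc p \<in> {1..M+N}" using idx_nth[OF I] p by auto
      from Lser_rll[OF MN this zw, of "qq ^ (2 * p)" s n]
      show "fps_nth (rll_comp M N (\<lambda>i j x y. scalar ((- 1) ^ twist2 M i j x y * Rzw M N qq 1 (qq ^ 2) [i, j] [x, y]))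
        (\<lambda>x y. Lser s (qq ^ (2 * p)) [x] [y]) (\<lambda>x y. Lser s (qq ^ (2 * p) * qq ^ 2) [x] [y]) (I ! p) (I ! Suc p) z w *
        unitvec J (I[p := z, Suc p := w])) n \<in> uq_ideal M N"
        by (auto simp: unitvec_def uq_ideal_0)
    qed
  qed
qed

lemma block_op_unit_op: "block_op (idx M N k) (unit_op M N k)"
  by (simp add: block_op_def entry_def app_tens_op_tone)

lemma carrier_op_unit_op: "carrier_op M N k (unit_op M N k)"
  by (auto simp: block_op_unit_op coeffs_in_def entry_def app_tens_op_tone unitvec_def intro: free_alg_closed)

lemma unit_op_idem: "unit_op M N k * unit_op M N k = unit_op M N k"
  by (rule linop_eqI) (simp add: app_tens_op_tone)

lemma T_op_unit_op: "Suc p < k \<Longrightarrow> T_op M N k p * unit_op M N k = unit_op M N k * T_op M N k p"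
  by (rule linop_eqI) (simp add: app_tens_op_tone app_T_op swap_at_idx)

lemma unit_op_L_op: "unit_op M N k * L_op M N k s p = L_op M N k s p"
  by (rule linop_eqI) (simp add: app_tens_op_tone L_op_def app_one_site)

lemma unit_op_R_op: "unit_op M N k * R_op M N k p w = R_op M N k p w"
  by (rule linop_eqI) (simp add: app_tens_op_tone R_op_def app_two_site)

lemma T_op_quadratic:
  assumes "Suc p < k"
  shows "(T_op M N k p - scale qq 1) * (T_op M N k p + scale (inverse qq) 1) = 0"
proof -
  have "(T_op M N k p - scale qq 1) * (T_op M N k p + scale (inverse qq) 1) =
    T_op M N k p * T_op M N k p - scale (qq - inverse qq) (T_op M N k p) - 1"
    by (simp add: distrib_left distrib_right left_diff_distrib scaled.sc_diff_left scaled.sc_linear)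
  thus ?thesis by (simp add: T_op_square[OF assms])
qed

text \<open>
  In \<open>P (R L L' - L' L R) (T + q\<^sup>-\<^sup>1)\<close> with \<open>R = R(1,q\<^sup>2)\<close> the second term vanishes, since \<open>R\<close> is a
  multiple of \<open>P (T - q)\<close>, and in the first term \<open>P R\<close> is a multiple of \<open>T - q\<close>.
\<close>
lemma local_manin:
  assumes MN: "M \<noteq> N" and p: "Suc p < k"
  shows "ideal_op M N k ((T_op M N k p - scale qq 1) * L_op M N k s p * L_op M N k s (Suc p) * (T_op M N k p + scale (inverse qq) 1))"
proof -
  define T where "T = T_op M N k p"
  define E where "E = unit_op M N k"
  define P where "P = P_op M N k p"
  define R where "R = R_op M N k p (qq ^ 2)"
  define L where "L = L_op M N k s p"
  define L' where "L' = L_op M N k s (Suc p)"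
  define S where "S = T + scale (inverse qq) 1"
  define c where "c = 1 - qq ^ 2"
  have c: "c \<noteq> 0" using qq_power_neq_1[of 2] by (simp add: c_def)
  have PR: "P * R = scale c (E * (T - scale qq 1))" unfolding P_def R_def c_def E_def T_def by (rule P_op_R_op_q2[OF p])
  \<comment> \<open>Since \<open>P\<^sup>2 = 1\<close> on the block, \<open>R\<close> is recovered from \<open>P R\<close>.\<close>
  have "R = E * R" by (simp add: E_def R_def unit_op_R_op)
  also have "\<dots> = P * (P * R)" by (simp add: P_def E_def P_op_P_op[OF p, symmetric] mult.assoc)
  finally have "R * S = P * scale c (E * ((T - scale qq 1) * S))" by (simp only: PR scaled.sc_mult_left mult.assoc)
  hence RS: "R * S = 0" using T_op_quadratic[OF p] by (simp add: T_def S_def)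
  have opS: "carrier_op M N k S" unfolding S_def T_def by (intro carrier_op_plus carrier_op_T_op p carrier_op_scale carrier_op_1)
  have opP: "carrier_op M N k P" unfolding P_def by (rule carrier_op_P_op[OF p])
  have "ideal_op M N k (P * (R * L * L' - L' * L * R) * S)"
    unfolding R_def L_def L'_def by (intro ideal_op_right ideal_op_left ideal_op_rll MN p opP opS)
  also have "P * (R * L * L' - L' * L * R) * S = (P * R) * L * L' * S - P * L' * L * (R * S)"
    by (simp only: right_diff_distrib left_diff_distrib mult.assoc)
  also have "\<dots> = scale c (E * (T - scale qq 1) * L * L' * S)" by (simp add: RS PR)
  also have "E * (T - scale qq 1) = (T - scale qq 1) * E"
    using T_op_unit_op[OF p, of M N] by (simp add: E_def T_def right_diff_distrib left_diff_distrib)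
  also have "(T - scale qq 1) * E * L = (T - scale qq 1) * L" by (simp add: mult.assoc E_def L_def unit_op_L_op)
  finally have "ideal_op M N k (scale (inverse c) (scale c ((T - scale qq 1) * L * L' * S)))" by (rule ideal_op_scale)
  thus ?thesis using c by (simp add: T_def L_def L'_def S_def)
qed

text \<open>
  The unit tensor at the end is the initial value of the product. The \<open>L\<close>-operators absorb it,
  so it only matters for \<open>k = 0\<close>.
\<close>
definition Lprod_op :: "nat \<Rightarrow> nat \<Rightarrow> nat \<Rightarrow> pm \<Rightarrow> (nat list, falg fps) linop" where
  "Lprod_op M N k s = prod_list (map (L_op M N k s) [0..<k]) * unit_op M N k"

lemma carrier_op_prod_list: "(\<And>F. F \<in> set Fs \<Longrightarrow> carrier_op M N k F) \<Longrightarrow> carrier_op M N k (prod_list Fs)"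
proof (induction Fs)
  case (Cons F Fs) thus ?case using carrier_op_times[of M N k F "prod_list Fs"] by simp
qed (simp only: prod_list.Nil carrier_op_1)

lemma prod_list_commute:
  fixes x :: "'a::monoid_mult"
  shows "(\<And>y. y \<in> set ys \<Longrightarrow> x * y = y * x) \<Longrightarrow> x * prod_list ys = prod_list ys * x"
proof (induction ys)
  case (Cons y ys)
  hence "x * y = y * x" "x * prod_list ys = prod_list ys * x" by simp_all
  thus ?case by (simp add: mult.assoc) (metis mult.assoc)
qed simp

text \<open>The factors of \<open>X\<close> outside the copies \<open>p+1\<close> and \<open>p+2\<close> commute with \<open>T\<close>.\<close>
lemma global_manin:
  assumes MN: "M \<noteq> N" and p: "Suc p < k"
  shows "ideal_op M N k ((T_op M N k p - scale qq 1) * Lprod_op M N k s * (T_op M N k p + scale (inverse qq) 1))"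
proof -
  define T where "T = T_op M N k p"
  define A where "A = prod_list (map (L_op M N k s) [0..<p])"
  define C where "C = prod_list (map (L_op M N k s) [Suc (Suc p)..<k])"
  define LL where "LL = L_op M N k s p * L_op M N k s (Suc p)"
  define E where "E = unit_op M N k"
  have "[0..<k] = [0..<p] @ [p..<k]" using p upt_add_eq_append[of 0 p "k - p"] by simp
  also have "[p..<k] = p # Suc p # [Suc (Suc p)..<k]" using p by (simp add: upt_conv_Cons)
  finally have X: "Lprod_op M N k s = A * LL * C * E" by (simp add: Lprod_op_def A_def C_def LL_def E_def mult.assoc)
  have TA: "T * A = A * T" unfolding A_def T_def using p by (intro prod_list_commute) (auto intro: T_op_L_op)
  have TC: "T * C = C * T" unfolding C_def T_def using p by (intro prod_list_commute) (auto intro: T_op_L_op)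
  have TE: "T * E = E * T" unfolding E_def T_def by (rule T_op_unit_op[OF p])
  have CE: "C * E * (T + scale (inverse qq) 1) = (T + scale (inverse qq) 1) * (C * E)"
  proof -
    have "C * E * T = T * (C * E)" unfolding mult.assoc[of C E T] TE[symmetric] mult.assoc[symmetric] TC ..
    thus ?thesis by (simp add: distrib_left distrib_right)
  qed
  have AT: "(T - scale qq 1) * A = A * (T - scale qq 1)"
    using TA by (simp add: left_diff_distrib right_diff_distrib)
  have "(T - scale qq 1) * Lprod_op M N k s * (T + scale (inverse qq) 1) =
    ((T - scale qq 1) * A) * LL * (C * E * (T + scale (inverse qq) 1))"
    by (simp only: X mult.assoc)
  also have "\<dots> = A * ((T - scale qq 1) * L_op M N k s p * L_op M N k s (Suc p) * (T + scale (inverse qq) 1)) * (C * E)"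
    unfolding AT CE LL_def by (simp only: mult.assoc)
  finally have e: "(T - scale qq 1) * Lprod_op M N k s * (T + scale (inverse qq) 1) =
     A * ((T - scale qq 1) * L_op M N k s p * L_op M N k s (Suc p) * (T + scale (inverse qq) 1)) * (C * E)" .
  have "carrier_op M N k A" "carrier_op M N k C"
    unfolding A_def C_def using p carrier_op_L_op by (intro carrier_op_prod_list; force)+
  thus ?thesis unfolding T_def[symmetric] e unfolding E_def T_def
    by (intro ideal_op_right ideal_op_left carrier_op_times local_manin MN p carrier_op_unit_op)
qed

lemma manin_trace_strace:
  assumes MN: "M \<noteq> N"
  shows "manin_trace scale {F. \<forall>n. fps_nth (strace M N k (F * Lprod_op M N k s)) n \<in> uq_ideal M N}
    {W. carrier_op M N k W} qq (T_gen M N k) k"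
proof -
  let ?K = "{F. \<forall>n. fps_nth (strace M N k (F * Lprod_op M N k s)) n \<in> uq_ideal M N}"
  show ?thesis
  proof (intro manin_trace.intro manin_trace_axioms.intro)
    show "scaled_ring scale" by (rule scaled.scaled_ring_axioms)
    show "0 \<in> ?K" using uq_ideal_0 by (simp add: strace_def entry_def)
    show "a + b \<in> ?K" if "a \<in> ?K" "b \<in> ?K" for a b
      using that by (simp add: distrib_right strace_plus uq_ideal_add)
    show "scale x a \<in> ?K" if "a \<in> ?K" for x a
      using that by (simp add: strace_scale scalar_def uq_ideal_scal)
    show "1 \<in> {W. carrier_op M N k W}" using carrier_op_1 by simp
    show "a + b \<in> {W. carrier_op M N k W}" if "a \<in> {W. carrier_op M N k W}" "b \<in> {W. carrier_op M N k W}" for a b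
      using that carrier_op_plus by simp
    show "a * b \<in> {W. carrier_op M N k W}" if "a \<in> {W. carrier_op M N k W}" "b \<in> {W. carrier_op M N k W}" for a b
      using that carrier_op_times by simp
    show "scale x a \<in> {W. carrier_op M N k W}" if "a \<in> {W. carrier_op M N k W}" for x a
      using that carrier_op_scale by simp
    show "T_gen M N k i \<in> {W. carrier_op M N k W}" if "1 \<le> i" "i < k" for i
      using that carrier_op_T_op[of "i - 1" k M N] by (simp add: T_gen_def)
    show "hecke scale qq (T_gen M N k) k" "hecke scale (- inverse qq) (T_gen M N k) k" by (rule hecke_T_gen)+
    fix W i assume W: "W \<in> {W. carrier_op M N k W}" and i: "1 \<le> i" "i < k"
    define T where "T = T_gen M N k i"
    define X where "X = Lprod_op M N k s"
    have p: "Suc (i - 1) < k" using i by simp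
    have cyc: "strace M N k ((T + scale (inverse qq) 1) * F) = strace M N k (F * (T + scale (inverse qq) 1))" for F
      using strace_T_op[OF p, of M N F] by (simp add: distrib_left distrib_right strace_plus T_def T_gen_def)
    have "ideal_op M N k (W * ((T - scale qq 1) * X * (T + scale (inverse qq) 1)))"
      using W ideal_op_left[OF _ global_manin[OF MN p, of s], of W] by (simp add: T_def T_gen_def X_def)
    hence "fps_nth (strace M N k (W * ((T - scale qq 1) * X * (T + scale (inverse qq) 1)))) n \<in> uq_ideal M N" for n
      by (rule strace_ideal)
    moreover have "strace M N k ((T + scale (inverse qq) 1) * W * (T - scale qq 1) * X) =
       strace M N k (W * ((T - scale qq 1) * X * (T + scale (inverse qq) 1)))"
      using cyc[of "W * (T - scale qq 1) * X"] by (simp only: mult.assoc)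
    ultimately show "(T_gen M N k i + scale (inverse qq) 1) * W * (T_gen M N k i - scale qq 1) \<in> ?K"
      unfolding T_def[symmetric] X_def[symmetric] by simp
  qed
qed

section \<open>The symmetrizers as operators, and the identities\<close>

text \<open>Scalars are even, so an even scalar tensor has no odd matrix units.\<close>
abbreviation cq_even :: "nat \<Rightarrow> nat \<Rightarrow> nat \<Rightarrow> cq tens \<Rightarrow> bool" where
  "cq_even M N k \<equiv> even_tens M N k id"

definition cq_op :: "nat \<Rightarrow> nat \<Rightarrow> nat \<Rightarrow> cq tens \<Rightarrow> (nat list, falg fps) linop" where
  "cq_op M N k X = tens_op M N k (tmap scalar X)"

lemma cq_op_tmul:
  assumes "cq_even M N k Y" shows "cq_op M N k (tmul M N k id X Y) = cq_op M N k X * cq_op M N k Y"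
proof -
  have "tmap scalar (tmul M N k id X Y) = tmul M N k id (tmap scalar X) (tmap scalar Y)"
    by (simp only: fun_eq_iff tmap_def tmul_def scalar_sum scalar_sign mult.assoc id_funpow id_apply) (simp only: scalar_mult simp_thms)
  moreover have "even_tens M N k id (tmap scalar Y)"
    using assms unfolding even_tens_def tmap_def by (metis scalar_sign id_apply)
  ultimately show ?thesis by (simp add: cq_op_def tens_op_tmul)
qed

lemma cq_op_tone: "cq_op M N k tone = unit_op M N k"
proof -
  have "tmap scalar tone = tone" by (simp add: fun_eq_iff tmap_def tone_def)
  thus ?thesis by (simp add: cq_op_def)
qed

lemma cq_op_lincomb: "cq_op M N k (\<lambda>I J. c * (\<Sum>x\<in>A. a x * X x I J)) = scale c (\<Sum>x\<in>A. scale (a x) (cq_op M N k (X x)))"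
proof (rule linop_eqI)
  fix v I
  have appsum: "app (\<Sum>x\<in>A. F x) v I = (\<Sum>x\<in>A. app (F x) v I)" for F :: "_ \<Rightarrow> (nat list, falg fps) linop"
    by (induction A rule: infinite_finite_induct) simp_all
  have "(\<Sum>J\<in>idx M N k. (- 1) ^ twist M k I J * scalar (c * (\<Sum>x\<in>A. a x * X x I J)) * v J) =
    (\<Sum>J\<in>idx M N k. \<Sum>x\<in>A. scalar c * (scalar (a x) * ((- 1) ^ twist M k I J * scalar (X x I J) * v J)))"
    by (intro sum.cong refl)
      (simp add: scalar_mult scalar_sum sum_distrib_left sum_distrib_right sgn_mult_sum sign_simps)
  also have "\<dots> = (\<Sum>x\<in>A. \<Sum>J\<in>idx M N k. scalar c * (scalar (a x) * ((- 1) ^ twist M k I J * scalar (X x I J) * v J)))"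
    by (rule sum.swap)
  finally show "app (cq_op M N k (\<lambda>I J. c * (\<Sum>x\<in>A. a x * X x I J))) v I =
      app (scale c (\<Sum>x\<in>A. scale (a x) (cq_op M N k (X x)))) v I"
    by (simp add: cq_op_def app_tens_op tmap_def appsum sum_distrib_left)
qed

lemma Pgr_parity: "odd (par M i + par M x + par M j + par M y) \<Longrightarrow> Pgr M N [i, j] [x, y] = 0"
  unfolding Pgr_def by (intro sum.neutral ballI) (auto simp: E2_def)

lemma tmap_place: "tmap scalar (place k as X) = place k as (tmap scalar X)"
  by (simp add: fun_eq_iff tmap_def place_def)

lemma cq_even_place2:
  assumes "\<And>i j x y. odd (par M i + par M x + par M j + par M y) \<Longrightarrow> X [i, j] [x, y] = 0" "Suc p < k"
  shows "cq_even M N k (place k [Suc p, Suc (Suc p)] X)"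
  using assms by (intro even_tens_place2) (auto simp: minus_one_power_iff)

lemma cq_even_Rcheck: "Suc p < k \<Longrightarrow> cq_even M N k (Rcheck M N k (Suc p))"
  unfolding Rcheck_def by (intro even_tens_tmul) (auto intro!: cq_even_place2 Pgr_parity Rzw_parity)

lemma cq_op_place2:
  assumes X: "\<And>i j x y. odd (par M i + par M x + par M j + par M y) \<Longrightarrow> X [i, j] [x, y] = 0" and p: "Suc p < k"
  shows "cq_op M N k (place k [Suc p, Suc (Suc p)] X) = two_site M N k p (\<lambda>i j x y. scalar ((- 1) ^ twist2 M i j x y * X [i, j] [x, y]))"
proof -
  have "tens_op M N k (place k [Suc p, Suc (Suc p)] (tmap scalar X)) = two_site M N k p (\<lambda>i j x y.
    (- 1) ^ ((par M i + par M x) * (par M x + par M y) + (par M j + par M y) * par M y) * tmap scalar X [i, j] [x, y])"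
    using X by (intro tens_op_place2[OF p]) (simp add: tmap_def)
  thus ?thesis by (simp add: cq_op_def tmap_place tmap_def scalar_sign twist2_def)
qed

text \<open>
  The generator \<open>P R(1,0)\<close> as a product of tensors corresponds to \<open>T_op\<close>, cut down to the
  multi-indices of length \<open>k\<close>.
\<close>
lemma cq_op_Rcheck: "Suc p < k \<Longrightarrow> cq_op M N k (Rcheck M N k (Suc p)) = unit_op M N k * T_op M N k p"
proof -
  assume p: "Suc p < k"
  have R: "Rzw M N qq 1 0 [i, j] [x, y] = 0" if "odd (par M i + par M x + par M j + par M y)" for i j x y
    using that by (intro Rzw_parity) auto
  have P: "Pgr M N [i, j] [x, y] = 0" if "odd (par M i + par M x + par M j + par M y)" for i j x y
    using that by (rule Pgr_parity)
  have "cq_op M N k (place k [Suc p, Suc (Suc p)] (Pgr M N)) = P_op M N k p"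
    unfolding P_op_def by (rule cq_op_place2[OF _ p]) (rule P)
  moreover have "cq_op M N k (place k [Suc p, Suc (Suc p)] (Rzw M N qq 1 0)) = R_op M N k p 0"
    unfolding R_op_def by (rule cq_op_place2[OF _ p]) (rule R)
  moreover have "cq_even M N k (place k [Suc p, Suc (Suc p)] (Rzw M N qq 1 0))"
    by (rule cq_even_place2[OF _ p]) (rule R)
  ultimately have "cq_op M N k (Rcheck M N k (Suc p)) = P_op M N k p * R_op M N k p 0"
    by (simp add: Rcheck_def cq_op_tmul)
  thus ?thesis by (simp add: P_op_R_op_0[OF p])
qed

definition T_word :: "nat \<Rightarrow> nat \<Rightarrow> nat \<Rightarrow> nat \<Rightarrow> nat list \<Rightarrow> cq tens" where
  "T_word M N k off u = foldr (\<lambda>i X. tmul M N k id (Rcheck M N k (off + i)) X) u tone"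

lemma T_word_props:
  assumes "off + m \<le> k" "set u \<subseteq> {1..<m}"
  shows "cq_even M N k (T_word M N k off u)"
    and "cq_op M N k (T_word M N k off u) = unit_op M N k * prod_list (map (\<lambda>i. T_gen M N k (off + i)) u)"
proof -
  have "cq_even M N k (T_word M N k off u) \<and>
    cq_op M N k (T_word M N k off u) = unit_op M N k * prod_list (map (\<lambda>i. T_gen M N k (off + i)) u)"
    using assms(2)
  proof (induction u)
    case Nil
    have "cq_even M N k tone" by (rule even_tens_tone) simp_all
    moreover have "T_word M N k off [] = tone" by (simp add: T_word_def)
    ultimately show ?case by (simp only: cq_op_tone list.map prod_list.Nil mult_1_right simp_thms)
  next
    case (Cons i u)
    define p where "p = off + i - 1"
    have p: "off + i = Suc p" "Suc p < k" using Cons.prems assms(1) by (auto simp: p_def)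
    define Y where "Y = T_word M N k off u"
    have Y: "cq_even M N k Y" "cq_op M N k Y = unit_op M N k * prod_list (map (\<lambda>i. T_gen M N k (off + i)) u)"
    proof -
      have "set u \<subseteq> {1..<m}" using Cons.prems by simp
      from Cons.IH[OF this] show "cq_even M N k Y" "cq_op M N k Y = unit_op M N k * prod_list (map (\<lambda>i. T_gen M N k (off + i)) u)"
        unfolding Y_def by blast+
    qed
    have W: "T_word M N k off (i # u) = tmul M N k id (Rcheck M N k (Suc p)) Y"
      by (simp add: T_word_def Y_def p)
    have "cq_op M N k (T_word M N k off (i # u)) = (unit_op M N k * T_op M N k p) * (unit_op M N k * prod_list (map (\<lambda>i. T_gen M N k (off + i)) u))"
      unfolding W cq_op_tmul[OF Y(1)] cq_op_Rcheck[OF p(2)] Y(2) ..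
    also have "\<dots> = unit_op M N k * (T_op M N k p * unit_op M N k) * prod_list (map (\<lambda>i. T_gen M N k (off + i)) u)"
      by (simp only: mult.assoc)
    also have "\<dots> = (unit_op M N k * unit_op M N k) * (T_op M N k p * prod_list (map (\<lambda>i. T_gen M N k (off + i)) u))"
      by (simp only: T_op_unit_op[OF p(2)] mult.assoc)
    also have "\<dots> = unit_op M N k * prod_list (map (\<lambda>i. T_gen M N k (off + i)) (i # u))"
      by (simp add: unit_op_idem T_gen_def p(1))
    finally have "cq_op M N k (T_word M N k off (i # u)) = unit_op M N k * prod_list (map (\<lambda>i. T_gen M N k (off + i)) (i # u))" .
    moreover have "cq_even M N k (T_word M N k off (i # u))"
      unfolding W by (intro even_tens_tmul cq_even_Rcheck Y p) auto
    ultimately show ?case by blast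
  qed
  thus "cq_even M N k (T_word M N k off u)"
    "cq_op M N k (T_word M N k off u) = unit_op M N k * prod_list (map (\<lambda>i. T_gen M N k (off + i)) u)" by blast+
qed

lemma Tperm_T_word: "Tperm M N k off m \<sigma> = T_word M N k off (SOME is. reduced m \<sigma> is)"
  by (simp add: Tperm_def T_word_def)

text \<open>
  The common form of the symmetrizer (\<open>t = q\<close>) and the antisymmetrizer (\<open>t = -q\<^sup>-\<^sup>1\<close>) with a
  normalizing factor \<open>c\<close>.
\<close>
definition hecke_sum :: "nat \<Rightarrow> nat \<Rightarrow> nat \<Rightarrow> nat \<Rightarrow> nat \<Rightarrow> cq \<Rightarrow> cq \<Rightarrow> cq tens" where
  "hecke_sum M N k off m c t = (\<lambda>I J. c * (\<Sum>\<sigma> | \<sigma> permutes {1..m}. t ^ perm_len m \<sigma> * Tperm M N k off m \<sigma> I J))"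

lemma cq_op_hecke_sum:
  assumes "off + m \<le> k"
  shows "cq_op M N k (hecke_sum M N k off m c t) = scale c (unit_op M N k * scaled.qsum t (\<lambda>i. T_gen M N k (off + i)) m)"
proof -
  let ?U = "\<lambda>i. T_gen M N k (off + i)"
  let ?F = "\<lambda>l u. scale (t ^ l) (cq_op M N k (T_word M N k off u))"
  have U1: "?U i * ?U j = ?U j * ?U i" if "i \<in> {1..<m}" "j \<in> {1..<m}" "Suc i < j" for i j
    using hecke.far_comm[OF hecke_T_gen(1), of "off + i" "off + j" k M N] that assms by simp
  have U2: "?U i * ?U (Suc i) * ?U i = ?U (Suc i) * ?U i * ?U (Suc i)" if "i \<in> {1..<m}" "Suc i \<in> {1..<m}" for i
    using hecke.braid_rel[OF hecke_T_gen(1), of "off + i" k M N] that assms by simp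
  \<comment> \<open>The product along a reduced word only depends on its braid class, so the chosen words may be
    replaced by normal words.\<close>
  have "(\<Sum>\<sigma> | \<sigma> permutes {1..m}. ?F (perm_len m \<sigma>) (SOME is. reduced m \<sigma> is)) = (\<Sum>w\<in>normal_words m. ?F (length w) w)"
  proof (rule sum_reduced_words)
    fix w u assume w: "w \<in> normal_words m" "braid_eq u w" "set u \<subseteq> {1..<m}"
    have "prod_list (map ?U u) = prod_list (map ?U w)"
      by (rule braid_eq_prod_list[OF w(2,3)]) (rule U1, assumption+, rule U2, assumption+)
    thus "?F (length w) u = ?F (length w) w"
      using T_word_props(2)[OF assms w(3)] T_word_props(2)[OF assms normal_words_set[OF w(1)]] by simp
  qed
  also have "\<dots> = (\<Sum>w\<in>normal_words m. unit_op M N k * scale (t ^ length w) (prod_list (map ?U w)))"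
    by (intro sum.cong refl) (simp add: T_word_props(2)[OF assms normal_words_set])
  also have "\<dots> = unit_op M N k * scaled.qsum t ?U m"
    by (simp only: sum_distrib_left[symmetric] scaled.qsum_words)
  finally show ?thesis
    unfolding hecke_sum_def cq_op_lincomb Tperm_T_word by simp
qed

lemma cq_even_hecke_sum:
  assumes "off + m \<le> k"
  shows "cq_even M N k (hecke_sum M N k off m c t)"
  unfolding even_tens_def
proof safe
  fix I J assume IJ: "I \<in> idx M N k" "J \<in> idx M N k"
  have "t ^ perm_len m \<sigma> * Tperm M N k off m \<sigma> I J =
    (- 1) ^ tparity M k I J * (t ^ perm_len m \<sigma> * Tperm M N k off m \<sigma> I J)" if \<sigma>: "\<sigma> permutes {1..m}" for \<sigma>
  proof -
    obtain w where w: "w \<in> normal_words m" "perm_of w = \<sigma>" using normal_words_surj[OF \<sigma>] by blast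
    have "reduced m \<sigma> (SOME is. reduced m \<sigma> is)"
      using reduced_normal_words[OF w(1)] w(2) by (metis someI)
    hence "set (SOME is. reduced m \<sigma> is) \<subseteq> {1..<m}" using reduced_braid_eq(2)[OF w(1)] w(2) by simp
    from T_word_props(1)[OF assms this, of M N] IJ
    have "Tperm M N k off m \<sigma> I J = (- 1) ^ tparity M k I J * Tperm M N k off m \<sigma> I J"
      unfolding Tperm_T_word even_tens_def by simp
    thus ?thesis by (metis mult.left_commute)
  qed
  hence "(\<Sum>\<sigma> | \<sigma> permutes {1..m}. t ^ perm_len m \<sigma> * Tperm M N k off m \<sigma> I J) =
    (- 1) ^ tparity M k I J * (\<Sum>\<sigma> | \<sigma> permutes {1..m}. t ^ perm_len m \<sigma> * Tperm M N k off m \<sigma> I J)"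
    (is "?S = _") unfolding sum_distrib_left by (intro sum.cong refl) auto
  hence "c * ?S = c * ((- 1) ^ tparity M k I J * ?S)" by (rule arg_cong)
  also have "\<dots> = (- 1) ^ tparity M k I J * (c * ?S)" by (rule mult.left_commute)
  finally show "id (hecke_sum M N k off m c t I J) = (- 1) ^ tparity M k I J * hecke_sum M N k off m c t I J"
    by (simp only: hecke_sum_def id_apply)
qed

lemma qnum_qint: "qnum qq (Suc n) = qq ^ n * qint (Suc n)"
proof -
  have nz: "qq * qq - 1 \<noteq> 0" using qq_power_neq_1[of 2] by (simp add: power2_eq_square)
  hence nz': "qq - inverse qq \<noteq> 0" by (simp add: field_simps)
  have 1: "qq * (qq - inverse qq) = qq * qq - 1" by (simp add: right_diff_distrib)
  have 2: "qq ^ Suc n * inverse qq ^ Suc n = 1" by (simp add: power_mult_distrib[symmetric] del: power_Suc)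
  have "(qq * qq - 1) * (qq ^ n * qint (Suc n)) = qq ^ Suc n * ((qq - inverse qq) * qint (Suc n))"
    by (simp add: 1[symmetric])
  also have "(qq - inverse qq) * qint (Suc n) = qq ^ Suc n - inverse qq ^ Suc n"
    using nz' by (simp add: qint_def)
  also have "qq ^ Suc n * \<dots> = qq ^ (2 * Suc n) - 1"
    unfolding right_diff_distrib 2 by (simp only: power_add[symmetric] mult_2)
  also have "\<dots> = (qq * qq - 1) * qnum qq (Suc n)" by (simp only: qnum_closed)
  finally show ?thesis using nz by simp
qed

lemma qnum_qint': "qnum (- inverse qq) (Suc n) = inverse (qq ^ n) * qint (Suc n)"
proof -
  have "qq ^ n * (qq ^ n * qnum (- inverse qq) (Suc n)) = qq ^ n * qint (Suc n)"
    using qnum_inverse[of qq n] by (simp add: qnum_qint power_mult power_mult_distrib power2_eq_square mult_ac)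
  hence "qq ^ n * qnum (- inverse qq) (Suc n) = qint (Suc n)" by simp
  thus ?thesis by (simp add: field_simps)
qed

lemma tri_Suc: "Suc m * (Suc m - 1) div 2 = m * (m - 1) div 2 + m"
proof (cases m)
  case (Suc p)
  have "Suc m * (Suc m - 1) = m * (m - 1) + m * 2" using Suc by (simp add: algebra_simps)
  thus ?thesis by simp
qed simp

text \<open>
  The powers of \<open>q\<close> in the definitions of the (anti)symmetrizers are exactly those that turn
  \<open>[m]!\<close> into the product of the eigenvalues of the coset sums.
\<close>
lemma qnum_fact_qfact:
  "qnum_fact qq m = qq powi int (m * (m - 1) div 2) * qfact m"
  "qnum_fact (- inverse qq) m = qq powi - int (m * (m - 1) div 2) * qfact m"
proof -
  have f: "qfact (Suc m) = qfact m * qint (Suc m)" for m by (simp add: qfact_def)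
  show "qnum_fact qq m = qq powi int (m * (m - 1) div 2) * qfact m"
  proof (induction m)
    case (Suc m) thus ?case
      unfolding tri_Suc qnum_fact_Suc f qnum_qint by (simp add: power_int_add power_add)
  qed (simp add: qfact_def)
  show "qnum_fact (- inverse qq) m = qq powi - int (m * (m - 1) div 2) * qfact m"
  proof (induction m)
    case (Suc m) thus ?case
      unfolding tri_Suc qnum_fact_Suc f qnum_qint' power_int_minus by (simp add: power_int_add power_add)
  qed (simp add: qfact_def)
qed

lemma cq_op_qsym:
  assumes "off + m \<le> k"
  shows "cq_op M N k (qsym M N k off m) = unit_op M N k * scaled.qproj qq (\<lambda>i. T_gen M N k (off + i)) m"
    and "cq_even M N k (qsym M N k off m)"
proof -
  have q: "qsym M N k off m = hecke_sum M N k off m (inverse (qnum_fact qq m)) qq"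
    by (intro ext) (simp add: qsym_def hecke_sum_def qnum_fact_qfact power_int_minus divide_inverse)
  show "cq_op M N k (qsym M N k off m) = unit_op M N k * scaled.qproj qq (\<lambda>i. T_gen M N k (off + i)) m"
    unfolding q cq_op_hecke_sum[OF assms] scaled.qproj_def by simp
  show "cq_even M N k (qsym M N k off m)" unfolding q by (rule cq_even_hecke_sum[OF assms])
qed

lemma cq_op_qantisym:
  assumes "off + m \<le> k"
  shows "cq_op M N k (qantisym M N k off m) = unit_op M N k * scaled.qproj (- inverse qq) (\<lambda>i. T_gen M N k (off + i)) m"
    and "cq_even M N k (qantisym M N k off m)"
proof -
  have s: "(- qq) powi - int l = (- inverse qq) ^ l" for l
    by (simp only: power_int_minus power_int_of_nat power_inverse[symmetric] inverse_minus_eq)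
  have q: "qantisym M N k off m = hecke_sum M N k off m (inverse (qnum_fact (- inverse qq) m)) (- inverse qq)"
    by (intro ext) (simp only: qantisym_def hecke_sum_def s, simp add: qnum_fact_qfact power_int_minus divide_inverse)
  show "cq_op M N k (qantisym M N k off m) = unit_op M N k * scaled.qproj (- inverse qq) (\<lambda>i. T_gen M N k (off + i)) m"
    unfolding q cq_op_hecke_sum[OF assms] scaled.qproj_def by simp
  show "cq_even M N k (qantisym M N k off m)" unfolding q by (rule cq_even_hecke_sum[OF assms])
qed

lemma tens_op_Lprod:
  "even_tens M N k (grinv_fps M) (Lprod M N k s) \<and> tens_op M N k (Lprod M N k s) = Lprod_op M N k s"
proof -
  let ?g = "grinv_fps M"
  let ?f = "\<lambda>as. foldr (\<lambda>a X. tmul M N k ?g (place k [a] (Lser s (qq ^ (2 * a - 2)))) X) as tone"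
  have g1: "?g 1 = 1" and g0: "?g 0 = 0"
    using grinv_fps_const[of M 1] grinv_fps_const[of M 0] by simp_all
  have L: "?g (Lser s c [i] [j]) = (- 1) ^ (par M i + par M j) * Lser s c [i] [j]" for c i j
    by (rule fps_ext) (simp add: fps_nth_sign, simp add: grinv_fps_def Lser_def grinv_mult grinv_gen minus_one_power_iff)
  have *: "even_tens M N k ?g (?f as) \<and>
    tens_op M N k (?f as) = prod_list (map (\<lambda>a. L_op M N k s (a - 1)) as) * unit_op M N k"
    if "set as \<subseteq> {1..k}" for as
    using that
  proof (induction as)
    case Nil thus ?case using even_tens_tone[OF g0 g1] by simp
  next
    case (Cons a as)
    then obtain p where a: "a = Suc p" and p: "p < k" by (cases a) auto
    define Y where "Y = ?f as"
    have Y: "even_tens M N k ?g Y" "tens_op M N k Y = prod_list (map (\<lambda>a. L_op M N k s (a - 1)) as) * unit_op M N k"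
      using Cons by (simp_all add: Y_def)
    have f: "?f (a # as) = tmul M N k ?g (place k [Suc p] (Lser s (qq ^ (2 * p)))) Y"
      by (simp add: Y_def a)
    have "even_tens M N k ?g (?f (a # as))"
      unfolding f by (intro even_tens_tmul even_tens_place_L Y L g0 p grinv_fps_uminus grinv_fps_add grinv_fps_mult)
    moreover have "tens_op M N k (?f (a # as)) = L_op M N k s p * tens_op M N k Y"
      unfolding f by (simp only: tens_op_tmul[OF Y(1) grinv_fps_uminus] tens_op_place1[OF p] L_op_def)
    ultimately show ?case unfolding Y(2) by (simp add: a mult.assoc)
  qed
  have "map (\<lambda>a. L_op M N k s (a - 1)) [1..<k + 1] = map (L_op M N k s) [0..<k]"
    by (rule nth_equalityI) (simp_all del: upt_Suc)
  moreover have "set [1..<k + 1] \<subseteq> {1..k}" by auto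
  ultimately show ?thesis using *[of "[1..<k + 1]"] unfolding Lprod_def Lprod_op_def by simp
qed

lemma str_with_L_eq: "str_with_L M N k s X = strace M N k (cq_op M N k X * Lprod_op M N k s)"
proof -
  have h: "(\<lambda>c. fps_const (scal c)) = scalar" by (simp add: fun_eq_iff scalar_def)
  show ?thesis unfolding str_with_L_def h str_eq cq_op_def strace_def
    using tens_op_Lprod[of M N k s] by (simp add: tens_op_tmul grinv_fps_uminus)
qed

lemma strace_sign: "(- 1) ^ r * strace M N k F = strace M N k ((- 1) ^ r * F)"
proof -
  have "strace M N k (- F) = - strace M N k F"
    using strace_minus[of M N k 0 F] by (simp add: strace_def entry_def sum_negf)
  thus ?thesis by (simp add: minus_one_power_iff)
qed

lemma strace_sum: "strace M N k (sum F A) = (\<Sum>x\<in>A. strace M N k (F x))"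
  by (induction A rule: infinite_finite_induct) (simp_all add: strace_plus, simp_all add: strace_def entry_def)

lemma unit_op_qproj: "off + m \<le> k \<Longrightarrow> unit_op M N k * scaled.qproj t (\<lambda>i. T_gen M N k (off + i)) m = scaled.qproj t (\<lambda>i. T_gen M N k (off + i)) m * unit_op M N k"
proof (rule scaled.qproj_commute)
  fix i assume "off + m \<le> k" "1 \<le> i" "i < m"
  hence "Suc (off + i - 1) < k" by simp
  thus "unit_op M N k * T_gen M N k (off + i) = T_gen M N k (off + i) * unit_op M N k"
    unfolding T_gen_def by (rule T_op_unit_op[symmetric])
qed

lemma unit_op_Lprod_op: "k \<ge> 1 \<Longrightarrow> unit_op M N k * Lprod_op M N k s = Lprod_op M N k s"
  by (simp add: Lprod_op_def upt_conv_Cons mult.assoc[symmetric] unit_op_L_op)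

text \<open>
  Both identities at once, \<open>t = q\<close> for the first and \<open>t = -q\<^sup>-\<^sup>1\<close> for the second. The projections
  onto the multi-indices of length \<open>k\<close> commute with the Hecke operators and are absorbed by the
  product of the \<open>L\<close>-operators, after which the abstract identity applies.
\<close>
lemma macmahon_tensor:
  assumes MN: "M \<noteq> N" and k: "k \<ge> 1" and t: "t = qq \<or> t = - inverse qq"
    and X: "\<And>r. r \<le> k \<Longrightarrow> cq_op M N k (X r) = unit_op M N k * scaled.qproj t (T_gen M N k) r"
    and Y: "\<And>r. r \<le> k \<Longrightarrow> cq_op M N k (Y r) = unit_op M N k * scaled.qproj (- inverse t) (\<lambda>i. T_gen M N k (r + i)) (k - r)"
    and evY: "\<And>r. r \<le> k \<Longrightarrow> cq_even M N k (Y r)"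
  shows "uq_proj M N (fps_nth (\<Sum>r\<le>k. (- 1) ^ r * str_with_L M N k s (tmul M N k id (X r) (Y r))) n) = \<zero>\<^bsub>Uq M N\<^esub>"
proof -
  let ?P = "\<lambda>r. scaled.qproj t (T_gen M N k) r" and ?Q = "\<lambda>r. scaled.qproj (- inverse t) (\<lambda>i. T_gen M N k (r + i)) (k - r)"
  have summand: "(- 1) ^ r * str_with_L M N k s (tmul M N k id (X r) (Y r)) =
      strace M N k ((- 1) ^ r * (?P r * ?Q r) * Lprod_op M N k s)" if "r \<le> k" for r
  proof -
    have "cq_op M N k (tmul M N k id (X r) (Y r)) = unit_op M N k * ?P r * (unit_op M N k * ?Q r)"
      using cq_op_tmul[OF evY[OF that]] X[OF that] Y[OF that] by simp
    also have "unit_op M N k * ?P r = ?P r * unit_op M N k" using unit_op_qproj[of 0 r k M N t] that by simp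
    also have "unit_op M N k * ?Q r = ?Q r * unit_op M N k" using that by (intro unit_op_qproj) auto
    finally have "cq_op M N k (tmul M N k id (X r) (Y r)) * Lprod_op M N k s =
        ?P r * (unit_op M N k * ?Q r) * (unit_op M N k * Lprod_op M N k s)" by (simp only: mult.assoc)
    also have "\<dots> = ?P r * ?Q r * (unit_op M N k * (unit_op M N k * Lprod_op M N k s))"
      using unit_op_qproj[of r "k - r" k M N "- inverse t"] that by (simp add: mult.assoc)
    finally show ?thesis by (simp add: str_with_L_eq strace_sign unit_op_Lprod_op[OF k] mult.assoc)
  qed
  interpret manin_trace scale "{F. \<forall>n. fps_nth (strace M N k (F * Lprod_op M N k s)) n \<in> uq_ideal M N}"
    "{W. carrier_op M N k W}" qq "T_gen M N k" k
    by (rule manin_trace_strace[OF MN])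
  have "(\<Sum>r\<le>k. (- 1) ^ r * str_with_L M N k s (tmul M N k id (X r) (Y r))) =
    strace M N k ((\<Sum>r\<le>k. (- 1) ^ r * (?P r * ?Q r)) * Lprod_op M N k s)"
    by (simp add: summand strace_sum sum_distrib_right)
  thus ?thesis using macmahon[OF t k] by (intro uq_proj_zero) simp
qed

theorem theorem1p3:
  fixes M N k :: nat and s :: pm
  assumes "M \<noteq> N" and "k \<ge> 1"
  shows "(\<forall>n. uq_proj M N (fps_nth
           (\<Sum>r\<le>k. (-1) ^ r *
              str_with_L M N k s
                (tmul M N k id (qsym M N k 0 r) (qantisym M N k r (k - r)))) n)
           = \<zero>\<^bsub>Uq M N\<^esub>) \<and>
         (\<forall>n. uq_proj M N (fps_nth
           (\<Sum>r\<le>k. (-1) ^ r *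
              str_with_L M N k s
                (tmul M N k id (qantisym M N k 0 r) (qsym M N k r (k - r)))) n)
           = \<zero>\<^bsub>Uq M N\<^esub>)"
proof (intro conjI allI)
  fix n
  show "uq_proj M N (fps_nth
           (\<Sum>r\<le>k. (-1) ^ r *
              str_with_L M N k s
                (tmul M N k id (qsym M N k 0 r) (qantisym M N k r (k - r)))) n)
           = \<zero>\<^bsub>Uq M N\<^esub>"
    by (rule macmahon_tensor[OF assms, of qq])
      (use cq_op_qsym[of 0 _ k M N] cq_op_qantisym[of _ _ k M N] in auto)
  show "uq_proj M N (fps_nth
           (\<Sum>r\<le>k. (-1) ^ r *
              str_with_L M N k s
                (tmul M N k id (qantisym M N k 0 r) (qsym M N k r (k - r)))) n)
           = \<zero>\<^bsub>Uq M N\<^esub>"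
    by (rule macmahon_tensor[OF assms, of "- inverse qq"])
      (use cq_op_qantisym[of 0 _ k M N] cq_op_qsym[of _ _ k M N] in auto)
qed

end
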